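(* The Liouville function $\lambda$ is not moderately aperiodic.
   Context: $\lambda(n)=(-1)^{\Omega(n)}$, where $\Omega(n)$ is the number of prime divisors of $n$ counted with multiplicity. $\mathcal{M}$ is the class of multiplicative functions $f:\mathbb{N}\to\mathbb{C}$ with $|f|\le1$. $f\in\mathcal{M}$ is aperiodic if its Cesàro averages along every infinite arithmetic progression tend to $0$. $f$ is moderately aperiodic if $f$ is aperiodic and for some $A>0$, $$\lim_{X\to\infty}\frac1{\log\log X}\inf_{|t|\le X^A}\min_{\chi\bmod q,\ q\le(\log X)^A}\sum_{p\le X}\frac1p\big(1-\mathrm{Re}(f(p)\chi(p)p^{it})\big)=0,$$ where $p$ runs over primes and $\chi$ over Dirichlet characters of modulus $q$. *)

theory Defs
  imports "HOL-Analysis.Analysis" "HOL-Number_Theory.Number_Theory"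
begin

unbundle no vec_syntax  (* frees the letter \<chi> *)

text \<open>
  Arithmetic functions are total functions on \<^typ>\<open>nat\<close>; the argument \<open>0\<close> lies outside the
  domain of the mathematical functions, and no definition below depends on the value there.
\<close>

definition multiplicative_functions :: "(nat \<Rightarrow> complex) set" ("\<M>") where
  "\<M> = {f. f 1 = 1 \<and>
           (\<forall>m n. m > 0 \<and> n > 0 \<and> coprime m n \<longrightarrow> f (m * n) = f m * f n) \<and>
           (\<forall>n>0. norm (f n) \<le> 1)}"

definition liouville :: "nat \<Rightarrow> complex" where
  "liouville n = (-1) ^ size (prime_factorization n)"

definition aperiodic :: "(nat \<Rightarrow> complex) \<Rightarrow> bool" where
  "aperiodic f \<longleftrightarrow> f \<in> \<M> \<and>
     (\<forall>a b. a > 0 \<longrightarrow> (\<lambda>N. (\<Sum>n=1..N. f (a * n + b)) / of_nat N) \<longlonglongrightarrow> 0)"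

definition dirichlet_character :: "nat \<Rightarrow> (nat \<Rightarrow> complex) \<Rightarrow> bool" where
  "dirichlet_character q \<chi> \<longleftrightarrow> q > 0 \<and>
     (\<forall>a b. \<chi> (a * b) = \<chi> a * \<chi> b) \<and>
     (\<forall>a. \<chi> (a + q) = \<chi> a) \<and>
     (\<forall>a. \<chi> a \<noteq> 0 \<longleftrightarrow> coprime a q)"

definition prime_distance :: "(nat \<Rightarrow> complex) \<Rightarrow> (nat \<Rightarrow> complex) \<Rightarrow> real \<Rightarrow> real \<Rightarrow> real" where
  "prime_distance f \<chi> t X =
     (\<Sum>p | prime p \<and> real p \<le> X.
        1 / real p * (1 - Re (f p * \<chi> p * of_nat p powr (\<i> * of_real t))))"

definition moderately_aperiodic :: "(nat \<Rightarrow> complex) \<Rightarrow> bool" where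
  "moderately_aperiodic f \<longleftrightarrow> aperiodic f \<and>
     (\<exists>A>0. ((\<lambda>X::real. 1 / ln (ln X) *
        (INF t\<in>{t. \<bar>t\<bar> \<le> X powr A}.
           Min {prime_distance f \<chi> t X | q \<chi>.
                  real q \<le> ln X powr A \<and> dirichlet_character q \<chi>})) \<longlongrightarrow> 0) at_top)"

text \<open>
  Class \<open>\<M>\<close> contains the Liouville function, so the membership condition in \<^const>\<open>aperiodic\<close> holds
  for it. The sets under \<^const>\<open>Min\<close> and \<^const>\<open>Inf\<close> are finite and bounded below, respectively,
  and they are nonempty for large \<open>X\<close>, so that these operators denote the actual minimum and
  infimum.
\<close>

lemma liouville_in_multiplicative_functions: "liouville \<in> \<M>"
  by (auto simp: multiplicative_functions_def liouville_def prime_factorization_mult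
        power_add norm_power)

lemma dirichlet_character_mod:
  assumes "dirichlet_character q \<chi>"
  shows "\<chi> (a mod q) = \<chi> a"
proof -
  have "\<chi> (b + k * q) = \<chi> b" for b k
  proof (induction k)
    case (Suc k)
    have "\<chi> (b + Suc k * q) = \<chi> ((b + k * q) + q)" by (simp add: algebra_simps)
    then show ?case using Suc assms by (simp add: dirichlet_character_def)
  qed simp
  from this[of "a mod q" "a div q"] show ?thesis by (simp add: mult.commute)
qed

lemma dirichlet_character_one:
  assumes "dirichlet_character q \<chi>"
  shows "\<chi> 1 = 1"
proof -
  have "\<chi> (1 * 1) = \<chi> 1 * \<chi> 1" "\<chi> 1 \<noteq> 0 \<longleftrightarrow> coprime 1 q"
    using assms unfolding dirichlet_character_def by blast+
  then show ?thesis by simp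
qed

lemma dirichlet_character_root_of_unity:
  assumes "dirichlet_character q \<chi>" "coprime a q"
  shows "\<chi> a ^ totient q = 1"
proof -
  have pow: "\<chi> (a ^ k) = \<chi> a ^ k" for k
    using assms(1) dirichlet_character_one[OF assms(1)]
    by (induction k) (auto simp: dirichlet_character_def)
  have "[a ^ totient q = 1] (mod q)" by (rule euler_theorem[OF assms(2)])
  then have "\<chi> (a ^ totient q) = \<chi> 1"
    by (metis assms(1) cong_def dirichlet_character_mod)
  then show ?thesis using pow dirichlet_character_one[OF assms(1)] by simp
qed

lemma norm_dirichlet_character_le_1:
  assumes "dirichlet_character q \<chi>"
  shows "norm (\<chi> a) \<le> 1"
proof (cases "coprime a q")
  case True
  have "totient q > 0" using assms by (simp add: dirichlet_character_def)
  then show ?thesis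
    using power_eq_1_iff[OF dirichlet_character_root_of_unity[OF assms True]] by auto
next
  case False
  then show ?thesis using assms by (auto simp: dirichlet_character_def)
qed

lemma finite_dirichlet_characters: "finite {\<chi>. dirichlet_character q \<chi>}"
proof (cases "q > 0")
  case True
  let ?R = "insert 0 {z::complex. z ^ totient q = 1}"
  have "totient q > 0" using True by simp
  then have "finite {z::complex. z ^ totient q = 1}"
    by (intro finite_roots_unity) linarith
  then have fin: "finite (PiE {..<q} (\<lambda>_. ?R))" by (intro finite_PiE) auto
  have "inj_on (\<lambda>\<chi>. restrict \<chi> {..<q}) {\<chi>. dirichlet_character q \<chi>}"
  proof (rule inj_onI, clarsimp, rule ext)
    fix \<chi> \<psi> a assume c: "dirichlet_character q \<chi>" "dirichlet_character q \<psi>"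
      and eq: "restrict \<chi> {..<q} = restrict \<psi> {..<q}"
    have "a mod q < q" using True by simp
    then have "\<chi> (a mod q) = \<psi> (a mod q)" using fun_cong[OF eq, of "a mod q"] by simp
    then show "\<chi> a = \<psi> a" using c by (simp add: dirichlet_character_mod)
  qed
  moreover have "(\<lambda>\<chi>. restrict \<chi> {..<q}) ` {\<chi>. dirichlet_character q \<chi>} \<subseteq> PiE {..<q} (\<lambda>_. ?R)"
  proof (intro image_subsetI PiE_I)
    fix \<chi> a assume c: "\<chi> \<in> {\<chi>. dirichlet_character q \<chi>}" and "a \<in> {..<q}"
    have "\<chi> a \<in> ?R"
      using c dirichlet_character_root_of_unity[of q \<chi> a]
      by (cases "coprime a q") (auto simp: dirichlet_character_def)
    then show "restrict \<chi> {..<q} a \<in> ?R" using \<open>a \<in> {..<q}\<close> by simp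
  qed simp
  ultimately show ?thesis using fin by (meson finite_imageD finite_subset)
qed (simp add: dirichlet_character_def)

lemma finite_prime_distances:
  "finite {prime_distance f \<chi> t X | q \<chi>. real q \<le> B \<and> dirichlet_character q \<chi>}"
proof -
  have "finite {q. real q \<le> B}"
    by (rule finite_subset[of _ "{..nat \<lfloor>B\<rfloor>}"]) (auto simp: le_nat_floor)
  then have "finite (\<Union>q\<in>{q. real q \<le> B}. {\<chi>. dirichlet_character q \<chi>})"
    using finite_dirichlet_characters by (intro finite_UN_I)
  then have "finite ((\<lambda>\<chi>. prime_distance f \<chi> t X) `
      (\<Union>q\<in>{q. real q \<le> B}. {\<chi>. dirichlet_character q \<chi>}))" by simp
  then show ?thesis by (rule finite_subset[rotated]) auto
qed

lemma prime_distances_nonempty: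
  assumes "B \<ge> 1"
  shows "{prime_distance f \<chi> t X | q \<chi>. real q \<le> B \<and> dirichlet_character q \<chi>} \<noteq> {}"
proof -
  have "dirichlet_character 1 (\<lambda>_. 1)" by (simp add: dirichlet_character_def)
  then show ?thesis using assms by (intro notI) (force dest!: equals0D[where a = "prime_distance f (\<lambda>_. 1) t X"])
qed

lemma prime_distance_nonneg:
  assumes "f \<in> \<M>" "dirichlet_character q \<chi>"
  shows "prime_distance f \<chi> t X \<ge> 0"
proof -
  have "Re (f p * \<chi> p * of_nat p powr (\<i> * of_real t)) \<le> 1" if "prime p" for p
  proof -
    have p: "p > 0" using that by (simp add: prime_gt_0_nat)
    then have "norm (of_nat p powr (\<i> * of_real t) :: complex) = 1"
      using norm_powr_real_powr'[of "of_nat p" "\<i> * of_real t"]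
      by (simp add: norm_powr_real)
    moreover have "norm (f p) \<le> 1" using assms(1) p by (simp add: multiplicative_functions_def)
    ultimately have "norm (f p * \<chi> p * of_nat p powr (\<i> * of_real t)) \<le> 1"
      using norm_dirichlet_character_le_1[OF assms(2), of p]
      by (simp add: norm_mult mult_le_one)
    then show ?thesis using complex_Re_le_cmod order_trans by blast
  qed
  then show ?thesis unfolding prime_distance_def by (intro sum_nonneg) auto
qed

end

theory Submission
  imports Defs "HOL-Real_Asymp.Real_Asymp"
begin

text \<open>
  If \<open>\<lambda>\<close> pretends to be \<open>\<chi>(n) n\<^sup>i\<^sup>t\<close> up to \<open>X\<close>, then \<open>\<chi>\<^sup>2(n) n\<^sup>2\<^sup>i\<^sup>t\<close> pretends to be 1. A bound of
  Vinogradov--Korobov type \<open>(ln X)\<^sup>c\<close>, \<open>c < 1\<close>, for the \<open>L\<close>-series near \<open>1 + it\<close>, obtained from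
  Vinogradov's mean value theorem, rules this out unless \<open>\<chi>\<^sup>2\<close> is principal and \<open>t\<close> is tiny. So
  \<open>\<lambda>\<close> pretends to be a real character \<open>\<chi>\<close> of modulus \<open>q \<le> (ln Y)\<^sup>A\<close> up to \<open>Y\<close>, where
  \<open>ln Y = (ln X)\<^sup>1\<^sup>/\<^sup>3\<close>. A Siegel zero may make this happen for one \<open>Y\<close>. But the characters found at
  \<open>Y\<close> and at the larger scale \<open>Z\<close> with \<open>ln Z = (ln Y)\<^sup>B\<close> pretend to be each other up to \<open>Y\<close>, hence
  agree at all primes not dividing their moduli. Then \<open>\<lambda>\<close> pretends up to \<open>Z\<close> to be a real character
  whose modulus is at most a small power of \<open>ln Z\<close>, which is impossible by the elementary lower
  bound for \<open>L(1 + \<sigma>, \<chi>)\<close> in terms of the modulus alone.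
\<close>

section \<open>Vinogradov's mean value theorem\<close>

text \<open>Any exponent c < 1 in the bound for the L-series leads to a contradiction, so constants
  are chosen generously. The value 39/40 arises because Taylor polynomials of degree k about (ln
  X)^(1/40) are used and the mean value constant obeys only ln C \<le> k^16. In the p-adic iteration
  the prime p depends on k alone, and a power M = p^a plays the part of a modulus near P^(1/k);
  powers of p meet every size up to a factor p, which the constant C absorbs. A character of modulus
  q enters through its residue classes: the L-series becomes an average of shifted zeta sums,
  bounded uniformly in the shift, so that q costs only ln q. The obstacle is the last step. The
  hypothesis admits moduli up to any fixed power of ln X, whereas the elementary bound of order 1/q
  for L(1 + \<sigma>, \<chi>) is applied only for q \<le> (ln X)^(1/16). Closeness is assumed at
  every large X, not merely along a sequence, so the second scale can be a function of the first
  that depends on A.\<close>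

definition tuples :: "nat \<Rightarrow> int set \<Rightarrow> (nat \<Rightarrow> int) set" where
  "tuples s A = PiE {..<s} (\<lambda>_. A)"

text \<open>With \<open>A = {0..<int P}\<close> and \<open>w = 0\<close> this is Vinogradov's
  J_{s,k}(P). The right-hand side \<open>w\<close> is kept because fixing some variables turns the
  homogeneous system into an inhomogeneous one in the others, and because the counts for all
  \<open>w\<close> are the Fourier coefficients of the 2s-th power of the modulus of the exponential
  sum.\<close>

definition solutions :: "nat \<Rightarrow> nat \<Rightarrow> int set \<Rightarrow> (nat \<Rightarrow> int) \<Rightarrow> nat" where
  "solutions k s A w = card {(x, y). x \<in> tuples s A \<and> y \<in> tuples s A \<and>
     (\<forall>j\<in>{1..k}. (\<Sum>i<s. x i ^ j) - (\<Sum>i<s. y i ^ j) = w j)}"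

lemma finite_tuples [simp]: "finite A \<Longrightarrow> finite (tuples s A)"
  unfolding tuples_def by (intro finite_PiE) auto

lemma card_tuples: "card (tuples s A) = card A ^ s"
  unfolding tuples_def by (subst card_PiE) auto

lemma finite_solutions:
  assumes "finite A"
  shows "finite {(x, y). x \<in> tuples s A \<and> y \<in> tuples s A \<and> R x y}"
  by (rule finite_subset[of _ "tuples s A \<times> tuples s A"]) (use assms in auto)

lemma solutions_le_trivial:
  assumes "finite A"
  shows "solutions k s A w \<le> card A ^ (2 * s)"
proof -
  have "solutions k s A w \<le> card (tuples s A \<times> tuples s A)"
    unfolding solutions_def using assms by (intro card_mono) auto
  then show ?thesis by (simp add: card_cartesian_product card_tuples power_mult power2_eq_square mult.commute flip: power_mult_distrib)
qed

lemma solutions_mono: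
  assumes "finite B" "A \<subseteq> B"
  shows "solutions k s A w \<le> solutions k s B w"
  unfolding solutions_def tuples_def
proof (rule card_mono)
  show "finite {(x, y). x \<in> PiE {..<s} (\<lambda>_. B) \<and> y \<in> PiE {..<s} (\<lambda>_. B) \<and>
     (\<forall>j\<in>{1..k}. (\<Sum>i<s. x i ^ j) - (\<Sum>i<s. y i ^ j) = w j)}"
    using finite_solutions[OF assms(1)] unfolding tuples_def .
  show "{(x, y). x \<in> PiE {..<s} (\<lambda>_. A) \<and> y \<in> PiE {..<s} (\<lambda>_. A) \<and>
     (\<forall>j\<in>{1..k}. (\<Sum>i<s. x i ^ j) - (\<Sum>i<s. y i ^ j) = w j)} \<subseteq>
     {(x, y). x \<in> PiE {..<s} (\<lambda>_. B) \<and> y \<in> PiE {..<s} (\<lambda>_. B) \<and>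
     (\<forall>j\<in>{1..k}. (\<Sum>i<s. x i ^ j) - (\<Sum>i<s. y i ^ j) = w j)}"
    using PiE_mono[of "{..<s}" "\<lambda>_. A" "\<lambda>_. B"] assms(2) by blast
qed

text \<open>By the binomial theorem the difference of j-th power sums of the translated variables is
  a fixed combination of the untranslated differences of degree at most j. The two sides have
  separate index sets so that s variables can be compared with k variables, or with none.\<close>

lemma power_sums_shift:
  fixes x :: "'i \<Rightarrow> int" and y :: "'l \<Rightarrow> int"
  assumes "\<And>l. l \<in> {1..k} \<Longrightarrow>
      (\<Sum>i\<in>I. x i ^ l) - (\<Sum>i\<in>I. x' i ^ l) = (\<Sum>i\<in>L. y i ^ l) - (\<Sum>i\<in>L. y' i ^ l)"
    and "j \<in> {1..k}"
  shows "(\<Sum>i\<in>I. (x i + b) ^ j) - (\<Sum>i\<in>I. (x' i + b) ^ j) =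
      (\<Sum>i\<in>L. (y i + b) ^ j) - (\<Sum>i\<in>L. (y' i + b) ^ j)"
proof -
  have expand: "(\<Sum>i\<in>A. (z i + b) ^ j) - (\<Sum>i\<in>A. (z' i + b) ^ j) =
     (\<Sum>l\<le>j. of_nat (j choose l) * b ^ (j - l) * ((\<Sum>i\<in>A. z i ^ l) - (\<Sum>i\<in>A. z' i ^ l)))"
    for A :: "'x set" and z z' :: "'x \<Rightarrow> int"
  proof -
    have "(\<Sum>i\<in>A. (u i + b) ^ j) = (\<Sum>l\<le>j. of_nat (j choose l) * b ^ (j - l) * (\<Sum>i\<in>A. u i ^ l))"
      for u :: "'x \<Rightarrow> int"
      by (subst binomial_ring, subst sum.swap) (simp add: sum_distrib_left mult_ac)
    then show ?thesis by (simp add: sum_subtractf right_diff_distrib)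
  qed
  \<comment> \<open>In degree 0 both differences vanish, because each compares two families over the
    same index set.\<close>
  have "(\<Sum>i\<in>I. x i ^ l) - (\<Sum>i\<in>I. x' i ^ l) = (\<Sum>i\<in>L. y i ^ l) - (\<Sum>i\<in>L. y' i ^ l)" if "l \<le> j" for l
    using assms(1)[of l] assms(2) that by (cases "l = 0") auto
  then show ?thesis by (simp add: expand)
qed

text \<open>Translation and dilation invariance of the system: undoing z \<mapsto> b + M z maps
  solutions to solutions, injectively on the image. It turns the solutions inside one residue class
  into solutions in a shorter interval.\<close>

lemma solutions_affine:
  fixes M b :: int
  assumes "M \<noteq> 0" "finite A"
  shows "solutions k s ((\<lambda>z. b + M * z) ` A) (\<lambda>_. 0) \<le> solutions k s A (\<lambda>_. 0)"
proof -
  let ?g = "\<lambda>z. b + M * z"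
  let ?T = "\<lambda>x. \<lambda>i\<in>{..<s}. (x i - b) div M"
  let ?S = "\<lambda>A. {(x, y). x \<in> tuples s A \<and> y \<in> tuples s A \<and>
     (\<forall>j\<in>{1..k}. (\<Sum>i<s. x i ^ j) - (\<Sum>i<s. y i ^ j) = 0)}"
  have rec: "?g (?T x i) = x i" if "x \<in> tuples s (?g ` A)" "i < s" for x i
  proof -
    have "x i \<in> ?g ` A" using that unfolding tuples_def by auto
    then show ?thesis using that assms by auto
  qed
  have "card (?S (?g ` A)) \<le> card (?S A)"
  proof (rule card_inj_on_le[where f = "\<lambda>(x, y). (?T x, ?T y)"])
    show "inj_on (\<lambda>(x, y). (?T x, ?T y)) (?S (?g ` A))"
    proof (rule inj_onI)
      have inj: "z = z'" if z: "z \<in> tuples s (?g ` A)" "z' \<in> tuples s (?g ` A)" and e: "?T z = ?T z'" for z z'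
      proof
        fix i show "z i = z' i"
        proof (cases "i < s")
          case True
          have "z i = ?g (?T z i)" using rec[OF z(1) True] by simp
          also have "\<dots> = ?g (?T z' i)" by (simp only: e)
          also have "\<dots> = z' i" by (rule rec[OF z(2) True])
          finally show ?thesis .
        next
          case False
          then have "z i = undefined" "z' i = undefined" using z by (auto simp: tuples_def intro: PiE_arb)
          then show ?thesis by simp
        qed
      qed
      fix a b assume "a \<in> ?S (?g ` A)" "b \<in> ?S (?g ` A)"
        "(\<lambda>(x, y). (?T x, ?T y)) a = (\<lambda>(x, y). (?T x, ?T y)) b"
      then show "a = b" using inj[of "fst a" "fst b"] inj[of "snd a" "snd b"]
        by (simp add: case_prod_unfold prod_eq_iff)
    qed
    show "(\<lambda>(x, y). (?T x, ?T y)) ` ?S (?g ` A) \<subseteq> ?S A"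
    proof clarify
      fix x y assume a: "x \<in> tuples s (?g ` A)" "y \<in> tuples s (?g ` A)"
        and e: "\<forall>j\<in>{1..k}. (\<Sum>i<s. x i ^ j) - (\<Sum>i<s. y i ^ j) = 0"
      have mem: "?T z \<in> tuples s A" if "z \<in> tuples s (?g ` A)" for z
        unfolding tuples_def
      proof (rule PiE_I)
        fix i assume i: "i \<in> {..<s}"
        then have "z i \<in> ?g ` A" using that unfolding tuples_def by auto
        then show "?T z i \<in> A" using i assms by auto
      qed auto
      have "(\<Sum>i<s. ?T x i ^ j) - (\<Sum>i<s. ?T y i ^ j) = 0" if j: "j \<in> {1..k}" for j
      proof -
        have sh: "(\<Sum>i<s. (x i + - b) ^ j) - (\<Sum>i<s. (y i + - b) ^ j)
            = (\<Sum>i\<in>({}::nat set). (x i + - b) ^ j) - (\<Sum>i\<in>{}. (y i + - b) ^ j)"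
          using e j by (intro power_sums_shift[where k = k]) auto
        have id: "(\<Sum>i<s. (z i + - b) ^ j) = M ^ j * (\<Sum>i<s. ?T z i ^ j)" if "z \<in> tuples s (?g ` A)" for z
        proof -
          have "z i + - b = M * ?T z i" if "i < s" for i using rec[OF \<open>z \<in> _\<close> that] by simp
          then have "(z i + - b) ^ j = M ^ j * ?T z i ^ j" if "i < s" for i
            using that by (simp only: power_mult_distrib)
          then show ?thesis unfolding sum_distrib_left by (intro sum.cong) auto
        qed
        show ?thesis using sh id[OF a(1)] id[OF a(2)] assms(1) by (simp flip: right_diff_distrib)
      qed
      then show "?T x \<in> tuples s A \<and> ?T y \<in> tuples s A \<and> (\<forall>j\<in>{1..k}. (\<Sum>i<s. ?T x i ^ j) - (\<Sum>i<s. ?T y i ^ j) = 0)"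
        using mem a by blast
    qed
  qed (use finite_solutions[OF assms(2)] in auto)
  then show ?thesis unfolding solutions_def .
qed

text \<open>Hensel lifting: at each step the linearised system is a Vandermonde system with unit determinant.\<close>
lemma power_sums_determine:
  fixes u v :: "nat \<Rightarrow> int"
  assumes p: "prime p" "int k < p"
    and cong: "\<And>i. i < k \<Longrightarrow> [u i = v i] (mod p)"
    and dist: "\<And>i l. i < k \<Longrightarrow> l < k \<Longrightarrow> i \<noteq> l \<Longrightarrow> \<not> [v i = v l] (mod p)"
    and ps: "\<And>j. j \<in> {1..k} \<Longrightarrow> [(\<Sum>i<k. u i ^ j) = (\<Sum>i<k. v i ^ j)] (mod p ^ e)"
    and i: "i < k"
  shows "[u i = v i] (mod p ^ e)"
proof (cases "e = 0")
  case False
  have "\<forall>i<k. [u i = v i] (mod p ^ m)" if "1 \<le> m" "m \<le> e" for m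
    using that
  proof (induction m rule: nat_induct_at_least)
    case base
    then show ?case using cong by simp
  next
    case (Suc m)
    have p0: "p > 0" using p(1) by (simp add: prime_gt_0_int)
    define z where "z i = (u i - v i) div p ^ m" for i
    have z: "u i = v i + p ^ m * z i" if "i < k" for i
    proof -
      have "p ^ m dvd u i - v i" using Suc that by (auto simp: cong_iff_dvd_diff)
      then show ?thesis by (simp add: z_def)
    qed
    have lin: "p dvd (\<Sum>i<k. v i ^ j * z i)" if j: "j < k" for j
    proof -
      have "[u i ^ Suc j = v i ^ Suc j + p ^ m * (int (Suc j) * v i ^ j * z i)] (mod p ^ Suc m)" if "i < k" for i
      proof -
        \<comment> \<open>Terms with at least two factors p^m vanish modulo p^(m + 1) since 2m \<ge>
          m + 1; only the term linear in \<open>z\<close> survives.\<close>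
        have pw: "p ^ Suc m dvd (p ^ m * z i) ^ (l + 2)" for l
        proof -
          have "Suc m \<le> m * (l + 2)" using Suc.hyps by (simp add: algebra_simps)
          then have "p ^ Suc m dvd p ^ (m * (l + 2))" by (rule le_imp_power_dvd)
          then show ?thesis by (simp only: power_mult_distrib power_mult dvd_mult2)
        qed
        have d: "p ^ Suc m dvd (\<Sum>l\<in>{2..Suc j}. of_nat (Suc j choose l) * (p ^ m * z i) ^ l * v i ^ (Suc j - l))"
        proof (rule dvd_sum)
          fix l assume "l \<in> {2..Suc j}"
          then have "l = (l - 2) + 2" by (simp only: atLeastAtMost_iff) linarith
          with pw have "p ^ Suc m dvd (p ^ m * z i) ^ l" by metis
          then show "p ^ Suc m dvd of_nat (Suc j choose l) * (p ^ m * z i) ^ l * v i ^ (Suc j - l)"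
            by (intro dvd_mult2 dvd_mult)
        qed
        have "u i ^ Suc j = (p ^ m * z i + v i) ^ Suc j" using z[OF that] by (simp add: add.commute)
        also have "\<dots> = (\<Sum>l\<in>{0..Suc j}. of_nat (Suc j choose l) * (p ^ m * z i) ^ l * v i ^ (Suc j - l))"
          unfolding binomial_ring by (simp add: atMost_atLeast0)
        also have "{0..Suc j} = insert 0 (insert 1 {2..Suc j})" by auto
        finally have "u i ^ Suc j - (v i ^ Suc j + p ^ m * (int (Suc j) * v i ^ j * z i)) =
          (\<Sum>l\<in>{2..Suc j}. of_nat (Suc j choose l) * (p ^ m * z i) ^ l * v i ^ (Suc j - l))"
          by (simp add: algebra_simps)
        then show ?thesis using d by (simp add: cong_iff_dvd_diff)
      qed
      then have "[(\<Sum>i<k. u i ^ Suc j) = (\<Sum>i<k. v i ^ Suc j + p ^ m * (int (Suc j) * v i ^ j * z i))] (mod p ^ Suc m)"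
        by (intro cong_sum) auto
      moreover have "[(\<Sum>i<k. u i ^ Suc j) = (\<Sum>i<k. v i ^ Suc j)] (mod p ^ Suc m)"
        using ps[of "Suc j"] j Suc.prems cong_dvd_modulus[OF _ le_imp_power_dvd[of "Suc m" e p]] by simp
      moreover have "(\<Sum>i<k. v i ^ Suc j + p ^ m * (int (Suc j) * v i ^ j * z i)) =
          (\<Sum>i<k. v i ^ Suc j) + p ^ m * (int (Suc j) * (\<Sum>i<k. v i ^ j * z i))"
        unfolding sum.distrib sum_distrib_left by (simp only: mult.assoc)
      ultimately have "[(\<Sum>i<k. v i ^ Suc j) = (\<Sum>i<k. v i ^ Suc j) + p ^ m * (int (Suc j) * (\<Sum>i<k. v i ^ j * z i))] (mod p ^ Suc m)"
        by (simp only:) (rule cong_trans[OF cong_sym])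
      then have "p ^ m * p dvd p ^ m * (int (Suc j) * (\<Sum>i<k. v i ^ j * z i))"
        by (simp add: cong_iff_dvd_diff mult.commute)
      then have "p dvd int (Suc j) * (\<Sum>i<k. v i ^ j * z i)" using p0 by simp
      \<comment> \<open>Here k < p enters: the derivative factor j + 1 \<le> k is a unit modulo
        p.\<close>
      moreover have "\<not> p dvd int (Suc j)" using j p by (auto dest!: zdvd_imp_le)
      ultimately show ?thesis using p(1) by (simp add: prime_dvd_mult_iff del: of_nat_Suc)
    qed
    have "[u i = v i] (mod p ^ Suc m)" if i: "i < k" for i
    proof -
      \<comment> \<open>In place of an inverse Vandermonde matrix: \<open>q\<close> has degree k - 1
        and vanishes at every \<open>v l\<close> with l \<noteq> i, so combining the linear
        conditions with its coefficients isolates \<open>z i\<close>.\<close>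
      define q where "q = (\<Prod>l\<in>{..<k} - {i}. [:- v l, 1:])"
      have "Polynomial.degree q = card ({..<k} - {i})"
        unfolding q_def by (subst Polynomial.degree_prod_eq_sum_degree) auto
      then have deg: "degree q < k" using i by simp
      have "(\<Sum>l<k. poly q (v l) * z l) = (\<Sum>j\<le>degree q. poly.coeff q j * (\<Sum>l<k. v l ^ j * z l))"
        unfolding poly_altdef sum_distrib_right by (subst sum.swap) (simp add: sum_distrib_left mult_ac)
      then have "p dvd (\<Sum>l<k. poly q (v l) * z l)"
        by (simp only:) (rule dvd_sum, rule dvd_mult, use deg lin in auto)
      also have "(\<Sum>l<k. poly q (v l) * z l) = (\<Sum>l\<in>{i}. poly q (v l) * z l)"
        using i by (intro sum.mono_neutral_right) (auto simp: q_def poly_prod)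
      finally have "p dvd poly q (v i) * z i" by simp
      moreover have "\<not> p dvd poly q (v i)"
        using dist[OF i] p(1) by (auto simp: q_def poly_prod prime_dvd_prod_iff cong_iff_dvd_diff)
      ultimately have "p dvd z i" using p(1) by (simp add: prime_dvd_mult_iff)
      then show ?thesis using z[OF i] by (simp add: cong_iff_dvd_diff mult.commute mult_dvd_mono)
    qed
    then show ?case by blast
  qed
  then show ?thesis using False i by auto
qed simp

section \<open>Exponential sums at rational frequencies\<close>

definition phase :: "nat \<Rightarrow> nat \<Rightarrow> (nat \<Rightarrow> nat) \<Rightarrow> (nat \<Rightarrow> int) \<Rightarrow> complex" where
  "phase Q k \<alpha> v = cis (2 * pi * real_of_int (\<Sum>j=1..k. int (\<alpha> j) * v j) / real Q)"

text \<open>The grid of points \<alpha>/Q replaces the torus: once Q exceeds the size of all power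
  sums involved, averaging over the grid detects the same equations as integration would.\<close>

definition freqs :: "nat \<Rightarrow> nat \<Rightarrow> (nat \<Rightarrow> nat) set" where
  "freqs Q k = PiE {1..k} (\<lambda>_. {..<Q})"

definition expsum :: "nat \<Rightarrow> nat \<Rightarrow> int set \<Rightarrow> (nat \<Rightarrow> nat) \<Rightarrow> complex" where
  "expsum Q k A \<alpha> = (\<Sum>x\<in>A. phase Q k \<alpha> (\<lambda>j. x ^ j))"

lemma finite_freqs [simp]: "finite (freqs Q k)"
  unfolding freqs_def by (intro finite_PiE) auto

lemma phase_add: "phase Q k \<alpha> (\<lambda>j. v j + w j) = phase Q k \<alpha> v * phase Q k \<alpha> w"
  by (simp add: phase_def cis_mult algebra_simps sum.distrib add_divide_distrib)

lemma phase_diff: "phase Q k \<alpha> (\<lambda>j. v j - w j) = phase Q k \<alpha> v * cnj (phase Q k \<alpha> w)"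
  by (simp add: phase_def cis_mult cis_cnj algebra_simps sum_subtractf diff_divide_distrib)

lemma phase_sum: "finite I \<Longrightarrow> phase Q k \<alpha> (\<lambda>j. \<Sum>i\<in>I. v i j) = (\<Prod>i\<in>I. phase Q k \<alpha> (v i))"
proof (induction I rule: finite_induct)
  case empty show ?case by (simp add: phase_def)
next
  case (insert i I)
  then show ?case using phase_add[of Q k \<alpha> "v i" "\<lambda>j. \<Sum>i\<in>I. v i j"] by simp
qed

lemma norm_phase [simp]: "norm (phase Q k \<alpha> v) = 1"
  by (simp add: phase_def)

lemma sum_roots_unity_dvd:
  assumes "Q > 0"
  shows "(\<Sum>a<Q. cis (2 * pi * real_of_int (int a * v) / real Q)) = (if int Q dvd v then of_nat Q else 0)"
proof -
  define z where "z = cis (2 * pi * real_of_int v / real Q)"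
  have pw: "cis (2 * pi * real_of_int (int a * v) / real Q) = z ^ a" for a
    unfolding z_def Complex.DeMoivre by (simp add: algebra_simps)
  have one: "z ^ Q = 1"
    unfolding z_def Complex.DeMoivre using assms by (simp add: cis_multiple_2pi)
  show ?thesis
  proof (cases "int Q dvd v")
    case True
    then obtain m where "v = int Q * m" by auto
    then have "z = 1" unfolding z_def using assms cis_multiple_2pi[of "of_int m"] by (simp add: mult.assoc)
    then show ?thesis using True unfolding pw by simp
  next
    case False
    have "z \<noteq> 1"
    proof
      assume "z = 1"
      then have "cos (2 * pi * real_of_int v / real Q) = 1"
        unfolding z_def by (metis cis.sel(1) one_complex.sel(1))
      then obtain m :: int where "2 * pi * real_of_int v / real Q = of_int m * 2 * pi"
        using cos_one_2pi_int by blast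
      then have "real_of_int v = of_int m * real Q" using assms by (simp add: field_simps)
      then have "v = m * int Q" by (metis of_int_eq_iff of_int_mult of_int_of_nat_eq)
      then show False using False by simp
    qed
    then have "(\<Sum>a<Q. z ^ a) = 0" using one by (simp add: sum_gp_strict)
    then show ?thesis using False unfolding pw by simp
  qed
qed

lemma phase_orthogonality:
  assumes "Q > 0"
  shows "(\<Sum>\<alpha>\<in>freqs Q k. phase Q k \<alpha> v) = (if \<forall>j\<in>{1..k}. int Q dvd v j then of_nat (Q ^ k) else 0)"
proof -
  \<comment> \<open>The phase splits into one factor per degree on writing \<open>v\<close> as a sum
    of vectors supported in a single coordinate.\<close>
  have "phase Q k \<alpha> v = (\<Prod>j=1..k. cis (2 * pi * real_of_int (int (\<alpha> j) * v j) / real Q))" for \<alpha>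
    using phase_sum[of "{1..k}" Q k \<alpha> "\<lambda>i j. if j = i then v i else 0"]
    unfolding phase_def by (simp add: if_distrib[of "(*) _"] cong: if_cong)
  then have "(\<Sum>\<alpha>\<in>freqs Q k. phase Q k \<alpha> v) =
      (\<Prod>j=1..k. \<Sum>a<Q. cis (2 * pi * real_of_int (int a * v j) / real Q))"
    unfolding freqs_def by (simp add: prod_sum_PiE)
  also have "\<dots> = (\<Prod>j=1..k. if int Q dvd v j then of_nat Q else 0)"
    by (intro prod.cong refl sum_roots_unity_dvd assms)
  also have "\<dots> = (if \<forall>j\<in>{1..k}. int Q dvd v j then of_nat (Q ^ k) else 0)"
    by (auto simp: prod_zero_iff)
  finally show ?thesis .
qed

text \<open>The bound P^k is the same for all degrees, so that one common denominator Q serves every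
  coordinate.\<close>

lemma power_sum_bound:
  assumes "A \<subseteq> {0..<int P}" "x \<in> tuples s A" "j \<in> {1..k}" "P > 0"
  shows "0 \<le> (\<Sum>i<s. x i ^ j)" "(\<Sum>i<s. x i ^ j) \<le> int s * int P ^ k"
proof -
  have x: "0 \<le> x i" "x i < int P" if "i < s" for i
    using assms that unfolding tuples_def by (force dest: PiE_mem)+
  show "0 \<le> (\<Sum>i<s. x i ^ j)" by (intro sum_nonneg zero_le_power) (use x in auto)
  have "(\<Sum>i<s. x i ^ j) \<le> (\<Sum>i<s. int P ^ k)"
  proof (rule sum_mono)
    fix i assume i: "i \<in> {..<s}"
    have "x i ^ j \<le> int P ^ j" using x i by (intro power_mono) (auto simp: less_imp_le)
    also have "\<dots> \<le> int P ^ k" using assms by (intro power_increasing) auto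
    finally show "x i ^ j \<le> int P ^ k" .
  qed
  then show "(\<Sum>i<s. x i ^ j) \<le> int s * int P ^ k" by simp
qed

lemma expsum_power:
  assumes "finite A"
  shows "expsum Q k A \<alpha> ^ s = (\<Sum>x\<in>tuples s A. phase Q k \<alpha> (\<lambda>j. \<Sum>i<s. x i ^ j))"
proof -
  have "expsum Q k A \<alpha> ^ s = (\<Prod>i<s. \<Sum>x\<in>A. phase Q k \<alpha> (\<lambda>j. x ^ j))"
    by (simp add: expsum_def)
  also have "\<dots> = (\<Sum>x\<in>tuples s A. \<Prod>i<s. phase Q k \<alpha> (\<lambda>j. x i ^ j))"
    unfolding tuples_def by (rule prod_sum_PiE) (use assms in auto)
  finally show ?thesis by (simp add: phase_sum)
qed

lemma norm_power_even: "of_real (norm z ^ (2 * s)) = z ^ s * cnj (z ^ s)"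
proof -
  have "complex_of_real (norm z ^ (2 * s)) = complex_of_real ((norm z)\<^sup>2) ^ s" by (simp add: power_mult)
  also have "\<dots> = (z * cnj z) ^ s" by (simp only: complex_norm_square)
  finally show ?thesis by (simp add: power_mult_distrib)
qed

lemma norm_expsum_power:
  assumes "finite A"
  shows "of_real (norm (expsum Q k A \<alpha>) ^ (2 * s)) =
    (\<Sum>(x, y)\<in>tuples s A \<times> tuples s A. phase Q k \<alpha> (\<lambda>j. (\<Sum>i<s. x i ^ j) - (\<Sum>i<s. y i ^ j)))"
  unfolding norm_power_even expsum_power[OF assms] cnj_sum phase_diff sum_product
  by (simp add: sum.cartesian_product)

text \<open>Orthogonality on the grid detects the equations only modulo Q. All quantities compared
  are at most (s + r) P^k in absolute value, which is below Q, so the congruences are equalities.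
  The twist by \<open>w\<close> moves the right-hand side of the system.\<close>

lemma twisted_moment:
  assumes A: "A \<subseteq> {0..<int P}" and P: "P > 0"
    and w: "\<And>j. j \<in> {1..k} \<Longrightarrow> \<bar>w j\<bar> \<le> int r * int P ^ k" and Q: "Q > (s + r) * P ^ k"
  shows "(\<Sum>\<alpha>\<in>freqs Q k. of_real (norm (expsum Q k A \<alpha>) ^ (2 * s)) * phase Q k \<alpha> w) =
     of_nat (Q ^ k * solutions k s A (\<lambda>j. - w j))"
proof -
  have fin: "finite A" using A finite_subset by blast
  let ?D = "\<lambda>x y j. (\<Sum>i<s. x i ^ j) - (\<Sum>i<s. y i ^ j) :: int"
  have dvd: "int Q dvd ?D x y j + w j \<longleftrightarrow> ?D x y j = - w j"
    if "x \<in> tuples s A" "y \<in> tuples s A" "j \<in> {1..k}" for x y j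
  proof -
    have "\<bar>?D x y j\<bar> \<le> int s * int P ^ k"
      using power_sum_bound[OF A that(1,3) P] power_sum_bound[OF A that(2,3) P] by linarith
    then have "\<bar>?D x y j + w j\<bar> \<le> (int s + int r) * int P ^ k"
      using w[OF that(3)] by (simp add: algebra_simps)
    also have "\<dots> < int Q" using Q by (metis of_nat_add of_nat_less_iff of_nat_mult of_nat_power)
    finally have "\<bar>?D x y j + w j\<bar> < int Q" .
    then have "int Q dvd ?D x y j + w j \<longleftrightarrow> ?D x y j + w j = 0"
      using zdvd_not_zless[of "\<bar>?D x y j + w j\<bar>" "int Q"] by (auto simp del: abs_le_zero_iff)
    then show ?thesis by linarith
  qed
  have "(\<Sum>\<alpha>\<in>freqs Q k. of_real (norm (expsum Q k A \<alpha>) ^ (2 * s)) * phase Q k \<alpha> w) =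
     (\<Sum>\<alpha>\<in>freqs Q k. \<Sum>(x, y)\<in>tuples s A \<times> tuples s A. phase Q k \<alpha> (\<lambda>j. ?D x y j + w j))"
    unfolding norm_expsum_power[OF fin] sum_distrib_right
    by (simp add: case_prod_unfold phase_add)
  also have "\<dots> = (\<Sum>(x, y)\<in>tuples s A \<times> tuples s A. \<Sum>\<alpha>\<in>freqs Q k. phase Q k \<alpha> (\<lambda>j. ?D x y j + w j))"
    by (subst sum.swap) (simp add: case_prod_unfold)
  also have "\<dots> = (\<Sum>(x, y)\<in>tuples s A \<times> tuples s A. if \<forall>j\<in>{1..k}. ?D x y j = - w j then of_nat (Q ^ k) else 0)"
  proof (intro sum.cong refl, clarify)
    fix x y assume "x \<in> tuples s A" "y \<in> tuples s A"
    then have "(\<forall>j\<in>{1..k}. int Q dvd ?D x y j + w j) \<longleftrightarrow> (\<forall>j\<in>{1..k}. ?D x y j = - w j)"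
      using dvd by blast
    then show "(\<Sum>\<alpha>\<in>freqs Q k. phase Q k \<alpha> (\<lambda>j. ?D x y j + w j)) =
       (if \<forall>j\<in>{1..k}. ?D x y j = - w j then of_nat (Q ^ k) else 0)"
      using phase_orthogonality[of Q k "\<lambda>j. ?D x y j + w j"] Q by simp
  qed
  also have "\<dots> = (\<Sum>z\<in>{(x, y). x \<in> tuples s A \<and> y \<in> tuples s A \<and> (\<forall>j\<in>{1..k}. ?D x y j = - w j)}. of_nat (Q ^ k))"
    by (rule sum.mono_neutral_cong_right) (use fin in \<open>auto split: if_splits\<close>)
  finally show ?thesis by (simp add: solutions_def mult.commute)
qed

lemma moment:
  assumes "A \<subseteq> {0..<int P}" "P > 0" "Q > s * P ^ k"
  shows "(\<Sum>\<alpha>\<in>freqs Q k. norm (expsum Q k A \<alpha>) ^ (2 * s)) = real (Q ^ k * solutions k s A (\<lambda>_. 0))"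
proof -
  have "(\<Sum>\<alpha>\<in>freqs Q k. of_real (norm (expsum Q k A \<alpha>) ^ (2 * s)) * phase Q k \<alpha> (\<lambda>_. 0)) =
     (of_nat (Q ^ k * solutions k s A (\<lambda>j. - 0)) :: complex)"
    by (rule twisted_moment[where r = 0 and P = P]) (use assms in auto)
  then have "complex_of_real (\<Sum>\<alpha>\<in>freqs Q k. norm (expsum Q k A \<alpha>) ^ (2 * s)) =
     complex_of_real (real (Q ^ k * solutions k s A (\<lambda>_. 0)))"
    by (simp add: phase_def)
  then show ?thesis by (simp only: of_real_eq_iff)
qed

text \<open>If r(v) counts the s-tuples with power-sum vector v, the number of solutions is the
  correlation \<Sum>r(v) r(v - w). By 2ab \<le> a^2 + b^2 it is at most \<Sum>r(v)^2, its value for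
  w = 0.\<close>

lemma solutions_le_homogeneous:
  assumes "finite A"
  shows "solutions k s A w \<le> solutions k s A (\<lambda>_. 0)"
proof -
  let ?T = "tuples s A"
  let ?\<phi> = "\<lambda>x. \<lambda>j\<in>{1..k}. \<Sum>i<s. x i ^ j"
  let ?V = "?\<phi> ` ?T"
  let ?W = "\<lambda>v. \<lambda>j\<in>{1..k}. v j - w j"
  define r where "r v = card {x \<in> ?T. ?\<phi> x = v}" for v
  have fin: "finite ?T" "finite ?V" using assms by auto
  have pairs: "card {(x, y). x \<in> ?T \<and> y \<in> ?T \<and> ?\<phi> y = F (?\<phi> x)} = (\<Sum>v\<in>?V. r v * r (F v))" for F
  proof -
    have "{(x, y). x \<in> ?T \<and> y \<in> ?T \<and> ?\<phi> y = F (?\<phi> x)} =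
      (\<Union>v\<in>?V. {x \<in> ?T. ?\<phi> x = v} \<times> {x \<in> ?T. ?\<phi> x = F v})" by auto
    then have "card {(x, y). x \<in> ?T \<and> y \<in> ?T \<and> ?\<phi> y = F (?\<phi> x)} =
        (\<Sum>v\<in>?V. card ({x \<in> ?T. ?\<phi> x = v} \<times> {x \<in> ?T. ?\<phi> x = F v}))"
      by (simp only:) (rule card_UN_disjoint, use fin in auto)
    then show ?thesis by (simp add: card_cartesian_product r_def)
  qed
  have sol: "solutions k s A u = card {(x, y). x \<in> ?T \<and> y \<in> ?T \<and> ?\<phi> y = (\<lambda>j\<in>{1..k}. ?\<phi> x j - u j)}" for u
  proof -
    have "(\<forall>j\<in>{1..k}. (\<Sum>i<s. x i ^ j) - (\<Sum>i<s. y i ^ j) = u j) \<longleftrightarrow>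
       ?\<phi> y = (\<lambda>j\<in>{1..k}. ?\<phi> x j - u j)" for x y :: "nat \<Rightarrow> int"
      by (auto simp: fun_eq_iff restrict_def algebra_simps)
    then show ?thesis unfolding solutions_def by simp
  qed
  have "2 * (\<Sum>v\<in>?V. r v * r (?W v)) \<le> (\<Sum>v\<in>?V. r v ^ 2 + r (?W v) ^ 2)"
  proof -
    have "2 * (a * b) \<le> a ^ 2 + b ^ 2" for a b :: nat
      using sum_squares_bound[of "real a" "real b"] by (simp add: mult.assoc flip: of_nat_mult of_nat_power of_nat_add of_nat_le_iff)
    then show ?thesis unfolding sum_distrib_left by (intro sum_mono)
  qed
  also have "\<dots> = (\<Sum>v\<in>?V. r v ^ 2) + (\<Sum>v\<in>?V. r (?W v) ^ 2)" by (rule sum.distrib)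
  also have "(\<Sum>v\<in>?V. r (?W v) ^ 2) \<le> (\<Sum>v\<in>?V. r v ^ 2)"
  proof -
    have inj: "inj_on ?W ?V"
    proof (rule inj_onI)
      fix v v' assume v: "v \<in> ?V" "v' \<in> ?V" and e: "?W v = ?W v'"
      show "v = v'"
      proof
        fix j show "v j = v' j" using fun_cong[OF e, of j] v by (cases "j \<in> {1..k}") auto
      qed
    qed
    have "(\<Sum>v\<in>?V. r (?W v) ^ 2) = (\<Sum>v\<in>?W ` ?V. r v ^ 2)"
      using inj by (simp add: sum.reindex)
    also have "\<dots> \<le> (\<Sum>v\<in>?W ` ?V \<union> ?V. r v ^ 2)" using fin by (intro sum_mono2) auto
    also have "\<dots> = (\<Sum>v\<in>?V. r v ^ 2)"
      by (rule sum.mono_neutral_right) (use fin in \<open>auto simp: r_def image_iff\<close>)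
    finally show ?thesis .
  qed
  finally have "(\<Sum>v\<in>?V. r v * r (?W v)) \<le> (\<Sum>v\<in>?V. r v * r v)" unfolding power2_eq_square by linarith
  moreover have "solutions k s A w = (\<Sum>v\<in>?V. r v * r (?W v))" unfolding sol by (rule pairs)
  moreover have "solutions k s A (\<lambda>_. 0) = (\<Sum>v\<in>?V. r v * r v)"
  proof -
    have "solutions k s A (\<lambda>_. 0) = (\<Sum>v\<in>?V. r v * r (\<lambda>j\<in>{1..k}. v j - 0))" unfolding sol by (rule pairs)
    also have "\<dots> = (\<Sum>v\<in>?V. r v * r v)" by (intro sum.cong refl) auto
    finally show ?thesis .
  qed
  ultimately show ?thesis by simp
qed

lemma power_mean_le:
  fixes z :: "'i \<Rightarrow> real"
  assumes "finite I" "\<And>i. i \<in> I \<Longrightarrow> z i \<ge> 0"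
  shows "(\<Sum>i\<in>I. z i) ^ Suc n \<le> real (card I) ^ n * (\<Sum>i\<in>I. z i ^ Suc n)"
proof (induction n)
  case (Suc n)
  define N where "N = real (card I)"
  \<comment> \<open>Chebyshev's sum inequality: z and z^(n + 1) are ordered alike, so the products
    of their differences are nonnegative.\<close>
  have ch: "(\<Sum>i\<in>I. z i) * (\<Sum>i\<in>I. z i ^ Suc n) \<le> N * (\<Sum>i\<in>I. z i ^ Suc (Suc n))"
  proof -
    have "(z i - z l) * (z i ^ Suc n - z l ^ Suc n) \<ge> 0" if "i \<in> I" "l \<in> I" for i l
    proof (cases "z i \<le> z l")
      case True
      then have "z i ^ Suc n \<le> z l ^ Suc n" using assms that by (intro power_mono) auto
      then show ?thesis using True by (simp add: mult_nonpos_nonpos)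
    next
      case False
      then have "z l ^ Suc n \<le> z i ^ Suc n" using assms that by (intro power_mono) auto
      then show ?thesis using False by simp
    qed
    then have "0 \<le> (\<Sum>i\<in>I. \<Sum>l\<in>I. (z i - z l) * (z i ^ Suc n - z l ^ Suc n))"
      by (intro sum_nonneg) auto
    also have "\<dots> = (\<Sum>i\<in>I. \<Sum>l\<in>I. z i ^ Suc (Suc n)) + (\<Sum>i\<in>I. \<Sum>l\<in>I. z l ^ Suc (Suc n))
        - (\<Sum>i\<in>I. \<Sum>l\<in>I. z i * z l ^ Suc n) - (\<Sum>i\<in>I. \<Sum>l\<in>I. z l * z i ^ Suc n)"
      by (simp add: sum.distrib sum_subtractf algebra_simps)
    also have "(\<Sum>i\<in>I. \<Sum>l\<in>I. z l * z i ^ Suc n) = (\<Sum>i\<in>I. \<Sum>l\<in>I. z i * z l ^ Suc n)" by (rule sum.swap)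
    also have "(\<Sum>i\<in>I. \<Sum>l\<in>I. z i * z l ^ Suc n) = (\<Sum>i\<in>I. z i) * (\<Sum>i\<in>I. z i ^ Suc n)"
      by (simp add: sum_product)
    also have "(\<Sum>i\<in>I. \<Sum>l\<in>I. z l ^ Suc (Suc n)) = N * (\<Sum>i\<in>I. z i ^ Suc (Suc n))" by (simp add: N_def)
    also have "(\<Sum>i\<in>I. \<Sum>l\<in>I. z i ^ Suc (Suc n)) = N * (\<Sum>i\<in>I. z i ^ Suc (Suc n))"
      by (simp add: N_def sum_distrib_left)
    finally show ?thesis by linarith
  qed
  have "(\<Sum>i\<in>I. z i) ^ Suc (Suc n) \<le> (\<Sum>i\<in>I. z i) * (N ^ n * (\<Sum>i\<in>I. z i ^ Suc n))"
    unfolding power_Suc[of _ "Suc n"] N_def by (intro mult_left_mono Suc sum_nonneg assms)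
  also have "\<dots> = N ^ n * ((\<Sum>i\<in>I. z i) * (\<Sum>i\<in>I. z i ^ Suc n))" by simp
  also have "\<dots> \<le> N ^ n * (N * (\<Sum>i\<in>I. z i ^ Suc (Suc n)))"
    by (intro mult_left_mono ch) (simp add: N_def)
  finally show ?case by (simp add: N_def mult_ac)
qed simp

section \<open>Residue classes and the p-adic recursion\<close>

definition inj_tuples :: "nat \<Rightarrow> nat \<Rightarrow> (nat \<Rightarrow> nat) set" where
  "inj_tuples k p = {c \<in> PiE {..<k} (\<lambda>_. {..<p}). inj_on c {..<k}}"

lemma finite_inj_tuples [simp]: "finite (inj_tuples k p)"
  unfolding inj_tuples_def by (auto intro!: finite_PiE)

lemma card_inj_tuples_le: "card (inj_tuples k p) \<le> p ^ k"
proof -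
  have "card (inj_tuples k p) \<le> card (PiE {..<k} (\<lambda>_. {..<p}))"
    unfolding inj_tuples_def by (intro card_mono) (auto intro!: finite_PiE)
  then show ?thesis by (simp add: card_PiE)
qed

text \<open>Either some class is responsible for the fraction \<open>1/(2k)\<close> of the sum, or at least
  \<open>k\<close> classes carry the fraction \<open>1/(2p)\<close> each.\<close>
lemma distinct_classes_bound:
  fixes z :: "nat \<Rightarrow> real" and f :: real
  assumes z: "\<And>c. z c \<ge> 0" and f: "0 \<le> f" "f \<le> (\<Sum>c<p. z c)" and k: "k > 0"
  shows "f ^ (2 * (s + k)) \<le> real (2 * k) ^ (2 * (s + k)) * (\<Sum>c<p. z c ^ (2 * (s + k))) +
     real (2 * p) ^ (2 * k) * (f ^ (2 * s) * (\<Sum>c\<in>inj_tuples k p. \<Prod>i<k. z (c i) ^ 2))"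
proof (cases "f = 0")
  case False
  then have f0: "f > 0" using f by simp
  have p: "p > 0" using f f0 by (cases p) auto
  \<comment> \<open>Classes outside \<open>H\<close> carry less than f/(2p) each, hence at most f/2
    together.\<close>
  define H where "H = {c \<in> {..<p}. f \<le> 2 * real p * z c}"
  have fin: "finite H" by (simp add: H_def)
  have t1: "0 \<le> real (2 * k) ^ (2 * (s + k)) * (\<Sum>c<p. z c ^ (2 * (s + k)))"
    using z by (intro mult_nonneg_nonneg sum_nonneg) auto
  have t2: "0 \<le> real (2 * p) ^ (2 * k) * (f ^ (2 * s) * (\<Sum>c\<in>inj_tuples k p. \<Prod>i<k. z (c i) ^ 2))"
    using f by (intro mult_nonneg_nonneg sum_nonneg prod_nonneg) auto
  show ?thesis
  proof (cases "card H \<ge> k")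
    case True
    obtain T where T: "T \<subseteq> H" "card T = k" using True by (meson obtain_subset_with_card_n)
    then have "finite T" using fin finite_subset by blast
    then obtain g where g: "bij_betw g {..<k} T"
      using ex_bij_betw_nat_finite[of T] T by (auto simp: atLeast0LessThan)
    define c where "c = restrict g {..<k}"
    have cH: "c i \<in> H" if "i < k" for i
      using that g T unfolding c_def bij_betw_def by auto
    have "inj_on c {..<k}" using g unfolding c_def bij_betw_def by (auto simp: inj_on_def)
    then have c: "c \<in> inj_tuples k p"
      using cH unfolding inj_tuples_def by (auto simp: c_def H_def)
    have "f ^ (2 * k) = (\<Prod>i<k. f ^ 2)" by (simp add: power_mult)
    also have "\<dots> \<le> (\<Prod>i<k. (real (2 * p)) ^ 2 * z (c i) ^ 2)"
    proof (intro prod_mono conjI)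
      fix i assume "i \<in> {..<k}"
      then have "f \<le> real (2 * p) * z (c i)" using cH[of i] by (simp add: H_def)
      then show "f ^ 2 \<le> real (2 * p) ^ 2 * z (c i) ^ 2"
        using f by (subst power_mult_distrib[symmetric], intro power_mono)
    qed simp
    also have "\<dots> = real (2 * p) ^ (2 * k) * (\<Prod>i<k. z (c i) ^ 2)"
      by (simp add: prod.distrib power_mult)
    also have "(\<Prod>i<k. z (c i) ^ 2) \<le> (\<Sum>c\<in>inj_tuples k p. \<Prod>i<k. z (c i) ^ 2)"
      using c by (intro member_le_sum) (auto intro: prod_nonneg)
    finally have "f ^ (2 * k) \<le> real (2 * p) ^ (2 * k) * (\<Sum>c\<in>inj_tuples k p. \<Prod>i<k. z (c i) ^ 2)"
      by (simp add: mult_left_mono)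
    then have "f ^ (2 * s) * f ^ (2 * k) \<le> f ^ (2 * s) * (real (2 * p) ^ (2 * k) * (\<Sum>c\<in>inj_tuples k p. \<Prod>i<k. z (c i) ^ 2))"
      using f by (intro mult_left_mono) auto
    then show ?thesis using t1 by (simp add: power_add[symmetric] algebra_simps)
  next
    case False
    have "(\<Sum>c\<in>{..<p} - H. z c) \<le> (\<Sum>c\<in>{..<p} - H. f / (2 * real p))"
      by (intro sum_mono) (use p in \<open>auto simp: H_def field_simps\<close>)
    also have "\<dots> \<le> real p * (f / (2 * real p))"
    proof -
      have "card ({..<p} - H) \<le> p" using card_mono[of "{..<p}" "{..<p} - H"] by simp
      then show ?thesis using f p by (simp del: times_divide_eq_right add: mult_right_mono)
    qed
    also have "\<dots> = f / 2" using p by simp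
    finally have a: "(\<Sum>c\<in>{..<p} - H. z c) \<le> f / 2" .
    have "(\<Sum>c<p. z c) = (\<Sum>c\<in>{..<p} - H. z c) + (\<Sum>c\<in>H. z c)"
      by (intro sum.subset_diff) (auto simp: H_def)
    then have b: "f / 2 \<le> (\<Sum>c\<in>H. z c)" using a f by linarith
    \<comment> \<open>Fewer than k classes of \<open>H\<close> share at least f/2, so one of them
      carries f/(2k).\<close>
    have "\<exists>c\<in>H. f / (2 * real k) \<le> z c"
    proof (rule ccontr)
      assume "\<not> ?thesis"
      then have lt: "z c < f / (2 * real k)" if "c \<in> H" for c using that by force
      have "H \<noteq> {}" using b f0 by auto
      then have "(\<Sum>c\<in>H. z c) < (\<Sum>c\<in>H. f / (2 * real k))" using fin lt by (intro sum_strict_mono) auto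
      also have "\<dots> \<le> real k * (f / (2 * real k))"
        using False f by (simp del: times_divide_eq_right add: mult_right_mono)
      also have "\<dots> = f / 2" using k by simp
      finally show False using b by simp
    qed
    then obtain c where c: "c < p" "f \<le> real (2 * k) * z c"
      using k by (auto simp: H_def field_simps)
    have "f ^ (2 * (s + k)) \<le> real (2 * k) ^ (2 * (s + k)) * z c ^ (2 * (s + k))"
      using c f unfolding power_mult_distrib[symmetric] by (intro power_mono) auto
    also have "z c ^ (2 * (s + k)) \<le> (\<Sum>c<p. z c ^ (2 * (s + k)))"
      using c z by (intro member_le_sum) auto
    finally show ?thesis using t2 by (simp add: mult_left_mono)
  qed
next
  case True
  then show ?thesis using k z
    by (auto simp: zero_power intro!: add_nonneg_nonneg mult_nonneg_nonneg sum_nonneg prod_nonneg)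
qed

definition residue_class :: "nat \<Rightarrow> nat \<Rightarrow> nat \<Rightarrow> int set" where
  "residue_class P m c = {x \<in> {0..<int P}. x mod int m = int c}"

lemma residue_class_subset: "residue_class P m c \<subseteq> {0..<int P}"
  by (auto simp: residue_class_def)

lemma finite_residue_class [simp]: "finite (residue_class P m c)"
  using residue_class_subset by (rule finite_subset) simp

text \<open>A class modulo m lies in the affine image of an interval with P div m + 1 integers, so
  affine invariance applies once the system has been made homogeneous.\<close>

lemma solutions_residue_class:
  assumes "m > 0"
  shows "solutions k s (residue_class P m c) w \<le> solutions k s {0..<int (P div m + 1)} (\<lambda>_. 0)"
proof -
  have "solutions k s (residue_class P m c) w \<le> solutions k s (residue_class P m c) (\<lambda>_. 0)"
    by (rule solutions_le_homogeneous) simp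
  also have "\<dots> \<le> solutions k s ((\<lambda>z. int c + int m * z) ` {0..<int (P div m + 1)}) (\<lambda>_. 0)"
  proof (rule solutions_mono)
    show "residue_class P m c \<subseteq> (\<lambda>z. int c + int m * z) ` {0..<int (P div m + 1)}"
    proof
      fix x assume "x \<in> residue_class P m c"
      then have x: "0 \<le> x" "x < int P" "x mod int m = int c" by (auto simp: residue_class_def)
      have "x = int c + int m * (x div int m)" using x(3) by (metis mod_mult_div_eq)
      moreover have "x div int m \<le> int P div int m" using x assms by (intro zdiv_mono1) auto
      then have "x div int m \<in> {0..<int (P div m + 1)}"
        using x assms by (auto simp: pos_imp_zdiv_nonneg_iff zdiv_int)
      ultimately show "x \<in> (\<lambda>z. int c + int m * z) ` {0..<int (P div m + 1)}" by blast
    qed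
  qed simp
  also have "\<dots> \<le> solutions k s {0..<int (P div m + 1)} (\<lambda>_. 0)"
    by (rule solutions_affine) (use assms in auto)
  finally show ?thesis .
qed

lemma expsum_residue_classes:
  assumes "m > 0"
  shows "expsum Q k {0..<int P} \<alpha> = (\<Sum>c<m. expsum Q k (residue_class P m c) \<alpha>)"
proof -
  have "{0..<int P} = (\<Union>c<m. residue_class P m c)"
  proof
    show "{0..<int P} \<subseteq> (\<Union>c<m. residue_class P m c)"
    proof
      fix x assume "x \<in> {0..<int P}"
      moreover have "nat (x mod int m) < m" using assms by (simp add: nat_less_iff)
      ultimately show "x \<in> (\<Union>c<m. residue_class P m c)"
        using assms by (auto simp: residue_class_def intro!: bexI[of _ "nat (x mod int m)"])
    qed
  qed (auto simp: residue_class_def)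
  then show ?thesis unfolding expsum_def
    by (simp only:) (rule sum.UNION_disjoint, auto simp: residue_class_def intro: finite_subset[of _ "{0..<int P}"])
qed

text \<open>The moment counts solutions with k pairs of variables u, v in prescribed distinct
  classes modulo p and s pairs in one class b modulo M. After translation by b the latter contribute
  multiples of M^j in degree j, so u fixes the j-th power sum of v modulo M^j. Choosing among M^(k -
  j) possibilities fixes it modulo M^k = p^(a k), and then \<open>power_sums_determine\<close>
  recovers v, whose entries are below P \<le> M^k. Each admissible pair u, v leaves at most
  J_{s,k}(P div M + 1) choices for the remaining variables.\<close>

lemma mixed_moment:
  fixes p a k :: nat
  assumes p: "prime p" "k < p" and M: "M = p ^ a" and PM: "P \<le> M ^ k" and P: "P > 0"
    and c: "c \<in> inj_tuples k p" and Q: "Q > (s + k) * P ^ k"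
  shows "(\<Sum>\<alpha>\<in>freqs Q k. (\<Prod>i<k. norm (expsum Q k (residue_class P p (c i)) \<alpha>) ^ 2) *
       norm (expsum Q k (residue_class P M b) \<alpha>) ^ (2 * s)) \<le>
     real (Q ^ k * (P ^ k * M ^ (\<Sum>j=1..k. k - j) * solutions k s {0..<int (P div M + 1)} (\<lambda>_. 0)))"
proof -
  define U where "U = PiE {..<k} (\<lambda>i. residue_class P p (c i))"
  let ?B = "residue_class P M b"
  let ?J = "solutions k s {0..<int (P div M + 1)} (\<lambda>_. 0)"
  let ?w = "\<lambda>u v j. (\<Sum>i<k. u i ^ j) - (\<Sum>i<k. v i ^ j) :: int"
  let ?E = "\<lambda>u v. \<forall>j\<in>{1..k}. int M ^ j dvd (\<Sum>i<k. (v i + - int b) ^ j) - (\<Sum>i<k. (u i + - int b) ^ j)"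
  have M0: "M > 0" using p M by (simp add: prime_gt_0_nat)
  have finU: "finite U" unfolding U_def by (intro finite_PiE) auto
  have Utup: "u \<in> tuples k {0..<int P}" if "u \<in> U" for u
    using that PiE_mono[of "{..<k}" "\<lambda>i. residue_class P p (c i)" "\<lambda>_. {0..<int P}"] residue_class_subset
    unfolding U_def tuples_def by blast
  have cardU: "card U \<le> P ^ k"
  proof -
    have "card U \<le> card (tuples k {0..<int P})" using Utup by (intro card_mono) auto
    then show ?thesis by (simp add: card_tuples)
  qed
  have prod: "complex_of_real (\<Prod>i<k. norm (expsum Q k (residue_class P p (c i)) \<alpha>) ^ 2) =
     (\<Sum>(u, v)\<in>U \<times> U. phase Q k \<alpha> (?w u v))" for \<alpha>
  proof -
    have e: "(\<Prod>i<k. expsum Q k (residue_class P p (c i)) \<alpha>) = (\<Sum>u\<in>U. phase Q k \<alpha> (\<lambda>j. \<Sum>i<k. u i ^ j))"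
      unfolding expsum_def U_def phase_sum[OF finite_lessThan] by (rule prod_sum_PiE) auto
    have "complex_of_real (\<Prod>i<k. norm (expsum Q k (residue_class P p (c i)) \<alpha>) ^ 2) =
        (\<Prod>i<k. expsum Q k (residue_class P p (c i)) \<alpha>) * cnj (\<Prod>i<k. expsum Q k (residue_class P p (c i)) \<alpha>)"
      unfolding of_real_prod complex_norm_square by (simp add: prod.distrib)
    also have "\<dots> = (\<Sum>u\<in>U. \<Sum>v\<in>U. phase Q k \<alpha> (?w u v))"
      unfolding e cnj_sum phase_diff sum_product ..
    finally show ?thesis by (simp add: sum.cartesian_product)
  qed
  \<comment> \<open>\<open>?E u v\<close> is the congruence condition just described; without it no
    choice of the other variables solves the system.\<close>
  have vanish: "solutions k s ?B (\<lambda>j. - ?w u v j) \<le> (if ?E u v then ?J else 0)" if "u \<in> U" "v \<in> U" for u v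
  proof (cases "?E u v")
    case True
    then show ?thesis using solutions_residue_class[OF M0, of k s P b] by simp
  next
    case False
    have "{(x, y). x \<in> tuples s ?B \<and> y \<in> tuples s ?B \<and>
       (\<forall>j\<in>{1..k}. (\<Sum>i<s. x i ^ j) - (\<Sum>i<s. y i ^ j) = - ?w u v j)} = {}"
    proof (rule ccontr)
      assume "\<not> ?thesis"
      then obtain x y where xy: "x \<in> tuples s ?B" "y \<in> tuples s ?B"
        "\<And>j. j \<in> {1..k} \<Longrightarrow> (\<Sum>i<s. x i ^ j) - (\<Sum>i<s. y i ^ j) = - ?w u v j" by blast
      have d: "int M ^ j dvd (\<Sum>i<s. (z i + - int b) ^ j)" if "z \<in> tuples s ?B" for z j
      proof (intro dvd_sum dvd_power_same)
        fix i assume "i \<in> {..<s}"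
        then have "z i \<in> ?B" using that unfolding tuples_def by blast
        then have "z i mod int M = int b" by (simp add: residue_class_def)
        then show "int M dvd z i + - int b" using mod_eq_dvd_iff[of "z i" "int M" "int b"]
          by (metis diff_conv_add_uminus dvd_minus_mod)
      qed
      have "?E u v"
      proof
        fix j assume j: "j \<in> {1..k}"
        have "(\<Sum>i<s. (x i + - int b) ^ j) - (\<Sum>i<s. (y i + - int b) ^ j) =
           (\<Sum>i<k. (v i + - int b) ^ j) - (\<Sum>i<k. (u i + - int b) ^ j)"
          by (rule power_sums_shift[OF _ j]) (use xy(3) in auto)
        then show "int M ^ j dvd (\<Sum>i<k. (v i + - int b) ^ j) - (\<Sum>i<k. (u i + - int b) ^ j)"
          using dvd_diff[OF d[OF xy(1), of j] d[OF xy(2), of j]] by simp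
      qed
      then show False using False by simp
    qed
    then have "solutions k s ?B (\<lambda>j. - ?w u v j) = 0" unfolding solutions_def by (simp only: card.empty)
    then show ?thesis by simp
  qed
  have count: "card {v \<in> U. ?E u v} \<le> M ^ (\<Sum>j=1..k. k - j)" for u
  proof -
    let ?\<psi> = "\<lambda>v j. (\<Sum>i<k. (v i + - int b) ^ j) - (\<Sum>i<k. (u i + - int b) ^ j)"
    \<comment> \<open>The digits missing between modulus M^j and modulus M^k: one number below M^(k
      - j) for each degree j.\<close>
    let ?g = "\<lambda>v. \<lambda>j\<in>{1..k}. nat (?\<psi> v j div int M ^ j mod int M ^ (k - j))"
    have "card {v \<in> U. ?E u v} \<le> card (PiE {1..k} (\<lambda>j. {..<M ^ (k - j)}))"
    proof (rule card_inj_on_le[where f = ?g])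
      show "inj_on ?g {v \<in> U. ?E u v}"
      proof (rule inj_onI, elim CollectE conjE)
        fix v v' assume v: "v \<in> U" "v' \<in> U" "?E u v" "?E u v'" and e: "?g v = ?g v'"
        have "[(\<Sum>i<k. (v i + - int b) ^ j) = (\<Sum>i<k. (v' i + - int b) ^ j)] (mod int p ^ (a * k))"
          if j: "j \<in> {1..k}" for j
        proof -
          obtain r r' where r: "?\<psi> v j = int M ^ j * r" "?\<psi> v' j = int M ^ j * r'"
            using v(3,4) j by (meson dvdE)
          have "nat (r mod int M ^ (k - j)) = nat (r' mod int M ^ (k - j))"
            using fun_cong[OF e, of j] j M0 by (simp only: restrict_apply if_True r) simp
          then have "r mod int M ^ (k - j) = r' mod int M ^ (k - j)"
            using M0 by (simp add: nat_eq_iff2)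
          then have "int M ^ (k - j) dvd r - r'" by (simp add: mod_eq_dvd_iff)
          then have "int M ^ j * int M ^ (k - j) dvd ?\<psi> v j - ?\<psi> v' j"
            unfolding r by (metis dvd_refl mult_dvd_mono right_diff_distrib)
          moreover have "int M ^ j * int M ^ (k - j) = int p ^ (a * k)"
            using j by (simp add: M power_add[symmetric] power_mult)
          ultimately show ?thesis by (simp add: cong_iff_dvd_diff)
        qed
        note ps = this
        have vi: "v i = v' i" if i: "i < k" for i
        proof -
          have cl: "v i mod int p = int (c i)" "v' i mod int p = int (c i)" "0 \<le> v i" "v i < int P" "0 \<le> v' i" "v' i < int P" if "i < k" for i
            using v(1,2) that unfolding U_def residue_class_def by (auto dest: PiE_mem)
          have "[v i + - int b = v' i + - int b] (mod int p ^ (a * k))"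
          proof (rule power_sums_determine[of "int p" k "\<lambda>i. v i + - int b" "\<lambda>i. v' i + - int b"])
            show "prime (int p)" using p by simp
            show "int k < int p" using p by simp
            show "[v i + - int b = v' i + - int b] (mod int p)" if "i < k" for i
              using cl[OF that] by (intro cong_add) (auto simp: cong_def)
            show "\<not> [v' i + - int b = v' l + - int b] (mod int p)" if "i < k" "l < k" "i \<noteq> l" for i l
            proof
              assume "[v' i + - int b = v' l + - int b] (mod int p)"
              then have "[v' i = v' l] (mod int p)" by (rule cong_add_rcancel[THEN iffD1])
              then have "c i = c l" using cl that by (simp add: cong_def)
              then show False using c that by (auto simp: inj_tuples_def inj_on_def)
            qed
          qed (use i ps in auto)
          then have "[v i = v' i] (mod int p ^ (a * k))" by (rule cong_add_rcancel[THEN iffD1])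
          moreover have "int P \<le> int p ^ (a * k)" using PM
            unfolding M power_mult[symmetric] of_nat_power[symmetric] of_nat_le_iff .
          then have "v i < int p ^ (a * k)" "v' i < int p ^ (a * k)" using cl[OF i] by linarith+
          ultimately show ?thesis using cl[OF i] by (intro cong_less_imp_eq_int[where m = "int p ^ (a * k)"])
        qed
        show "v = v'"
        proof (rule PiE_ext)
          show "v \<in> PiE {..<k} (\<lambda>i. residue_class P p (c i))" "v' \<in> PiE {..<k} (\<lambda>i. residue_class P p (c i))"
            using v unfolding U_def by auto
        qed (use vi in auto)
      qed
      show "?g ` {v \<in> U. ?E u v} \<subseteq> PiE {1..k} (\<lambda>j. {..<M ^ (k - j)})"
        using M0 by (auto simp: nat_less_iff)
    qed (auto intro: finite_PiE)
    also have "\<dots> = M ^ (\<Sum>j=1..k. k - j)" by (simp add: card_PiE power_sum)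
    finally show ?thesis .
  qed
  have "complex_of_real (\<Sum>\<alpha>\<in>freqs Q k. (\<Prod>i<k. norm (expsum Q k (residue_class P p (c i)) \<alpha>) ^ 2) *
       norm (expsum Q k ?B \<alpha>) ^ (2 * s)) =
     (\<Sum>\<alpha>\<in>freqs Q k. \<Sum>(u, v)\<in>U \<times> U. of_real (norm (expsum Q k ?B \<alpha>) ^ (2 * s)) * phase Q k \<alpha> (?w u v))"
    unfolding of_real_sum of_real_mult prod sum_distrib_right
    by (intro sum.cong refl) (simp add: case_prod_unfold mult.commute)
  also have "\<dots> = (\<Sum>(u, v)\<in>U \<times> U. \<Sum>\<alpha>\<in>freqs Q k. of_real (norm (expsum Q k ?B \<alpha>) ^ (2 * s)) * phase Q k \<alpha> (?w u v))"
    by (subst sum.swap) (simp add: case_prod_unfold)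
  also have "\<dots> = (\<Sum>(u, v)\<in>U \<times> U. of_nat (Q ^ k * solutions k s ?B (\<lambda>j. - ?w u v j)))"
  proof (intro sum.cong refl, clarify)
    fix u v assume uv: "u \<in> U" "v \<in> U"
    show "(\<Sum>\<alpha>\<in>freqs Q k. of_real (norm (expsum Q k ?B \<alpha>) ^ (2 * s)) * phase Q k \<alpha> (?w u v)) =
       of_nat (Q ^ k * solutions k s ?B (\<lambda>j. - ?w u v j))"
    proof (rule twisted_moment[OF residue_class_subset P _ Q])
      fix j assume j: "j \<in> {1..k}"
      show "\<bar>?w u v j\<bar> \<le> int k * int P ^ k"
        using power_sum_bound[OF subset_refl Utup[OF uv(1)] j P] power_sum_bound[OF subset_refl Utup[OF uv(2)] j P]
        by linarith
    qed
  qed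
  also have "\<dots> = complex_of_real (real (\<Sum>(u, v)\<in>U \<times> U. Q ^ k * solutions k s ?B (\<lambda>j. - ?w u v j)))"
    by (simp add: case_prod_unfold)
  finally have "(\<Sum>\<alpha>\<in>freqs Q k. (\<Prod>i<k. norm (expsum Q k (residue_class P p (c i)) \<alpha>) ^ 2) *
       norm (expsum Q k ?B \<alpha>) ^ (2 * s)) = real (\<Sum>(u, v)\<in>U \<times> U. Q ^ k * solutions k s ?B (\<lambda>j. - ?w u v j))"
    by (simp only: of_real_eq_iff)
  also have "real (\<Sum>(u, v)\<in>U \<times> U. Q ^ k * solutions k s ?B (\<lambda>j. - ?w u v j)) \<le>
      real (\<Sum>u\<in>U. \<Sum>v\<in>U. Q ^ k * (if ?E u v then ?J else 0))"
    unfolding of_nat_le_iff sum.cartesian_product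
  proof (intro sum_mono, clarify)
    fix u v assume "u \<in> U" "v \<in> U"
    then show "Q ^ k * solutions k s ?B (\<lambda>j. - ?w u v j) \<le> Q ^ k * (if ?E u v then ?J else 0)"
      by (intro mult_le_mono2 vanish)
  qed
  also have "(\<Sum>u\<in>U. \<Sum>v\<in>U. Q ^ k * (if ?E u v then ?J else 0)) = (\<Sum>u\<in>U. Q ^ k * (card {v \<in> U. ?E u v} * ?J))"
  proof -
    have "(\<Sum>v\<in>U. Q ^ k * (if ?E u v then ?J else 0)) = Q ^ k * (card {v \<in> U. ?E u v} * ?J)" for u
    proof -
      have "(\<Sum>v\<in>U. (if ?E u v then ?J else 0)) = (\<Sum>v\<in>{v \<in> U. ?E u v}. ?J)"
        using finU by (simp only: sum.inter_filter)
      then show ?thesis by (simp only: sum_distrib_left[symmetric] sum_constant of_nat_id)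
    qed
    then show ?thesis by (intro sum.cong refl)
  qed
  also have "real \<dots> \<le> real (\<Sum>u\<in>U. Q ^ k * (M ^ (\<Sum>j=1..k. k - j) * ?J))"
    unfolding of_nat_le_iff by (intro sum_mono mult_le_mono mult_right_mono count order_refl)
  also have "\<dots> \<le> real (P ^ k * (Q ^ k * (M ^ (\<Sum>j=1..k. k - j) * ?J)))"
    unfolding of_nat_le_iff sum_constant of_nat_id by (rule mult_le_mono1[OF cardU])
  finally show ?thesis by (simp add: mult_ac)
qed

abbreviation vinogradov :: "nat \<Rightarrow> nat \<Rightarrow> nat \<Rightarrow> nat" where
  "vinogradov k s P \<equiv> solutions k s {0..<int P} (\<lambda>_. 0)"

text \<open>\<open>distinct_classes_bound\<close> is applied at each frequency and summed. Its first
  term concerns solutions inside one class modulo p. In its second term f^(2s) is split over the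
  classes modulo M by the power mean inequality, which costs M^(2s - 1) and, together with the sum
  over the classes, M^(2s); what remains are mixed moments.\<close>

lemma vinogradov_recursion:
  fixes p a k s P :: nat
  assumes p: "prime p" "k < p" and M: "M = p ^ a" and PM: "P \<le> M ^ k" and P: "P > 0"
    and k: "k > 0" and s: "s > 0"
  shows "real (vinogradov k (s + k) P) \<le>
    real (2 * k) ^ (2 * (s + k)) * (real p * vinogradov k (s + k) (P div p + 1)) +
    real (2 * p) ^ (2 * k) * real p ^ k * real M ^ (2 * s) *
      (real P ^ k * real M ^ (\<Sum>j=1..k. k - j) * vinogradov k s (P div M + 1))"
proof -
  define Q where "Q = (s + k) * P ^ k + 1"
  have Q: "Q > (s + k) * P ^ k" "Q > 0" by (simp_all add: Q_def)
  have p0: "p > 0" and M0: "M > 0" using p M by (auto simp: prime_gt_0_nat)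
  let ?F = "freqs Q k"
  let ?z = "\<lambda>\<alpha> c. norm (expsum Q k (residue_class P p c) \<alpha>)"
  let ?y = "\<lambda>\<alpha> b. norm (expsum Q k (residue_class P M b) \<alpha>)"
  let ?f = "\<lambda>\<alpha>. norm (expsum Q k {0..<int P} \<alpha>)"
  let ?J1 = "real (vinogradov k (s + k) (P div p + 1))"
  let ?J2 = "real (vinogradov k s (P div M + 1))"
  let ?e = "\<Sum>j=1..k. k - j"
  have fz: "?f \<alpha> \<le> (\<Sum>c<p. ?z \<alpha> c)" for \<alpha>
    unfolding expsum_residue_classes[OF p0] by (rule norm_sum)
  have fy: "?f \<alpha> ^ (2 * s) \<le> real M ^ (2 * s - 1) * (\<Sum>b<M. ?y \<alpha> b ^ (2 * s))" for \<alpha>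
  proof -
    have "?f \<alpha> \<le> (\<Sum>b<M. ?y \<alpha> b)"
      unfolding expsum_residue_classes[OF M0] by (rule norm_sum)
    then have "?f \<alpha> ^ (2 * s) \<le> (\<Sum>b<M. ?y \<alpha> b) ^ (2 * s)" by (rule power_mono) simp
    also have "\<dots> \<le> real (card {..<M}) ^ (2 * s - 1) * (\<Sum>b<M. ?y \<alpha> b ^ (2 * s))"
      using power_mean_le[of "{..<M}" "?y \<alpha>" "2 * s - 1"] s by simp
    finally show ?thesis by simp
  qed
  have first: "(\<Sum>\<alpha>\<in>?F. \<Sum>c<p. ?z \<alpha> c ^ (2 * (s + k))) \<le> real Q ^ k * (real p * ?J1)"
  proof -
    have "(\<Sum>\<alpha>\<in>?F. \<Sum>c<p. ?z \<alpha> c ^ (2 * (s + k))) = (\<Sum>c<p. \<Sum>\<alpha>\<in>?F. ?z \<alpha> c ^ (2 * (s + k)))"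
      by (rule sum.swap)
    also have "\<dots> = (\<Sum>c<p. real (Q ^ k * solutions k (s + k) (residue_class P p c) (\<lambda>_. 0)))"
      by (intro sum.cong refl moment[OF residue_class_subset P]) (use Q in simp)
    also have "\<dots> \<le> (\<Sum>c<p. real (Q ^ k) * ?J1)"
      unfolding of_nat_mult
      by (intro sum_mono mult_left_mono of_nat_mono solutions_residue_class p0) auto
    finally show ?thesis by (simp add: mult_ac)
  qed
  have second: "(\<Sum>\<alpha>\<in>?F. ?f \<alpha> ^ (2 * s) * (\<Sum>c\<in>inj_tuples k p. \<Prod>i<k. ?z \<alpha> (c i) ^ 2)) \<le>
     real Q ^ k * (real p ^ k * real M ^ (2 * s) * (real P ^ k * real M ^ ?e * ?J2))"
  proof -
    have "(\<Sum>\<alpha>\<in>?F. ?f \<alpha> ^ (2 * s) * (\<Sum>c\<in>inj_tuples k p. \<Prod>i<k. ?z \<alpha> (c i) ^ 2)) \<le>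
      (\<Sum>\<alpha>\<in>?F. (real M ^ (2 * s - 1) * (\<Sum>b<M. ?y \<alpha> b ^ (2 * s))) * (\<Sum>c\<in>inj_tuples k p. \<Prod>i<k. ?z \<alpha> (c i) ^ 2))"
      by (intro sum_mono mult_right_mono fy sum_nonneg prod_nonneg) auto
    also have "\<dots> = real M ^ (2 * s - 1) * (\<Sum>\<alpha>\<in>?F. \<Sum>b<M. \<Sum>c\<in>inj_tuples k p. (\<Prod>i<k. ?z \<alpha> (c i) ^ 2) * ?y \<alpha> b ^ (2 * s))"
      by (simp add: sum_distrib_left sum_product mult_ac)
    also have "(\<Sum>\<alpha>\<in>?F. \<Sum>b<M. \<Sum>c\<in>inj_tuples k p. (\<Prod>i<k. ?z \<alpha> (c i) ^ 2) * ?y \<alpha> b ^ (2 * s)) =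
       (\<Sum>b<M. \<Sum>c\<in>inj_tuples k p. \<Sum>\<alpha>\<in>?F. (\<Prod>i<k. ?z \<alpha> (c i) ^ 2) * ?y \<alpha> b ^ (2 * s))"
      by (rule trans[OF sum.swap], rule sum.cong[OF refl], rule sum.swap)
    also have "\<dots> \<le> (\<Sum>b<M. \<Sum>c\<in>inj_tuples k p. real (Q ^ k * (P ^ k * M ^ ?e * vinogradov k s (P div M + 1))))"
      by (intro sum_mono mixed_moment[where a = a] p M PM P Q)
    also have "\<dots> = real M * (real (card (inj_tuples k p)) * real (Q ^ k * (P ^ k * M ^ ?e * vinogradov k s (P div M + 1))))"
      by simp
    also have "\<dots> \<le> real M * (real (p ^ k) * real (Q ^ k * (P ^ k * M ^ ?e * vinogradov k s (P div M + 1))))"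
      by (intro mult_left_mono mult_right_mono of_nat_mono card_inj_tuples_le) auto
    finally have "(\<Sum>\<alpha>\<in>?F. ?f \<alpha> ^ (2 * s) * (\<Sum>c\<in>inj_tuples k p. \<Prod>i<k. ?z \<alpha> (c i) ^ 2)) \<le>
       real M ^ (2 * s - 1) * (real M * (real (p ^ k) * real (Q ^ k * (P ^ k * M ^ ?e * vinogradov k s (P div M + 1)))))"
      by (simp add: mult_left_mono)
    also have "\<dots> = real M ^ (2 * s - 1 + 1) * (real (p ^ k) * real (Q ^ k * (P ^ k * M ^ ?e * vinogradov k s (P div M + 1))))"
      by (simp only: power_add power_one_right mult.assoc)
    also have "2 * s - 1 + 1 = 2 * s" using s by simp
    finally show ?thesis by (simp add: mult_ac)
  qed
  have "real Q ^ k * real (vinogradov k (s + k) P) = (\<Sum>\<alpha>\<in>?F. ?f \<alpha> ^ (2 * (s + k)))"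
    using moment[of "{0..<int P}" P "s + k" k Q] P Q by simp
  also have "\<dots> \<le> (\<Sum>\<alpha>\<in>?F. real (2 * k) ^ (2 * (s + k)) * (\<Sum>c<p. ?z \<alpha> c ^ (2 * (s + k))) +
     real (2 * p) ^ (2 * k) * (?f \<alpha> ^ (2 * s) * (\<Sum>c\<in>inj_tuples k p. \<Prod>i<k. ?z \<alpha> (c i) ^ 2)))"
    by (intro sum_mono distinct_classes_bound fz k) auto
  also have "\<dots> = real (2 * k) ^ (2 * (s + k)) * (\<Sum>\<alpha>\<in>?F. \<Sum>c<p. ?z \<alpha> c ^ (2 * (s + k))) +
     real (2 * p) ^ (2 * k) * (\<Sum>\<alpha>\<in>?F. ?f \<alpha> ^ (2 * s) * (\<Sum>c\<in>inj_tuples k p. \<Prod>i<k. ?z \<alpha> (c i) ^ 2))"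
    by (simp only: sum.distrib sum_distrib_left)
  also have "\<dots> \<le> real (2 * k) ^ (2 * (s + k)) * (real Q ^ k * (real p * ?J1)) +
     real (2 * p) ^ (2 * k) * (real Q ^ k * (real p ^ k * real M ^ (2 * s) * (real P ^ k * real M ^ ?e * ?J2)))"
    by (intro add_mono mult_left_mono first second) auto
  also have "\<dots> = real Q ^ k * (real (2 * k) ^ (2 * (s + k)) * (real p * ?J1) +
     real (2 * p) ^ (2 * k) * real p ^ k * real M ^ (2 * s) * (real P ^ k * real M ^ ?e * ?J2))"
    by (simp add: algebra_simps)
  finally show ?thesis using Q by (simp only: mult_le_cancel_left_pos zero_less_power of_nat_0_less_iff)
qed

section \<open>Iteration of the recursion\<close>

lemma sum_gap: "(\<Sum>j=1..k. k - j) = k * (k - 1) div 2" for k :: nat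
proof -
  have "(\<Sum>j=1..k. k - j) = (\<Sum>i<k. i)"
    by (rule sum.reindex_bij_witness[where i = "\<lambda>i. k - i" and j = "\<lambda>j. k - j"]) auto
  also have "\<dots> = k * (k - 1) div 2"
    using gauss_sum_nat[of "k - 1"] by (cases k) (simp_all add: lessThan_Suc_atMost atLeast0AtMost mult.commute)
  finally show ?thesis .
qed

text \<open>The defect \<open>\<eta>\<close> of the mean value estimate contracts by the factor \<open>1 - 1/k\<close>.
  The first term of the recursion is absorbed by induction on \<open>P\<close>, because
  \<open>p\<close> is large compared with \<open>k\<close>.\<close>
lemma mean_value_step:
  fixes p k s :: nat and C \<eta> K :: real
  assumes p: "prime p" "p \<ge> 64 * k ^ 4" and k: "k \<ge> 2" and K: "K = k * (k + 1) / 2" and s: "s \<ge> K"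
    and \<eta>: "0 \<le> \<eta>" "\<eta> \<le> K" and C: "C \<ge> 1"
    and IH: "\<And>P. P > 0 \<Longrightarrow> real (vinogradov k s P) \<le> C * real P powr (2 * real s - K + \<eta>)"
    and P: "P > 0"
  shows "real (vinogradov k (s + k) P) \<le>
    C * real p ^ (2 * k ^ 2 + 6 * k + 2 * s) * real P powr (2 * real (s + k) - K + \<eta> * (1 - 1 / k))"
  using P
proof (induction P rule: less_induct)
  case (less P)
  define E where "E = 2 * k ^ 2 + 6 * k + 2 * s"
  define C' where "C' = C * real p ^ E"
  define e1 where "e1 = 2 * real s - K + \<eta>"
  define e2 where "e2 = 2 * real (s + k) - K + \<eta> * (1 - 1 / k)"
  have k1: "1 \<le> k ^ 4" using k by simp
  have p0: "real p \<ge> 64" using p(2) k1 by linarith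
  have K2: "2 * K = real (k ^ 2 + k)" unfolding K by (simp add: power2_eq_square algebra_simps)
  have kk: "k ^ 2 = k * k" "k * k \<ge> 2 * k" using k by (auto simp: power2_eq_square)
  have Kk: "K \<le> real k * real k" "K \<ge> k" proof -
    have "2 * real k \<le> real k * real k" using k by (intro mult_right_mono) auto
    moreover have "2 * K = real k * real k + real k" using K2 by (simp add: power2_eq_square)
    ultimately show "K \<le> real k * real k" "K \<ge> k" using k by linarith+
  qed
  have \<eta>k: "0 \<le> \<eta> * (1 - 1 / k)" "\<eta> * (1 - 1 / k) \<le> \<eta>"
    using \<eta> k by (auto simp: mult_left_le)
  have C'1: "C' \<ge> 1" unfolding C'_def using C p0 by (simp add: mult_ge1_I)
  have e2: "e2 \<ge> real (s + k)" using s \<eta>k unfolding e2_def by simp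
  have e1: "0 \<le> e1" "e1 \<le> 2 * real s" using s \<eta> Kk unfolding e1_def by auto
  have P1: "real P \<ge> 1" using less.prems by simp
  have "real (vinogradov k (s + k) P) \<le> C' * real P powr e2"
  \<comment> \<open>For P \<le> p^2 the trivial count exceeds the claimed power of P by at most P^K
    \<le> p^(2K) = p^(k^2 + k), which the constant absorbs.\<close>
  proof (cases "P \<le> p ^ 2")
    case True
    have "real (vinogradov k (s + k) P) \<le> real (P ^ (2 * (s + k)))"
      unfolding of_nat_le_iff using solutions_le_trivial[of "{0..<int P}" k "s + k" "\<lambda>_. 0"] by simp
    also have "\<dots> = real P powr (2 * real (s + k))" using P1 by (simp flip: powr_realpow)
    also have "\<dots> = real P powr (2 * real (s + k) - e2) * real P powr e2" by (simp flip: powr_add)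
    also have "real P powr (2 * real (s + k) - e2) \<le> C'"
    proof -
      have "real P powr (2 * real (s + k) - e2) \<le> real P powr K"
        using P1 \<eta>k by (intro powr_mono) (auto simp: e2_def)
      also have "\<dots> \<le> (real p powr 2) powr K"
      proof (rule powr_mono2)
        show "real P \<le> real p powr 2" using True p0 by (simp flip: of_nat_power)
      qed (use Kk in auto)
      also have "\<dots> = real p powr real (k ^ 2 + k)" by (simp only: powr_powr K2)
      also have "\<dots> = real p ^ (k ^ 2 + k)" using p0 by (intro powr_realpow) simp
      also have "\<dots> \<le> real p ^ E" using p0 by (intro power_increasing) (auto simp: E_def)
      also have "\<dots> \<le> C'" unfolding C'_def using C p0 by (simp add: mult_right_mono)
      finally show ?thesis .
    qed
    finally show ?thesis by (simp add: mult_right_mono)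
  next
    case False
    then have Pp: "real p ^ 2 < real P" by (simp flip: of_nat_power)
    have p1: "p > 1" using p0 by simp
    \<comment> \<open>Least \<open>a\<close> with P \<le> p^(a k), so that M exceeds P^(1/k) by at
      most a factor p.\<close>
    define a where "a = (LEAST a. P \<le> (p ^ a) ^ k)"
    define M where "M = p ^ a"
    have "P \<le> (p ^ P) ^ k"
    proof -
      have "P \<le> p ^ P" using p1 by (simp add: less_imp_le_nat power_gt_expt)
      also have "\<dots> \<le> (p ^ P) ^ k" using k p1 by (intro self_le_power) auto
      finally show ?thesis .
    qed
    then have PM: "P \<le> M ^ k" unfolding a_def M_def by (rule LeastI)
    have "a \<noteq> 0"
    proof
      assume "a = 0"
      then have "P \<le> 1" using PM by (simp add: M_def)
      then have "real P \<le> 1" by simp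
      moreover have "1 \<le> real p ^ 2" using p0 by (intro one_le_power) simp
      ultimately show False using Pp by linarith
    qed
    then have "\<not> P \<le> (p ^ (a - 1)) ^ k" unfolding a_def by (intro not_less_Least) simp
    moreover have "M = p * p ^ (a - 1)" using \<open>a \<noteq> 0\<close> by (simp add: M_def flip: power_Suc)
    ultimately have Mk: "real M ^ k \<le> real p ^ k * real P"
      by (simp add: power_mult_distrib mult_left_mono flip: of_nat_power of_nat_mult)
    have Mpos: "real M > 0" using p1 by (simp add: M_def)
    have Mle: "real M \<le> real p * real P powr (1 / k)"
    proof -
      have "real M = (real M ^ k) powr (1 / k)" using Mpos k by (simp add: powr_powr flip: powr_realpow)
      also have "\<dots> \<le> (real p ^ k * real P) powr (1 / k)" using Mk Mpos by (intro powr_mono2) auto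
      also have "\<dots> = real p * real P powr (1 / k)" using p0 k
        by (simp add: powr_mult powr_powr flip: powr_realpow)
      finally show ?thesis .
    qed
    \<comment> \<open>From p^2 < P and k \<ge> 2 it follows that p P^(1/k) \<le> P^(1/2)
      P^(1/2).\<close>
    have MP: "real M \<le> real P"
    proof -
      have "real p \<le> real P powr (1 / 2)"
        using Pp p0 by (simp add: powr_half_sqrt real_le_rsqrt)
      moreover have "real P powr (1 / k) \<le> real P powr (1 / 2)"
        using P1 k by (intro powr_mono) (auto simp: field_simps)
      ultimately have "real p * real P powr (1 / k) \<le> real P powr (1 / 2) * real P powr (1 / 2)"
        by (intro mult_mono) auto
      also have "\<dots> = real P" using P1 by (simp flip: powr_add)
      finally show ?thesis using Mle by simp
    qed
    have pP: "real p \<le> real P" using Pp p0 self_le_power[of "real p" 2] by simp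
    have half: "real (P div m + 1) \<le> 2 * real P / real m" if "0 < real m" "real m \<le> real P" for m
    proof -
      have "real (P div m) \<le> real P / real m" by (rule of_nat_div_le_of_nat)
      moreover have "1 \<le> real P / real m" using that by simp
      ultimately show ?thesis by simp
    qed
    have rec: "real (vinogradov k (s + k) P) \<le>
      real (2 * k) ^ (2 * (s + k)) * (real p * vinogradov k (s + k) (P div p + 1)) +
      real (2 * p) ^ (2 * k) * real p ^ k * real M ^ (2 * s) *
        (real P ^ k * real M ^ (\<Sum>j=1..k. k - j) * vinogradov k s (P div M + 1))"
    proof (rule vinogradov_recursion[OF p(1) _ M_def PM])
      have "k \<le> k ^ 4" using k by (intro self_le_power) auto
      then show "k < p" using p(2) k by linarith
      show "0 < s" using s Kk k by (cases s) auto
    qed (use less.prems k in auto)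
    have t1: "real (2 * k) ^ (2 * (s + k)) * (real p * vinogradov k (s + k) (P div p + 1)) \<le> C' / 2 * real P powr e2"
    proof -
      have "P div p + 1 < P"
      proof -
        have "real (P div p + 1) \<le> 2 * real P / real p" using half[of p] p0 pP by simp
        also have "\<dots> < real P" using p0 P1 by (simp add: field_simps)
        finally show ?thesis by simp
      qed
      then have "real (vinogradov k (s + k) (P div p + 1)) \<le> C' * real (P div p + 1) powr e2"
        using less.IH[of "P div p + 1"] unfolding C'_def E_def e2_def by simp
      also have "\<dots> \<le> C' * (2 * real P / real p) powr e2"
        using half[of p] p0 pP C'1 e2 by (intro mult_left_mono powr_mono2) auto
      also have "(2 * real P / real p) powr e2 = (2 / real p) powr e2 * real P powr e2"
        using p0 P1 by (simp add: powr_mult[symmetric])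
      also have "(2 / real p) powr e2 \<le> (2 / real p) powr real (s + k)"
        using e2 p0 by (intro powr_mono') auto
      also have "\<dots> = (2 / real p) ^ (s + k)" using p0 by (intro powr_realpow) auto
      finally have "real (vinogradov k (s + k) (P div p + 1)) \<le> C' * ((2 / real p) ^ (s + k) * real P powr e2)"
        using C'1 by (simp add: mult_left_mono mult_right_mono)
      then have "real (2 * k) ^ (2 * (s + k)) * (real p * vinogradov k (s + k) (P div p + 1)) \<le>
        real (2 * k) ^ (2 * (s + k)) * (real p * (C' * ((2 / real p) ^ (s + k) * real P powr e2)))"
        by (intro mult_left_mono) auto
      also have "\<dots> = (real p * ((real (2 * k)) ^ 2 * (2 / real p)) ^ (s + k)) * (C' * real P powr e2)"
        unfolding power_mult[of "real (2 * k)" 2] power_mult_distrib by (simp only: mult_ac)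
      also have "\<dots> \<le> 1 / 2 * (C' * real P powr e2)"
      proof (rule mult_right_mono)
        \<comment> \<open>The hypothesis p \<ge> 64 k^4 is made for this point: y = 8 k^2 / p then
          satisfies y^2 \<le> 1/p, and with s + k \<ge> 4 the factor p y^(s + k) falls below
          1/2.\<close>
        define y where "y = (real (2 * k)) ^ 2 * (2 / real p)"
        have "real (64 * k ^ 4) \<le> real p" using p(2) by (simp only: of_nat_le_iff)
        then have y2: "y ^ 2 \<le> 1 / real p" "y \<ge> 0"
          using p0 by (auto simp: y_def power2_eq_square field_simps eval_nat_numeral)
        have y1: "y \<le> 1"
        proof -
          have "y ^ 2 \<le> 1 ^ 2" using y2 p0 by (simp add: order_trans[of _ "1 / real p"])
          then show ?thesis by (rule power2_le_imp_le) simp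
        qed
        have "s + k \<ge> 4" using s Kk k by linarith
        then have "y ^ (s + k) \<le> y ^ 4" using y1 y2 by (intro power_decreasing) auto
        also have "\<dots> = (y ^ 2) ^ 2" by simp
        also have "\<dots> \<le> (1 / real p) ^ 2" using y2 by (intro power_mono) auto
        finally have "real p * y ^ (s + k) \<le> real p * (1 / real p) ^ 2" by (intro mult_left_mono) auto
        also have "\<dots> \<le> 1 / 2" using p0 by (simp add: power2_eq_square field_simps)
        finally show "real p * ((real (2 * k)) ^ 2 * (2 / real p)) ^ (s + k) \<le> 1 / 2" by (simp add: y_def)
      qed (use C'1 in auto)
      finally show ?thesis by simp
    qed
    have t2: "real (2 * p) ^ (2 * k) * real p ^ k * real M ^ (2 * s) *
        (real P ^ k * real M ^ (\<Sum>j=1..k. k - j) * vinogradov k s (P div M + 1)) \<le> C' / 2 * real P powr e2"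
    proof -
      have gap: "real (\<Sum>j=1..k. k - j) = K - k"
      proof -
        have "even (k * (k - 1))" by (cases "even k") auto
        then have "2 * real (\<Sum>j=1..k. k - j) = real (k * (k - 1))" unfolding sum_gap
          by (metis dvd_mult_div_cancel of_nat_mult of_nat_numeral)
        also have "\<dots> = 2 * (K - k)" using k unfolding right_diff_distrib K2 by (simp add: of_nat_diff power2_eq_square algebra_simps)
        finally show ?thesis by simp
      qed
      have "real (vinogradov k s (P div M + 1)) \<le> C * real (P div M + 1) powr e1"
        using IH[of "P div M + 1"] by (simp add: e1_def)
      also have "\<dots> \<le> C * (2 * real P / real M) powr e1"
        using half[OF Mpos MP] C e1 by (intro mult_left_mono powr_mono2) auto
      also have "(2 * real P / real M) powr e1 = 2 powr e1 * (real P powr e1 * real M powr (- e1))"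
        using Mpos P1 by (simp add: powr_mult powr_divide powr_minus divide_simps)
      also have "2 powr e1 \<le> 2 powr (2 * real s)" using e1 by (intro powr_mono) auto
      also have "2 powr (2 * real s) = 2 ^ (2 * s)" using powr_realpow[of 2 "2 * s"] by simp
      finally have J: "real (vinogradov k s (P div M + 1)) \<le> C * (2 ^ (2 * s) * (real P powr e1 * real M powr (- e1)))"
        using C by (simp add: mult_left_mono mult_right_mono)
      have "real M ^ (2 * s) * (real P ^ k * real M ^ (\<Sum>j=1..k. k - j) * vinogradov k s (P div M + 1)) \<le>
        real M ^ (2 * s) * (real P ^ k * real M ^ (\<Sum>j=1..k. k - j) * (C * (2 ^ (2 * s) * (real P powr e1 * real M powr (- e1)))))"
        using J by (intro mult_left_mono) auto
      also have "\<dots> = C * 2 ^ (2 * s) * ((real P powr k * real P powr e1) * (real M powr (2 * real s) * real M powr (K - k) * real M powr (- e1)))"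
      proof -
        have "real M ^ (2 * s) = real M powr (2 * real s)" using Mpos by (simp flip: powr_realpow)
        moreover have "real M ^ (\<Sum>j=1..k. k - j) = real M powr (K - k)"
          using Mpos unfolding gap[symmetric] by (simp only: powr_realpow)
        moreover have "real P ^ k = real P powr k" using P1 by (simp flip: powr_realpow)
        ultimately show ?thesis by (simp only: mult_ac)
      qed
      also have "real P powr k * real P powr e1 = real P powr (k + e1)" by (simp add: powr_add)
      also have "real M powr (2 * real s) * real M powr (K - k) * real M powr (- e1) = real M powr (real k * real k - \<eta>)"
      proof -
        have "2 * real s + (K - k) + - e1 = real k * real k - \<eta>"
          using K2 unfolding e1_def by (simp add: power2_eq_square)
        then show ?thesis by (simp only: powr_add[symmetric])
      qed
      \<comment> \<open>Here the defect contracts: the power M^(k^2 - \<eta>), with M about P^(1/k),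
        contributes P^(k - \<eta>/k).\<close>
      also have "real M powr (real k * real k - \<eta>) \<le> real p powr (real k * real k) * real P powr (k - \<eta> / k)"
      proof -
        have "real M powr (real k * real k - \<eta>) \<le> (real p * real P powr (1 / k)) powr (real k * real k - \<eta>)"
          using Mle Mpos \<eta> Kk by (intro powr_mono2) auto
        also have "\<dots> = real p powr (real k * real k - \<eta>) * real P powr (1 / k * (real k * real k - \<eta>))"
          using p0 by (simp add: powr_mult powr_powr)
        also have "1 / k * (real k * real k - \<eta>) = k - \<eta> / k" using k by (simp add: field_simps)
        also have "real p powr (real k * real k - \<eta>) \<le> real p powr (real k * real k)"
          using p0 \<eta> by (intro powr_mono) auto
        finally show ?thesis by (simp add: mult_right_mono)
      qed
      finally have "real M ^ (2 * s) * (real P ^ k * real M ^ (\<Sum>j=1..k. k - j) * vinogradov k s (P div M + 1)) \<le>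
        C * 2 ^ (2 * s) * (real P powr (k + e1) * (real p powr (real k * real k) * real P powr (k - \<eta> / k)))"
        using C by (simp add: mult_left_mono)
      also have "\<dots> = C * 2 ^ (2 * s) * real p ^ (k * k) * (real P powr (k + e1) * real P powr (k - \<eta> / k))"
        using p0 powr_realpow[of "real p" "k * k"] by (simp add: mult_ac)
      also have "real P powr (k + e1) * real P powr (k - \<eta> / k) = real P powr e2"
        unfolding powr_add[symmetric] by (rule arg_cong[where f = "\<lambda>x. real P powr x"]) (simp add: e1_def e2_def algebra_simps)
      finally have "real (2 * p) ^ (2 * k) * real p ^ k * (real M ^ (2 * s) * (real P ^ k * real M ^ (\<Sum>j=1..k. k - j) * vinogradov k s (P div M + 1)))
        \<le> real (2 * p) ^ (2 * k) * real p ^ k * (C * 2 ^ (2 * s) * real p ^ (k * k) * real P powr e2)"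
        by (intro mult_left_mono) auto
      also have "\<dots> = C * (2 ^ (2 * k + 2 * s) * real p ^ (2 * k + k + k * k)) * real P powr e2"
        by (simp only: of_nat_mult of_nat_numeral power_mult_distrib power_add mult_ac)
      also have "\<dots> \<le> C * (real p ^ E / 2) * real P powr e2"
      proof (intro mult_right_mono mult_left_mono)
        have "2 * (2 ^ (2 * k + 2 * s) * real p ^ (2 * k + k + k * k)) = 2 ^ (2 * k + 2 * s + 1) * real p ^ (2 * k + k + k * k)" by simp
        also have "\<dots> \<le> real p ^ (2 * k + 2 * s + 1) * real p ^ (2 * k + k + k * k)"
          using p0 by (intro mult_right_mono power_mono) auto
        also have "\<dots> = real p ^ (2 * k + 2 * s + 1 + (2 * k + k + k * k))" by (simp only: power_add)
        also have "\<dots> \<le> real p ^ E" using p0 k kk by (intro power_increasing) (auto simp: E_def)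
        finally show "2 ^ (2 * k + 2 * s) * real p ^ (2 * k + k + k * k) \<le> real p ^ E / 2" by simp
      qed (use C in auto)
      finally show ?thesis by (simp add: C'_def mult_ac)
    qed
    show ?thesis using rec t1 t2 by simp
  qed
  then show ?case by (simp add: C'_def E_def e2_def)
qed

text \<open>Euclid's prime of size at most n! + 1 is good enough, because p enters only through the
  constant C, and of C just a polynomial bound for ln C in terms of k is used.\<close>

lemma ln_prime_above:
  fixes n :: nat
  assumes "n \<ge> 2"
  obtains p where "prime p" "n \<le> p" "ln (real p) \<le> real n ^ 2"
proof -
  obtain p where p: "prime p" "n < p" "p \<le> fact n + 1" using next_prime_bound[of n] by blast
  have "real p \<le> fact n + 1" using p(3) by (metis of_nat_1 of_nat_add of_nat_fact of_nat_le_iff)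
  also have "\<dots> \<le> 2 * real n ^ n"
  proof -
    have "fact n \<le> real n ^ n" using fact_le_power[of n, where 'a = real] by simp
    moreover have "1 \<le> real n ^ n" using assms by simp
    ultimately show ?thesis by simp
  qed
  finally have "ln (real p) \<le> ln (2 * real n ^ n)" using prime_gt_0_nat[OF p(1)] by (subst ln_le_cancel_iff) (use assms in auto)
  also have "\<dots> = ln 2 + real n * ln (real n)" using assms by (simp add: ln_mult ln_realpow)
  also have "\<dots> \<le> 1 + real n * (real n - 1)"
    using assms ln_le_minus_one[of 2] by (intro add_mono mult_left_mono ln_le_minus_one) auto
  also have "\<dots> \<le> real n ^ 2" using assms by (simp add: power2_eq_square algebra_simps)
  finally show ?thesis using that p by auto
qed

text \<open>Starting from the trivial estimate at s = k^2, where the defect is K = k (k + 1)/2, each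
  step adds k to s and multiplies the defect by 1 - 1/k. After k^2 steps s = k^2 + k^3 and the
  defect is at most k^2 exp(-k) \<le> 1/8. Every step costs a factor p^(10 k^3) with ln p \<le>
  k^10, whence ln C \<le> 10 k^15 \<le> k^16.\<close>

theorem vinogradov_mean_value:
  "\<exists>k0. \<forall>k\<ge>k0. \<exists>s C. s > 0 \<and> s \<le> 2 * k ^ 3 \<and> C \<ge> 1 \<and> ln C \<le> real k ^ 16 \<and>
     (\<forall>P>0. real (vinogradov k s P) \<le> C * real P powr (2 * real s - real k * (real k + 1) / 2 + 1 / 8))"
proof -
  have "eventually (\<lambda>x::real. x ^ 2 * exp (- x) \<le> 1 / 8) at_top" by real_asymp
  then obtain x0 where x0: "\<And>x::real. x \<ge> x0 \<Longrightarrow> x ^ 2 * exp (- x) \<le> 1 / 8"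
    by (auto simp: eventually_at_top_linorder)
  show ?thesis
  proof (rule exI[of _ "max 64 (nat \<lceil>x0\<rceil>)"], intro allI impI)
    fix k :: nat assume k': "max 64 (nat \<lceil>x0\<rceil>) \<le> k"
    then have k: "k \<ge> 64" and kx: "real k \<ge> x0" by (auto simp: nat_le_iff ceiling_le_iff)
    define K where "K = real k * (real k + 1) / 2"
    have Kk: "0 \<le> K" "K \<le> real k ^ 2"
    proof -
      have "1 * real k \<le> real k * real k" using k by (intro mult_right_mono) auto
      then show "K \<le> real k ^ 2" unfolding K_def power2_eq_square by (simp add: algebra_simps)
    qed (simp add: K_def)
    have "1 \<le> k ^ 4" using k by simp
    then have "2 \<le> 64 * k ^ 4" by linarith
    then obtain p where p: "prime p" "64 * k ^ 4 \<le> p" "ln (real p) \<le> real (64 * k ^ 4) ^ 2"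
      by (rule ln_prime_above)
    have p1: "real p \<ge> 1" using prime_ge_1_nat[OF p(1)] by simp
    have lnp: "ln (real p) \<le> real k ^ 10"
    proof -
      have "real (64 * k ^ 4) ^ 2 = 64 ^ 2 * real k ^ 8" by (simp add: power_mult_distrib flip: power_mult)
      also have "\<dots> \<le> real k ^ 2 * real k ^ 8" using k by (intro mult_right_mono power_mono) auto
      finally show ?thesis using p(3) by (simp flip: power_add)
    qed
    define s where "s i = k ^ 2 + i * k" for i
    have claim: "real (vinogradov k (s i) P) \<le> real p ^ (10 * k ^ 3 * i) * real P powr (2 * real (s i) - K + K * (1 - 1 / k) ^ i)"
      if "i \<le> k ^ 2" "P > 0" for i P
      using that
    proof (induction i arbitrary: P)
      case 0
      have "real (vinogradov k (s 0) P) \<le> real (P ^ (2 * s 0))"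
        unfolding of_nat_le_iff using solutions_le_trivial[of "{0..<int P}" k "s 0" "\<lambda>_. 0"] by simp
      also have "\<dots> = real P powr (2 * real (s 0))" using 0 by (simp flip: powr_realpow)
      finally show ?case by simp
    next
      case (Suc i)
      have "real (vinogradov k (s i + k) P) \<le> real p ^ (10 * k ^ 3 * i) * real p ^ (2 * k ^ 2 + 6 * k + 2 * s i) *
        real P powr (2 * real (s i + k) - K + K * (1 - 1 / k) ^ i * (1 - 1 / k))"
      proof (rule mean_value_step[OF p(1,2)])
        show "K \<le> real (s i)" using Kk order_trans[OF Kk(2), of "real (s i)"] by (simp add: s_def)
        show "0 \<le> K * (1 - 1 / k) ^ i" using Kk k by simp
        show "K * (1 - 1 / k) ^ i \<le> K" using Kk k by (intro mult_left_le power_le_one) auto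
      qed (use Suc k p1 in \<open>auto simp: K_def algebra_simps\<close>)
      also have "\<dots> \<le> real p ^ (10 * k ^ 3 * i) * real p ^ (10 * k ^ 3) *
        real P powr (2 * real (s i + k) - K + K * (1 - 1 / k) ^ i * (1 - 1 / k))"
      proof (intro mult_right_mono mult_left_mono power_increasing)
        have "s i \<le> k ^ 2 + k ^ 2 * k" unfolding s_def using Suc.prems by (intro add_mono mult_right_mono) auto
        also have "k ^ 2 * k = k ^ 3" by (simp add: power2_eq_square power3_eq_cube)
        finally have "s i \<le> k ^ 2 + k ^ 3" .
        moreover have "k \<le> k ^ 3" using k by (auto intro: self_le_power)
        moreover have "2 * k ^ 2 \<le> k ^ 3"
          using k mult_right_mono[of 2 k "k ^ 2"] by (simp add: power2_eq_square power3_eq_cube)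
        ultimately show "2 * k ^ 2 + 6 * k + 2 * s i \<le> 10 * k ^ 3"
          by linarith
      qed (use p1 in auto)
      also have "s i + k = s (Suc i)" by (simp add: s_def)
      finally show ?case by (simp add: power_add mult_ac)
    qed
    define C where "C = real p ^ (10 * k ^ 3 * k ^ 2)"
    have "ln C \<le> real k ^ 16"
    proof -
      have "ln C = real (10 * k ^ 3 * k ^ 2) * ln (real p)" using p1 unfolding C_def by (subst ln_realpow) auto
      also have "\<dots> \<le> real (10 * k ^ 3 * k ^ 2) * real k ^ 10" using lnp by (intro mult_left_mono) auto
      also have "\<dots> = 10 * real k ^ 15" by (simp flip: power_add)
      also have "\<dots> \<le> real k * real k ^ 15" using k by (intro mult_right_mono) auto
      finally show ?thesis by (simp flip: power_Suc)
    qed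
    moreover have "s (k ^ 2) > 0" using k by (simp add: s_def)
    moreover have "s (k ^ 2) \<le> 2 * k ^ 3"
      using k mult_left_mono[of 1 k "k ^ 2"] by (simp add: s_def power2_eq_square power3_eq_cube)
    moreover have "C \<ge> 1" unfolding C_def using p1 by simp
    moreover have "\<forall>P>0. real (vinogradov k (s (k ^ 2)) P) \<le> C * real P powr (2 * real (s (k ^ 2)) - K + 1 / 8)"
    proof (intro allI impI)
      fix P :: nat assume P: "P > 0"
      have "(1 - 1 / real k) ^ (k ^ 2) \<le> exp (- (1 / k)) ^ (k ^ 2)"
        using k exp_ge_add_one_self[of "- (1 / real k)"] by (intro power_mono) auto
      also have "\<dots> = exp (- real k)" using k by (simp add: power2_eq_square flip: exp_of_nat_mult)
      finally have "K * (1 - 1 / k) ^ (k ^ 2) \<le> real k ^ 2 * exp (- real k)"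
        using Kk k by (intro mult_mono) auto
      then have \<eta>: "K * (1 - 1 / k) ^ (k ^ 2) \<le> 1 / 8" using x0[OF kx] by linarith
      have "real (vinogradov k (s (k ^ 2)) P) \<le> C * real P powr (2 * real (s (k ^ 2)) - K + K * (1 - 1 / k) ^ (k ^ 2))"
        using claim[of "k ^ 2" P] P by (simp add: C_def)
      also have "\<dots> \<le> C * real P powr (2 * real (s (k ^ 2)) - K + 1 / 8)"
        using \<eta> P \<open>C \<ge> 1\<close> by (intro mult_left_mono powr_mono) auto
      finally show "real (vinogradov k (s (k ^ 2)) P) \<le> C * real P powr (2 * real (s (k ^ 2)) - K + 1 / 8)" .
    qed
    ultimately show "\<exists>s C. s > 0 \<and> s \<le> 2 * k ^ 3 \<and> C \<ge> 1 \<and> ln C \<le> real k ^ 16 \<and>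
     (\<forall>P>0. real (vinogradov k s P) \<le> C * real P powr (2 * real s - real k * (real k + 1) / 2 + 1 / 8))"
      unfolding K_def by blast
  qed
qed

section \<open>Zeta sums near the line Re s = 1\<close>

definition real_expsum :: "nat \<Rightarrow> nat \<Rightarrow> (nat \<Rightarrow> real) \<Rightarrow> complex" where
  "real_expsum k P \<theta> = (\<Sum>x<P. cis (\<Sum>j=1..k. \<theta> j * real x ^ j))"

text \<open>The box contains every vector of differences of power sums of two s-tuples from [0, P),
  hence the support of the Fourier coefficients in \<open>norm_real_expsum_power\<close>.\<close>

definition freq_box :: "nat \<Rightarrow> nat \<Rightarrow> nat \<Rightarrow> (nat \<Rightarrow> int) set" where
  "freq_box k s P = PiE {1..k} (\<lambda>j. {- int (s * P ^ j)..int (s * P ^ j)})"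

lemma finite_freq_box [simp]: "finite (freq_box k s P)"
  unfolding freq_box_def by (intro finite_PiE) auto

lemma card_freq_box: "real (card (freq_box k s P)) = (\<Prod>j=1..k. 2 * real (s * P ^ j) + 1)"
proof -
  have "real (card {- int (s * P ^ j)..int (s * P ^ j)}) = 2 * real (s * P ^ j) + 1" for j
    by (simp add: nat_add_distrib)
  then show ?thesis unfolding freq_box_def by (subst card_PiE) (auto simp: of_nat_prod)
qed

lemma norm_real_expsum_power:
  "of_real (norm (real_expsum k P \<theta>) ^ (2 * s)) =
    (\<Sum>v\<in>freq_box k s P. of_nat (solutions k s {0..<int P} v) * cis (\<Sum>j=1..k. \<theta> j * v j))"
proof -
  let ?A = "{0..<int P}"
  let ?ph = "\<lambda>v :: nat \<Rightarrow> int. cis (\<Sum>j=1..k. \<theta> j * v j)"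
  let ?D = "\<lambda>x y j. (\<Sum>i<s. x i ^ j) - (\<Sum>i<s. y i ^ j) :: int"
  let ?g = "\<lambda>(x, y). \<lambda>j\<in>{1..k}. ?D x y j"
  have prod: "?ph (\<lambda>j. \<Sum>i\<in>I. w i j) = (\<Prod>i\<in>I. ?ph (w i))" if "finite I" for I :: "nat set" and w
    using that
  proof (induction I rule: finite_induct)
    case (insert i I)
    have "?ph (\<lambda>j. w i j + (\<Sum>i\<in>I. w i j)) = ?ph (w i) * ?ph (\<lambda>j. \<Sum>i\<in>I. w i j)"
      unfolding cis_mult of_int_add distrib_left sum.distrib ..
    then show ?case using insert by simp
  qed simp
  have e: "real_expsum k P \<theta> = (\<Sum>x\<in>?A. ?ph (\<lambda>j. x ^ j))"
    unfolding real_expsum_def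
    by (rule sum.reindex_bij_witness[where i = nat and j = int]) auto
  have pw: "real_expsum k P \<theta> ^ s = (\<Sum>x\<in>tuples s ?A. ?ph (\<lambda>j. \<Sum>i<s. x i ^ j))"
  proof -
    have "real_expsum k P \<theta> ^ s = (\<Prod>i<s. \<Sum>x\<in>?A. ?ph (\<lambda>j. x ^ j))" by (simp add: e)
    also have "\<dots> = (\<Sum>x\<in>tuples s ?A. \<Prod>i<s. ?ph (\<lambda>j. x i ^ j))"
      unfolding tuples_def by (rule prod_sum_PiE) auto
    finally show ?thesis unfolding prod[OF finite_lessThan] .
  qed
  have diff: "?ph (\<lambda>j. v j - w j) = ?ph v * cnj (?ph w)" for v w
    by (simp add: cis_mult cis_cnj algebra_simps sum_subtractf)
  have "of_real (norm (real_expsum k P \<theta>) ^ (2 * s)) = (\<Sum>x\<in>tuples s ?A. \<Sum>y\<in>tuples s ?A. ?ph (?D x y))"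
    unfolding norm_power_even pw cnj_sum diff sum_product ..
  also have "\<dots> = (\<Sum>z\<in>tuples s ?A \<times> tuples s ?A. ?ph (?g z))"
    unfolding sum.cartesian_product by (intro sum.cong refl) (auto intro!: arg_cong[where f = cis] sum.cong)
  also have "\<dots> = (\<Sum>v\<in>freq_box k s P. \<Sum>z\<in>{z \<in> tuples s ?A \<times> tuples s ?A. ?g z = v}. ?ph (?g z))"
  proof (rule sum.group[symmetric])
    show "?g ` (tuples s ?A \<times> tuples s ?A) \<subseteq> freq_box k s P"
    proof clarify
      fix x y assume xy: "x \<in> tuples s ?A" "y \<in> tuples s ?A"
      show "(\<lambda>j\<in>{1..k}. ?D x y j) \<in> freq_box k s P" unfolding freq_box_def
      proof (rule PiE_I)
        fix j assume j: "j \<in> {1..k}"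
        show "(\<lambda>j\<in>{1..k}. ?D x y j) j \<in> {- int (s * P ^ j)..int (s * P ^ j)}"
        proof (cases "P > 0")
          case True
          show ?thesis
            using power_sum_bound[OF subset_refl xy(1) _ True, of j j] power_sum_bound[OF subset_refl xy(2) _ True, of j j] j
            by simp
        next
          case False
          \<comment> \<open>For P = 0 a tuple exists only if s = 0.\<close>
          have "s = 0"
          proof (rule ccontr)
            assume "s \<noteq> 0"
            then have "x 0 \<in> ?A" using PiE_mem[OF xy(1)[unfolded tuples_def], of 0] by simp
            then show False using False by simp
          qed
          then show ?thesis using j by simp
        qed
      qed auto
    qed
  qed auto
  also have "\<dots> = (\<Sum>v\<in>freq_box k s P. of_nat (solutions k s ?A v) * ?ph v)"
  proof (intro sum.cong refl)
    fix v assume v: "v \<in> freq_box k s P"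
    have "{z \<in> tuples s ?A \<times> tuples s ?A. ?g z = v} = {(x, y). x \<in> tuples s ?A \<and> y \<in> tuples s ?A \<and> (\<forall>j\<in>{1..k}. ?D x y j = v j)}"
    proof -
      have "(\<lambda>j\<in>{1..k}. ?D x y j) = v \<longleftrightarrow> (\<forall>j\<in>{1..k}. ?D x y j = v j)" for x y
        using v unfolding freq_box_def by (auto simp: fun_eq_iff restrict_def PiE_def extensional_def)
      then show ?thesis by auto
    qed
    then have "card {z \<in> tuples s ?A \<times> tuples s ?A. ?g z = v} = solutions k s ?A v"
      unfolding solutions_def by (rule arg_cong)
    moreover have "(\<Sum>z\<in>{z \<in> tuples s ?A \<times> tuples s ?A. ?g z = v}. ?ph (?g z)) = (\<Sum>z\<in>{z \<in> tuples s ?A \<times> tuples s ?A. ?g z = v}. ?ph v)"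
      by (intro sum.cong refl) (simp only: mem_Collect_eq)
    ultimately show "(\<Sum>z\<in>{z \<in> tuples s ?A \<times> tuples s ?A. ?g z = v}. ?ph (?g z)) = of_nat (solutions k s ?A v) * ?ph v"
      by (simp only: sum_constant)
  qed
  finally show ?thesis .
qed

text \<open>Duality: expanding the 2s-th powers and summing over n first leaves, for each v, an
  exponential sum over the index n. The mean value theorem enters only through the uniform bound
  J_{s,k}(P) on the coefficients.\<close>

lemma sum_expsum_power_le:
  "(\<Sum>n\<in>I. norm (real_expsum k P (\<theta> n)) ^ (2 * s)) \<le>
     real (vinogradov k s P) * (\<Sum>v\<in>freq_box k s P. norm (\<Sum>n\<in>I. cis (\<Sum>j=1..k. \<theta> n j * real_of_int (v j))))"
proof -
  let ?G = "\<lambda>v. \<Sum>n\<in>I. cis (\<Sum>j=1..k. \<theta> n j * real_of_int (v j))"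
  have "complex_of_real (\<Sum>n\<in>I. norm (real_expsum k P (\<theta> n)) ^ (2 * s)) =
     (\<Sum>v\<in>freq_box k s P. of_nat (solutions k s {0..<int P} v) * ?G v)"
    unfolding of_real_sum norm_real_expsum_power sum_distrib_left by (rule sum.swap)
  then have "norm (complex_of_real (\<Sum>n\<in>I. norm (real_expsum k P (\<theta> n)) ^ (2 * s))) \<le>
     (\<Sum>v\<in>freq_box k s P. norm (of_nat (solutions k s {0..<int P} v) * ?G v))"
    by (simp only:) (rule norm_sum)
  also have "\<dots> \<le> (\<Sum>v\<in>freq_box k s P. real (vinogradov k s P) * norm (?G v))"
    unfolding norm_mult norm_of_nat
    by (intro sum_mono mult_right_mono of_nat_mono solutions_le_homogeneous) auto
  finally have "\<bar>\<Sum>n\<in>I. norm (real_expsum k P (\<theta> n)) ^ (2 * s)\<bar> \<le>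
      (\<Sum>v\<in>freq_box k s P. real (vinogradov k s P) * norm (?G v))" by (simp only: norm_of_real)
  then show ?thesis by (simp add: sum_distrib_left)
qed

lemma norm_one_minus_cis_ge:
  assumes "\<bar>x\<bar> \<le> 1"
  shows "norm (1 - cis x) \<ge> \<bar>x\<bar> / 2"
proof -
  have "norm (1 - cis x) \<ge> \<bar>sin x\<bar>"
    using abs_Im_le_cmod[of "1 - cis x"] by simp
  moreover have "\<bar>sin x\<bar> \<ge> \<bar>x\<bar> / 2"
  proof -
    have "\<bar>sin x - x\<bar> \<le> \<bar>x\<bar> ^ 3 / 6"
      using Maclaurin_sin_bound[of x 3] by (simp add: sin_coeff_def eval_nat_numeral)
    moreover have "\<bar>x\<bar> ^ 3 \<le> \<bar>x\<bar>" using assms power_decreasing[of 1 3 "\<bar>x\<bar>"] by simp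
    ultimately show ?thesis by linarith
  qed
  ultimately show ?thesis by linarith
qed

text \<open>The geometric sum has modulus at most 2/|1 - e^(ix)|, and |1 - e^(ix)| \<ge> |x|/2 for
  |x| \<le> 1. The range |x| \<le> 1 is what the later choice of the degree j0 guarantees.\<close>

lemma norm_dirichlet_kernel_le:
  assumes "x \<noteq> 0" "\<bar>x\<bar> \<le> 1"
  shows "norm (\<Sum>l\<in>{- int V..int V}. cis (x * real_of_int l)) \<le> 4 / \<bar>x\<bar>"
proof -
  have "(\<Sum>l\<in>{- int V..int V}. cis (x * real_of_int l)) = (\<Sum>a<2 * V + 1. cis (x * (real a - real V)))"
    by (rule sum.reindex_bij_witness[where i = "\<lambda>a. int a - int V" and j = "\<lambda>l. nat (l + int V)"]) auto
  also have "\<dots> = cis (- (x * real V)) * (\<Sum>a<2 * V + 1. cis x ^ a)"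
    unfolding sum_distrib_left Complex.DeMoivre by (simp add: cis_mult algebra_simps)
  finally have "norm (\<Sum>l\<in>{- int V..int V}. cis (x * real_of_int l)) = norm (\<Sum>a<2 * V + 1. cis x ^ a)"
    by (simp add: norm_mult)
  moreover have "norm (1 - cis x) * norm (\<Sum>a<2 * V + 1. cis x ^ a) \<le> 2"
  proof -
    have "(1 - cis x) * (\<Sum>a<2 * V + 1. cis x ^ a) = 1 - cis x ^ (2 * V + 1)"
      by (rule one_diff_power_eq[symmetric])
    then have "norm (1 - cis x) * norm (\<Sum>a<2 * V + 1. cis x ^ a) = norm (1 - cis x ^ (2 * V + 1))"
      by (metis norm_mult)
    also have "\<dots> \<le> norm (1 :: complex) + norm (cis x ^ (2 * V + 1))" by (rule norm_triangle_ineq4)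
    finally show ?thesis unfolding norm_power norm_cis by simp
  qed
  moreover have "\<bar>x\<bar> / 2 * norm (\<Sum>a<2 * V + 1. cis x ^ a) \<le> norm (1 - cis x) * norm (\<Sum>a<2 * V + 1. cis x ^ a)"
    using norm_one_minus_cis_ge[OF assms(2)] by (intro mult_right_mono) auto
  ultimately show ?thesis using assms(1) by (simp add: field_simps)
qed

lemma sum_inverse_le:
  assumes "N > 0"
  shows "(\<Sum>h=1..N. 1 / real h) \<le> 1 + ln (real N)"
  using assms
proof (induction N rule: nat_induct_non_zero)
  case (Suc N)
  have "1 / real (Suc N) \<le> ln (real (Suc N)) - ln (real N)"
  proof -
    have "ln (real N / real (Suc N)) \<le> real N / real (Suc N) - 1" using Suc by (intro ln_le_minus_one) auto
    also have "\<dots> = - (1 / real (Suc N))" by (simp add: field_simps)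
    finally show ?thesis using Suc by (simp add: ln_div)
  qed
  then show ?case using Suc by simp
qed simp

lemma sum_spaced_le:
  fixes m :: nat
  assumes I: "I \<subseteq> {a..<a + N}" and N: "N > 0" and b: "b \<ge> 0" and m: "m \<in> I"
  shows "(\<Sum>n\<in>I - {m}. b / \<bar>real n - real m\<bar>) \<le> 2 * b * (1 + ln (real N))"
proof -
  let ?f = "\<lambda>n. b / \<bar>real n - real m\<bar>"
  have am: "a \<le> m" "m < a + N" using m I by auto
  have "(\<Sum>n\<in>I - {m}. ?f n) \<le> (\<Sum>n\<in>{a..<a + N} - {m}. ?f n)"
    using I b by (intro sum_mono2) auto
  also have "{a..<a + N} - {m} = {a..<m} \<union> {m<..<a + N}" using am by auto
  also have "(\<Sum>n\<in>{a..<m} \<union> {m<..<a + N}. ?f n) = (\<Sum>n\<in>{a..<m}. ?f n) + (\<Sum>n\<in>{m<..<a + N}. ?f n)"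
    by (intro sum.union_disjoint) auto
  also have "(\<Sum>n\<in>{a..<m}. ?f n) = (\<Sum>h\<in>{1..m - a}. b / real h)"
    by (rule sum.reindex_bij_witness[where i = "\<lambda>h. m - h" and j = "\<lambda>n. m - n"]) auto
  also have "\<dots> \<le> (\<Sum>h=1..N. b / real h)" using am b by (intro sum_mono2) auto
  also have "(\<Sum>n\<in>{m<..<a + N}. ?f n) = (\<Sum>h\<in>{1..<a + N - m}. b / real h)"
    by (rule sum.reindex_bij_witness[where i = "\<lambda>h. m + h" and j = "\<lambda>n. n - m"]) auto
  also have "\<dots> \<le> (\<Sum>h=1..N. b / real h)" using am b by (intro sum_mono2) auto
  also have "(\<Sum>h=1..N. b / real h) + (\<Sum>h=1..N. b / real h) = 2 * b * (\<Sum>h=1..N. 1 / real h)"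
    by (simp add: sum_distrib_left)
  also have "\<dots> \<le> 2 * b * (1 + ln (real N))" using b sum_inverse_le[OF N] by (intro mult_left_mono) auto
  finally show ?thesis by simp
qed

text \<open>A dual large sieve in which only the \<open>j\<^sub>0\<close>-th coordinate of the frequencies is used.\<close>
lemma spaced_sum_over_box:
  fixes \<theta> :: "nat \<Rightarrow> nat \<Rightarrow> real"
  assumes I: "I \<subseteq> {a..<a + N}" and N: "N > 0" and j0: "j0 \<in> {1..k}" and \<delta>: "\<delta> > 0" and sP: "s > 0" "P > 0"
    and small: "\<And>n m. n \<in> I \<Longrightarrow> m \<in> I \<Longrightarrow> \<bar>\<theta> n j0 - \<theta> m j0\<bar> \<le> 1"
    and spaced: "\<And>n m. n \<in> I \<Longrightarrow> m \<in> I \<Longrightarrow> \<delta> * \<bar>real n - real m\<bar> \<le> \<bar>\<theta> n j0 - \<theta> m j0\<bar>"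
  shows "(\<Sum>v\<in>freq_box k s P. norm (\<Sum>n\<in>I. cis (\<Sum>j=1..k. \<theta> n j * real_of_int (v j)))) \<le>
     real (card (freq_box k s P)) * sqrt (real N * (1 + 4 * (1 + ln (real N)) / (\<delta> * real P ^ j0)))"
proof -
  let ?X = "freq_box k s P"
  let ?G = "\<lambda>v. \<Sum>n\<in>I. cis (\<Sum>j=1..k. \<theta> n j * real_of_int (v j))"
  let ?V = "\<lambda>j. s * P ^ j"
  \<comment> \<open>\<open>W\<close> is the number of integers in the j0-th side of the box.\<close>
  define W where "W = 2 * real (?V j0) + 1"
  have finI: "finite I" using I finite_subset by blast
  have cardI: "real (card I) \<le> real N" using card_mono[OF _ I] by simp
  have W: "W > 0" "W \<ge> 2 * real P ^ j0"
  proof -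
    have "1 * real P ^ j0 \<le> real s * real P ^ j0" using sP by (intro mult_right_mono) auto
    then show "W \<ge> 2 * real P ^ j0" by (simp add: W_def)
    show "W > 0" unfolding W_def by linarith
  qed
  \<comment> \<open>Multiplying out the square makes the sum over the box factor into
    one-dimensional kernels. All coordinates but j0 are estimated trivially, which yields card/W;
    coordinate j0 gives 4/(\<delta> |n - m|) by the spacing.\<close>
  have S2: "(\<Sum>v\<in>?X. norm (?G v) ^ 2) \<le> real (card ?X) / W * (\<Sum>n\<in>I. \<Sum>m\<in>I. if n = m then W else 4 / (\<delta> * \<bar>real n - real m\<bar>))"
  proof -
    have ker: "norm (\<Sum>l\<in>{- int (?V j)..int (?V j)}. cis (x * real_of_int l)) \<le> 2 * real (?V j) + 1" for j x
    proof -
      have "norm (\<Sum>l\<in>{- int (?V j)..int (?V j)}. cis (x * real_of_int l)) \<le> (\<Sum>l\<in>{- int (?V j)..int (?V j)}. 1)"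
        by (rule order_trans[OF norm_sum]) simp
      then show ?thesis by (simp add: nat_add_distrib)
    qed
    have "complex_of_real (\<Sum>v\<in>?X. norm (?G v) ^ 2) = (\<Sum>v\<in>?X. \<Sum>n\<in>I. \<Sum>m\<in>I. cis (\<Sum>j=1..k. (\<theta> n j - \<theta> m j) * real_of_int (v j)))"
      unfolding of_real_sum complex_norm_square cnj_sum sum_product
      by (simp add: cis_cnj cis_mult algebra_simps sum_subtractf)
    also have "\<dots> = (\<Sum>n\<in>I. \<Sum>m\<in>I. \<Sum>v\<in>?X. cis (\<Sum>j=1..k. (\<theta> n j - \<theta> m j) * real_of_int (v j)))"
      by (rule trans[OF sum.swap], rule sum.cong[OF refl], rule sum.swap)
    also have "\<dots> = (\<Sum>n\<in>I. \<Sum>m\<in>I. \<Prod>j=1..k. \<Sum>l\<in>{- int (?V j)..int (?V j)}. cis ((\<theta> n j - \<theta> m j) * real_of_int l))"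
    proof (intro sum.cong refl)
      fix n m
      have "cis (\<Sum>j\<in>J. f j) = (\<Prod>j\<in>J. cis (f j))" if "finite J" for J :: "nat set" and f
        using that by (induction J rule: finite_induct) (auto simp flip: cis_mult)
      then have "(\<Sum>v\<in>?X. cis (\<Sum>j=1..k. (\<theta> n j - \<theta> m j) * real_of_int (v j))) =
         (\<Sum>v\<in>?X. \<Prod>j=1..k. cis ((\<theta> n j - \<theta> m j) * real_of_int (v j)))" by simp
      also have "\<dots> = (\<Prod>j=1..k. \<Sum>l\<in>{- int (?V j)..int (?V j)}. cis ((\<theta> n j - \<theta> m j) * real_of_int l))"
        unfolding freq_box_def by (rule prod_sum_PiE[symmetric]) auto
      finally show "(\<Sum>v\<in>?X. cis (\<Sum>j=1..k. (\<theta> n j - \<theta> m j) * real_of_int (v j))) =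
         (\<Prod>j=1..k. \<Sum>l\<in>{- int (?V j)..int (?V j)}. cis ((\<theta> n j - \<theta> m j) * real_of_int l))" .
    qed
    finally have "norm (complex_of_real (\<Sum>v\<in>?X. norm (?G v) ^ 2)) = norm \<dots>" by (rule arg_cong)
    also have "\<dots> \<le> (\<Sum>n\<in>I. \<Sum>m\<in>I. norm (\<Prod>j=1..k. \<Sum>l\<in>{- int (?V j)..int (?V j)}. cis ((\<theta> n j - \<theta> m j) * real_of_int l)))"
      by (rule order_trans[OF norm_sum]) (intro sum_mono norm_sum)
    also have "\<dots> \<le> (\<Sum>n\<in>I. \<Sum>m\<in>I. real (card ?X) / W * (if n = m then W else 4 / (\<delta> * \<bar>real n - real m\<bar>)))"
    proof (intro sum_mono)
      fix n m assume nm: "n \<in> I" "m \<in> I"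
      let ?D = "\<lambda>j. \<Sum>l\<in>{- int (?V j)..int (?V j)}. cis ((\<theta> n j - \<theta> m j) * real_of_int l)"
      have d0: "norm (?D j0) \<le> (if n = m then W else 4 / (\<delta> * \<bar>real n - real m\<bar>))"
      proof (cases "n = m")
        case True then show ?thesis using ker[where j = j0 and x = "\<theta> n j0 - \<theta> m j0"] by (simp add: W_def)
      next
        case False
        then have pos: "0 < \<delta> * \<bar>real n - real m\<bar>" using \<delta> by simp
        have "norm (?D j0) \<le> 4 / \<bar>\<theta> n j0 - \<theta> m j0\<bar>"
          by (rule norm_dirichlet_kernel_le) (use pos spaced[OF nm] small[OF nm] in auto)
        also have "\<dots> \<le> 4 / (\<delta> * \<bar>real n - real m\<bar>)"
          using pos spaced[OF nm] by (intro divide_left_mono mult_pos_pos[OF \<open>0 < \<delta> * \<bar>real n - real m\<bar>\<close>]) auto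
        finally show ?thesis using False by simp
      qed
      have "norm (\<Prod>j=1..k. ?D j) = norm (?D j0) * (\<Prod>j\<in>{1..k} - {j0}. norm (?D j))"
        using j0 by (subst prod_norm[symmetric], subst prod.remove[of _ j0]) auto
      also have "\<dots> \<le> (if n = m then W else 4 / (\<delta> * \<bar>real n - real m\<bar>)) * (\<Prod>j\<in>{1..k} - {j0}. 2 * real (?V j) + 1)"
      proof (intro mult_mono d0 prod_mono conjI ker)
        show "0 \<le> (if n = m then W else 4 / (\<delta> * \<bar>real n - real m\<bar>))" using W \<delta> by auto
      qed (auto intro: prod_nonneg)
      also have "(\<Prod>j\<in>{1..k} - {j0}. 2 * real (?V j) + 1) = real (card ?X) / W"
        using W j0 unfolding card_freq_box W_def by (subst prod.remove[of "{1..k}" j0]) auto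
      finally show "norm (\<Prod>j=1..k. ?D j) \<le> real (card ?X) / W * (if n = m then W else 4 / (\<delta> * \<bar>real n - real m\<bar>))"
        by (simp only: mult.commute)
    qed
    also have "norm (complex_of_real (\<Sum>v\<in>?X. norm (?G v) ^ 2)) = (\<Sum>v\<in>?X. norm (?G v) ^ 2)"
      unfolding norm_of_real by (rule abs_of_nonneg) (auto intro: sum_nonneg)
    finally show ?thesis by (simp only: sum_distrib_left)
  qed
  have S3: "(\<Sum>n\<in>I. \<Sum>m\<in>I. if n = m then W else 4 / (\<delta> * \<bar>real n - real m\<bar>)) \<le> real N * (W + 2 * (4 / \<delta>) * (1 + ln (real N)))"
  proof -
    have "(\<Sum>m\<in>I. if n = m then W else 4 / (\<delta> * \<bar>real n - real m\<bar>)) \<le> W + 2 * (4 / \<delta>) * (1 + ln (real N))" if n: "n \<in> I" for n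
    proof -
      have "(\<Sum>m\<in>I. if n = m then W else 4 / (\<delta> * \<bar>real n - real m\<bar>)) = W + (\<Sum>m\<in>I - {n}. (4 / \<delta>) / \<bar>real m - real n\<bar>)"
        using n finI by (subst sum.remove[of I n]) (auto intro!: sum.cong simp: abs_minus_commute)
      also have "\<dots> \<le> W + 2 * (4 / \<delta>) * (1 + ln (real N))"
        using sum_spaced_le[OF I N _ n, where b = "4 / \<delta>"] \<delta> by simp
      finally show ?thesis .
    qed
    then have "(\<Sum>n\<in>I. \<Sum>m\<in>I. if n = m then W else 4 / (\<delta> * \<bar>real n - real m\<bar>)) \<le> (\<Sum>n\<in>I. W + 2 * (4 / \<delta>) * (1 + ln (real N)))"
      by (intro sum_mono)
    also have "\<dots> = real (card I) * (W + 2 * (4 / \<delta>) * (1 + ln (real N)))" by simp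
    also have "\<dots> \<le> real N * (W + 2 * (4 / \<delta>) * (1 + ln (real N)))"
      using cardI W \<delta> N by (intro mult_right_mono) auto
    finally show ?thesis .
  qed
  \<comment> \<open>Cauchy-Schwarz over the box.\<close>
  have "(\<Sum>v\<in>?X. norm (?G v)) ^ 2 \<le> real (card ?X) * (\<Sum>v\<in>?X. norm (?G v) ^ 2)"
    using power_mean_le[of ?X "\<lambda>v. norm (?G v)" 1] by (simp add: numeral_2_eq_2)
  also have "\<dots> \<le> real (card ?X) * (real (card ?X) / W * (real N * (W + 2 * (4 / \<delta>) * (1 + ln (real N)))))"
    using W by (intro mult_left_mono order_trans[OF S2] S3) auto
  also have "real (card ?X) * (real (card ?X) / W * (real N * (W + 2 * (4 / \<delta>) * (1 + ln (real N))))) =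
     real (card ?X) ^ 2 * (real N * (1 + 8 * (1 + ln (real N)) / (\<delta> * W)))"
    using W \<delta> by (simp add: field_simps power2_eq_square)
  also have "\<dots> \<le> real (card ?X) ^ 2 * (real N * (1 + 4 * (1 + ln (real N)) / (\<delta> * real P ^ j0)))"
  proof (intro mult_left_mono add_left_mono)
    have "8 * (1 + ln (real N)) / (\<delta> * W) \<le> 8 * (1 + ln (real N)) / (\<delta> * (2 * real P ^ j0))"
      using W \<delta> N sP by (intro divide_left_mono mult_left_mono mult_pos_pos) auto
    also have "\<dots> = (2 * (4 * (1 + ln (real N)))) / (2 * (\<delta> * real P ^ j0))" by (simp add: mult_ac)
    also have "\<dots> = 4 * (1 + ln (real N)) / (\<delta> * real P ^ j0)" by (rule mult_divide_mult_cancel_left) simp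
    finally show "8 * (1 + ln (real N)) / (\<delta> * W) \<le> 4 * (1 + ln (real N)) / (\<delta> * real P ^ j0)" .
  qed auto
  finally have "(\<Sum>v\<in>?X. norm (?G v)) ^ 2 \<le> (real (card ?X) * sqrt (real N * (1 + 4 * (1 + ln (real N)) / (\<delta> * real P ^ j0)))) ^ 2"
    using N \<delta> by (simp add: power_mult_distrib)
  then show ?thesis by (rule power2_le_imp_le) (use N \<delta> in auto)
qed

section \<open>Zeta sums over a block [N, 2N)\<close>

definition inv_pow :: "complex \<Rightarrow> real \<Rightarrow> complex" where
  "inv_pow s u = exp (- s * of_real (ln u))"

lemma norm_inv_pow: "u > 0 \<Longrightarrow> norm (inv_pow s u) = u powr (- Re s)"
  by (simp add: inv_pow_def powr_def mult.commute)

lemma inv_pow_eq: "u > 0 \<Longrightarrow> inv_pow (Complex \<sigma> (- \<tau>)) u = of_real (u powr (- \<sigma>)) * cis (\<tau> * ln u)"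
  by (simp add: inv_pow_def complex_eq_iff powr_def Re_exp Im_exp mult.commute)

text \<open>The derivative of the remainder is (-x)^k/(1 + x), because the derivative of the
  polynomial is a geometric sum; on [0, z] it is at most z^k in absolute value.\<close>

lemma ln_one_plus_taylor:
  fixes z :: real
  assumes "0 \<le> z"
  shows "\<bar>ln (1 + z) - (\<Sum>j=1..k. (- 1) ^ (j + 1) * z ^ j / j)\<bar> \<le> z ^ (k + 1)"
proof -
  define g where "g x = ln (1 + x) - (\<Sum>j=1..k. (- 1) ^ (j + 1) * x ^ j / real j)" for x :: real
  have deriv: "(g has_real_derivative (- x) ^ k / (1 + x)) (at x)" if "x \<ge> 0" for x
  proof -
    have "(g has_real_derivative 1 / (1 + x) - (\<Sum>j=1..k. (- 1) ^ (j + 1) * (real j * x ^ (j - 1)) / real j)) (at x)"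
      unfolding g_def using that by (auto intro!: derivative_eq_intros sum.cong simp: mult_ac)
    also have "(\<Sum>j=1..k. (- 1) ^ (j + 1) * (real j * x ^ (j - 1)) / real j) = (\<Sum>j=1..k. (- x) ^ (j - 1))"
    proof (intro sum.cong refl)
      fix j assume "j \<in> {1..k}"
      then obtain i where "j = Suc i" by (cases j) auto
      then show "(- 1) ^ (j + 1) * (real j * x ^ (j - 1)) / real j = (- x) ^ (j - 1)"
        using power_minus[of x i] by simp
    qed
    also have "\<dots> = (\<Sum>j<k. (- x) ^ j)"
      by (rule sum.reindex_bij_witness[where i = Suc and j = "\<lambda>j. j - 1"]) auto
    also have "\<dots> = (1 - (- x) ^ k) / (1 + x)"
      using that one_diff_power_eq[of "- x" k] by (simp add: field_simps)
    also have "1 / (1 + x) - (1 - (- x) ^ k) / (1 + x) = (- x) ^ k / (1 + x)"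
      using that by (simp add: diff_divide_distrib)
    finally show ?thesis .
  qed
  have "norm (g z - g 0) \<le> z ^ k * norm (z - 0)"
  proof (rule field_differentiable_bound[of "{0..z}" g "\<lambda>x. (- x) ^ k / (1 + x)"])
    fix x assume x: "x \<in> {0..z}"
    show "(g has_field_derivative (- x) ^ k / (1 + x)) (at x within {0..z})"
      by (rule has_field_derivative_at_within[OF deriv]) (use x in simp)
    have "norm ((- x) ^ k / (1 + x)) = x ^ k / (1 + x)" using x by (simp add: norm_divide norm_power)
    also have "\<dots> \<le> x ^ k" using x by (simp add: field_simps)
    also have "\<dots> \<le> z ^ k" using x by (intro power_mono) auto
    finally show "norm ((- x) ^ k / (1 + x)) \<le> z ^ k" .
  qed (use assms in auto)
  moreover have "g 0 = 0" by (simp add: g_def zero_power)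
  ultimately show ?thesis using assms by (simp add: g_def mult.commute)
qed

lemma norm_cis_diff_le: "norm (cis a - cis b) \<le> \<bar>a - b\<bar>"
proof -
  have "norm (cis a - cis b) \<le> 1 * norm (a - b)"
  proof (rule differentiable_bound[of UNIV _ "\<lambda>x h. h *\<^sub>R (\<i> * cis x)"])
    show "(cis has_derivative (\<lambda>h. h *\<^sub>R (\<i> * cis x))) (at x within UNIV)" for x
      by (auto intro!: derivative_eq_intros simp: scaleR_conv_of_real mult_ac)
    have "norm (h *\<^sub>R (\<i> * cis x)) \<le> 1 * norm h" for h x by (simp add: norm_mult)
    then show "onorm (\<lambda>h. h *\<^sub>R (\<i> * cis x)) \<le> 1" for x by (intro onorm_bound) auto
  qed auto
  then show ?thesis by simp
qed

text \<open>Raising the shift by one changes the sum by its two end terms only.\<close>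

lemma sum_shift_le:
  fixes g :: "nat \<Rightarrow> complex"
  assumes "a \<le> b" "\<And>n. n \<ge> a \<Longrightarrow> norm (g n) \<le> \<epsilon>"
  shows "norm ((\<Sum>n=a..<b. g n) - (\<Sum>n=a..<b. g (n + x))) \<le> 2 * real x * \<epsilon>"
proof (induction x)
  case (Suc x)
  have "(\<Sum>n=a..<b. g (n + Suc x)) = (\<Sum>n=a..<b. g (n + x)) + (g (b + x) - g (a + x))"
    using assms(1) by (induction b rule: dec_induct) auto
  then have "(\<Sum>n=a..<b. g n) - (\<Sum>n=a..<b. g (n + Suc x)) =
     ((\<Sum>n=a..<b. g n) - (\<Sum>n=a..<b. g (n + x))) - g (b + x) + g (a + x)" by (simp add: algebra_simps)
  also have "norm \<dots> \<le> norm ((\<Sum>n=a..<b. g n) - (\<Sum>n=a..<b. g (n + x))) + norm (g (b + x)) + norm (g (a + x))"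
    using norm_triangle_ineq[of "(\<Sum>n=a..<b. g n) - (\<Sum>n=a..<b. g (n + x)) - g (b + x)" "g (a + x)"]
      norm_triangle_ineq4[of "(\<Sum>n=a..<b. g n) - (\<Sum>n=a..<b. g (n + x))" "g (b + x)"] by linarith
  also have "\<dots> \<le> 2 * real x * \<epsilon> + \<epsilon> + \<epsilon>"
    using Suc assms(2)[of "b + x"] assms(2)[of "a + x"] assms(1) by simp
  finally show ?case by (simp add: algebra_simps)
qed simp

text \<open>The volume P^(k (k + 1)/2) of the box exactly consumes the saving in the mean value
  theorem; the gain then comes from the cancellation in the sums over n.\<close>

lemma card_freq_box_le:
  assumes "s > 0" "P > 0"
  shows "real (card (freq_box k s P)) \<le> (3 * real s) ^ k * real P powr (real k * (real k + 1) / 2)"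
proof -
  have "real (card (freq_box k s P)) \<le> (\<Prod>j=1..k. (3 * real s) * real P ^ j)"
    unfolding card_freq_box
  proof (intro prod_mono conjI)
    fix j
    have "1 \<le> s * P ^ j" using assms by simp
    then have "1 \<le> real (s * P ^ j)" by linarith
    then show "2 * real (s * P ^ j) + 1 \<le> (3 * real s) * real P ^ j" by simp
  qed auto
  also have "\<dots> = (3 * real s) ^ k * real P ^ (\<Sum>j=1..k. j)"
    by (simp add: prod.distrib power_sum)
  also have "real P ^ (\<Sum>j=1..k. j) = real P powr real (\<Sum>j=1..k. j)"
    using assms by (simp flip: powr_realpow)
  also have "real (\<Sum>j=1..k. j) = real k * (real k + 1) / 2"
    by (induction k) (auto simp: field_simps)
  finally show ?thesis .
qed

text \<open>Bernoulli's inequality for (w/u)^j. It keeps the Taylor coefficients belonging to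
  different n apart.\<close>

lemma inverse_power_diff_ge:
  fixes u w :: real
  assumes "0 < u" "u \<le> w" "w \<le> B" "j > 0"
  shows "real j * (w - u) / B ^ (j + 1) \<le> 1 / u ^ j - 1 / w ^ j"
proof -
  have "real j * (w - u) \<le> w ^ j / u ^ j * w - w * 1"
  proof -
    have "1 + real j * (w / u - 1) \<le> (1 + (w / u - 1)) ^ j"
      using assms by (intro Bernoulli_inequality) (auto simp: field_simps)
    then have "1 + real j * (w / u - 1) \<le> w ^ j / u ^ j" by (simp add: power_divide)
    then have "(1 + real j * (w / u - 1)) * w \<le> w ^ j / u ^ j * w" using assms by (intro mult_right_mono) auto
    moreover have "real j * (w - u) \<le> real j * (w / u - 1) * w"
    proof -
      have "0 \<le> (w - u) ^ 2" by simp
      then have "w - u \<le> (w / u - 1) * w" using assms by (simp add: field_simps power2_eq_square)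
      then have "real j * (w - u) \<le> real j * ((w / u - 1) * w)" by (intro mult_left_mono) auto
      then show ?thesis by (simp add: mult_ac)
    qed
    ultimately show ?thesis by (simp add: algebra_simps)
  qed
  then have "real j * (w - u) / w ^ (j + 1) \<le> (w ^ j / u ^ j * w - w * 1) / w ^ (j + 1)"
    using assms by (intro divide_right_mono) auto
  also have "\<dots> = 1 / u ^ j - 1 / w ^ j" using assms by (simp add: field_simps)
  finally have "real j * (w - u) / w ^ (j + 1) \<le> 1 / u ^ j - 1 / w ^ j" .
  moreover have "real j * (w - u) / B ^ (j + 1) \<le> real j * (w - u) / w ^ (j + 1)"
    using assms by (intro divide_left_mono power_mono mult_pos_pos) auto
  ultimately show ?thesis by linarith
qed

text \<open>A pointwise form of Hoelder's inequality: unless a \<le> 1/L, the power (a L)^(n - 1) is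
  at least 1.\<close>

lemma le_inverse_plus_power:
  fixes a L :: real
  assumes "a \<ge> 0" "L > 0" "n > 0"
  shows "a \<le> 1 / L + L ^ (n - 1) * a ^ n"
proof (cases "a \<le> 1 / L")
  case True
  moreover have "0 \<le> L ^ (n - 1) * a ^ n" using assms by simp
  ultimately show ?thesis by linarith
next
  case False
  then have "1 \<le> (a * L) ^ (n - 1)" using assms by (intro one_le_power) (simp add: field_simps)
  then have "a * 1 \<le> a * (a * L) ^ (n - 1)" using assms by (intro mult_left_mono) auto
  also have "\<dots> = L ^ (n - 1) * a ^ n" using assms by (cases n) (auto simp: power_mult_distrib)
  finally have "a \<le> L ^ (n - 1) * a ^ n" by simp
  moreover have "0 \<le> 1 / L" using assms by simp
  ultimately show ?thesis by linarith
qed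

text \<open>The integers n in [N, 2N) are treated with inner sums of length P = N^(3/4). This length
  makes the Taylor error |\<tau>| (P/N)^(k + 1) at most N^(-1/4), since |\<tau>| \<le> N^(k/4).
  \<open>L\<close> is the factor to be saved, and \<open>large\<close> says that all losses together
  with L^(2s) fit into N^(1/8).\<close>

context
  fixes k s N P :: nat and C \<tau> \<beta> L :: real
  assumes k: "k > 0" and s: "s > 0" and C: "C \<ge> 1"
    and vmv: "\<And>P. P > 0 \<Longrightarrow> real (vinogradov k s P) \<le> C * real P powr (2 * real s - real k * (real k + 1) / 2 + 1 / 8)"
    and N: "N \<ge> 2" and \<tau>: "real N \<le> \<bar>\<tau>\<bar>" "\<bar>\<tau>\<bar> \<le> real N powr (real k / 4)"
    and \<beta>: "0 \<le> \<beta>" "\<beta> \<le> 1" and L: "L \<ge> 1"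
    and large: "C * (6 * real s) ^ k * (4 * (1 + ln (real N))) * L ^ (2 * s) \<le> real N powr (1 / 8)"
  defines "P \<equiv> nat \<lfloor>real N powr (3 / 4)\<rfloor>"
begin

lemma P_bounds: "P > 0" "real P \<le> real N powr (3 / 4)" "real N powr (3 / 4) / 2 \<le> real P"
proof -
  have 1: "1 \<le> real N powr (3 / 4)" using N by (intro ge_one_powr_ge_zero) auto
  then have fl: "1 \<le> \<lfloor>real N powr (3 / 4)\<rfloor>" by simp
  then show "P > 0" unfolding P_def by linarith
  have P: "real P = real_of_int \<lfloor>real N powr (3 / 4)\<rfloor>" using 1 by (simp add: P_def)
  show "real P \<le> real N powr (3 / 4)" unfolding P by linarith
  show "real N powr (3 / 4) / 2 \<le> real P" using fl unfolding P by linarith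
qed

text \<open>The coefficient of x^j in the Taylor polynomial of \<tau> ln(1 + x/(n +
  \<beta>)).\<close>

abbreviation (input) taylor_freq :: "nat \<Rightarrow> nat \<Rightarrow> real" where
  "taylor_freq n j \<equiv> \<tau> * ((- 1) ^ (j + 1) / (real j * (real n + \<beta>) ^ j))"

text \<open>Only the coefficient of one degree j0 is exploited, with j0 least such that |\<tau>| <
  N^j0: its values differ by at most 1, yet they move with n by at least |\<tau>|/(2N)^(j0 + 1) per
  step. Since j0 \<ge> 2, the factor 1/(\<delta> P^j0) of the large sieve is at most N^(1/2) up to a
  constant depending on k, so the 2s-th moment over n is of order N^(7/8) P^(2s) up to the factors
  in \<open>large\<close>, instead of N P^(2s).\<close>

lemma mean_expsum_le:
  assumes I: "I \<subseteq> {N..<2 * N}"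
  shows "(\<Sum>n\<in>I. norm (real_expsum k P (taylor_freq n)) / P) \<le> 2 * real N / L"
proof -
  have N1: "real N \<ge> 2" using N by simp
  define j0 where "j0 = (LEAST j. \<bar>\<tau>\<bar> < real N ^ j)"
  have "\<bar>\<tau>\<bar> \<le> real N powr (real k / 4)" by (rule \<tau>)
  also have "\<dots> < real N powr real k" using N1 k by (intro powr_less_mono) auto
  also have "\<dots> = real N ^ k" using N1 by (intro powr_realpow) auto
  finally have tk: "\<bar>\<tau>\<bar> < real N ^ k" .
  have j0: "\<bar>\<tau>\<bar> < real N ^ j0" unfolding j0_def using tk by (rule LeastI)
  have j0k: "j0 \<le> k" unfolding j0_def using tk by (rule Least_le)
  have j02: "j0 \<ge> 2"
  proof (rule ccontr)
    assume "\<not> ?thesis"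
    then have "real N ^ j0 \<le> real N ^ 1" using N1 by (intro power_increasing) auto
    then show False using j0 \<tau> unfolding power_one_right by linarith
  qed
  have j0l: "real N ^ (j0 - 1) \<le> \<bar>\<tau>\<bar>"
  proof (rule ccontr)
    assume "\<not> ?thesis"
    then have "j0 \<le> j0 - 1" unfolding j0_def by (intro Least_le) auto
    then show False using j02 by simp
  qed
  define \<delta> where "\<delta> = \<bar>\<tau>\<bar> / (2 * real N) ^ (j0 + 1)"
  have t0: "\<bar>\<tau>\<bar> > 0" using \<tau> N by linarith
  have \<delta>: "\<delta> > 0" using t0 N1 by (simp add: \<delta>_def)
  have diff: "\<bar>taylor_freq n j0 - taylor_freq m j0\<bar> = \<bar>\<tau>\<bar> / real j0 * \<bar>1 / (real n + \<beta>) ^ j0 - 1 / (real m + \<beta>) ^ j0\<bar>" for n m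
  proof -
    have "taylor_freq n j0 - taylor_freq m j0 = \<tau> * (- 1) ^ (j0 + 1) / real j0 * (1 / (real n + \<beta>) ^ j0 - 1 / (real m + \<beta>) ^ j0)"
      by (simp add: right_diff_distrib)
    then show ?thesis by (simp add: abs_mult power_abs)
  qed
  have box: "(\<Sum>v\<in>freq_box k s P. norm (\<Sum>n\<in>I. cis (\<Sum>j=1..k. taylor_freq n j * real_of_int (v j)))) \<le>
     real (card (freq_box k s P)) * sqrt (real N * (1 + 4 * (1 + ln (real N)) / (\<delta> * real P ^ j0)))"
  proof (rule spaced_sum_over_box[of _ N])
    show "I \<subseteq> {N..<N + N}" using I by (simp add: mult_2)
    show "j0 \<in> {1..k}" using j0k j02 by simp
    fix n m assume nm: "n \<in> I" "m \<in> I"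
    have rng: "real N \<le> real n + \<beta>" "real n + \<beta> \<le> 2 * real N" if "n \<in> I" for n
    proof -
      have "N \<le> n" "n + 1 \<le> 2 * N" using that I by auto
      then have "real N \<le> real n" "real n + 1 \<le> 2 * real N" by linarith+
      then show "real N \<le> real n + \<beta>" "real n + \<beta> \<le> 2 * real N" using \<beta> by auto
    qed
    have inv: "0 \<le> 1 / (real n + \<beta>) ^ j0" "1 / (real n + \<beta>) ^ j0 \<le> 1 / real N ^ j0" if "n \<in> I" for n
      using rng[OF that] N1 by (auto intro!: divide_left_mono power_mono mult_pos_pos)
    show "\<bar>taylor_freq n j0 - taylor_freq m j0\<bar> \<le> 1"
    proof -
      have "\<bar>1 / (real n + \<beta>) ^ j0 - 1 / (real m + \<beta>) ^ j0\<bar> \<le> 1 / real N ^ j0"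
        using inv[OF nm(1)] inv[OF nm(2)] by linarith
      then have "\<bar>taylor_freq n j0 - taylor_freq m j0\<bar> \<le> \<bar>\<tau>\<bar> / real j0 * (1 / real N ^ j0)"
        unfolding diff by (intro mult_left_mono) auto
      also have "\<dots> \<le> \<bar>\<tau>\<bar> / 1 * (1 / real N ^ j0)"
        using j02 by (intro mult_right_mono divide_left_mono) auto
      also have "\<dots> \<le> 1" using j0 N1 by (simp add: field_simps)
      finally show ?thesis .
    qed
    show "\<delta> * \<bar>real n - real m\<bar> \<le> \<bar>taylor_freq n j0 - taylor_freq m j0\<bar>"
    proof -
      have ord: "real j0 * \<bar>real n - real m\<bar> / (2 * real N) ^ (j0 + 1) \<le> \<bar>1 / (real n + \<beta>) ^ j0 - 1 / (real m + \<beta>) ^ j0\<bar>"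
        if "n \<in> I" "m \<in> I" "n \<le> m" for n m
        using inverse_power_diff_ge[of "real n + \<beta>" "real m + \<beta>" "2 * real N" j0] rng[OF that(1)] rng[OF that(2)] that N1 j02 by simp
      have "real j0 * \<bar>real n - real m\<bar> / (2 * real N) ^ (j0 + 1) \<le> \<bar>1 / (real n + \<beta>) ^ j0 - 1 / (real m + \<beta>) ^ j0\<bar>"
        using ord[OF nm] ord[OF nm(2,1)] by (cases "n \<le> m") (simp_all add: abs_minus_commute)
      then have "\<bar>\<tau>\<bar> / real j0 * (real j0 * \<bar>real n - real m\<bar> / (2 * real N) ^ (j0 + 1)) \<le> \<bar>taylor_freq n j0 - taylor_freq m j0\<bar>"
        unfolding diff by (intro mult_left_mono) auto
      then show ?thesis using j02 by (simp add: \<delta>_def)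
    qed
  qed (use N s P_bounds \<delta> in auto)
  have root: "sqrt (real N * (1 + 4 * (1 + ln (real N)) / (\<delta> * real P ^ j0))) \<le> real N powr (3 / 4) * (4 * 2 ^ k * (1 + ln (real N)))"
  proof (rule real_le_lsqrt)
    have lnN: "ln (real N) \<ge> 0" using N1 by simp
    have "1 / (\<delta> * real P ^ j0) \<le> 2 * 4 ^ k * real N powr (1 / 2)"
    proof -
      have Nj: "real N ^ (j0 + 1) = real N ^ (j0 - 1) * real N ^ 2"
        using j02 by (simp flip: power_add)
      have "1 / (\<delta> * real P ^ j0) = (2 * real N) ^ (j0 + 1) / (\<bar>\<tau>\<bar> * real P ^ j0)"
        by (simp add: \<delta>_def)
      also have "\<dots> \<le> (2 * real N) ^ (j0 + 1) / (real N ^ (j0 - 1) * (real N powr (3 / 4) / 2) ^ j0)"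
        using P_bounds N1 t0 by (intro divide_left_mono mult_mono j0l power_mono mult_pos_pos) auto
      also have "\<dots> = 2 ^ (j0 + 1) * 2 ^ j0 * (real N ^ 2 / (real N powr (3 / 4)) ^ j0)"
        unfolding power_mult_distrib[of 2] power_divide Nj using N1 by simp
      also have "(real N powr (3 / 4)) ^ j0 = real N powr (3 / 4 * real j0)"
        using N1 by (simp add: powr_powr flip: powr_realpow)
      also have "real N ^ 2 / real N powr (3 / 4 * real j0) = real N powr (2 - 3 / 4 * real j0)"
        using N1 powr_realpow[of "real N" 2] by (simp add: powr_diff)
      also have "2 ^ (j0 + 1) * 2 ^ j0 * real N powr (2 - 3 / 4 * real j0) \<le> 2 * 4 ^ k * real N powr (1 / 2)"
      proof (rule mult_mono)
        have "(2::real) ^ (j0 + 1) * 2 ^ j0 = 2 * 4 ^ j0" by (simp flip: power_mult_distrib)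
        also have "\<dots> \<le> 2 * 4 ^ k" using j0k by (intro mult_left_mono power_increasing) auto
        finally show "(2::real) ^ (j0 + 1) * 2 ^ j0 \<le> 2 * 4 ^ k" .
        show "real N powr (2 - 3 / 4 * real j0) \<le> real N powr (1 / 2)" using N1 j02 by (intro powr_mono) auto
      qed auto
      finally show ?thesis .
    qed
    then have "4 * (1 + ln (real N)) * (1 / (\<delta> * real P ^ j0)) \<le> 4 * (1 + ln (real N)) * (2 * 4 ^ k * real N powr (1 / 2))"
      using lnN by (intro mult_left_mono) auto
    moreover have "1 * 1 * 1 \<le> (1 + ln (real N)) * 4 ^ k * real N powr (1 / 2)"
      using lnN N1 by (intro mult_mono ge_one_powr_ge_zero) auto
    moreover have "4 * (1 + ln (real N)) * (2 * 4 ^ k * real N powr (1 / 2)) = 8 * ((1 + ln (real N)) * 4 ^ k * real N powr (1 / 2))"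
      by simp
    moreover have "4 * (1 + ln (real N)) / (\<delta> * real P ^ j0) = 4 * (1 + ln (real N)) * (1 / (\<delta> * real P ^ j0))"
      by simp
    ultimately have "1 + 4 * (1 + ln (real N)) / (\<delta> * real P ^ j0) \<le> 9 * ((1 + ln (real N)) * 4 ^ k * real N powr (1 / 2))"
      by linarith
    also have "\<dots> \<le> 16 * ((1 + ln (real N)) * (1 + ln (real N)) * 4 ^ k * real N powr (1 / 2))"
      using lnN by (intro mult_mono) auto
    finally have "real N * (1 + 4 * (1 + ln (real N)) / (\<delta> * real P ^ j0)) \<le>
       real N * (16 * ((1 + ln (real N)) * (1 + ln (real N)) * 4 ^ k * real N powr (1 / 2)))"
      by (intro mult_left_mono) auto
    also have "\<dots> = (real N * real N powr (1 / 2)) * (16 * ((1 + ln (real N)) * (1 + ln (real N)) * 4 ^ k))" by simp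
    also have "real N * real N powr (1 / 2) = (real N powr (3 / 4)) ^ 2"
      using N1 powr_mult_base[of "real N" "1 / 2"] by (simp add: power2_eq_square flip: powr_add)
    also have "(4::real) ^ k = (2 ^ k) ^ 2" by (simp flip: power_mult_distrib add: power2_eq_square)
    finally show "real N * (1 + 4 * (1 + ln (real N)) / (\<delta> * real P ^ j0)) \<le> (real N powr (3 / 4) * (4 * 2 ^ k * (1 + ln (real N)))) ^ 2"
      by (simp add: power2_eq_square mult_ac)
    show "0 \<le> real N powr (3 / 4) * (4 * 2 ^ k * (1 + ln (real N)))" using lnN by simp
  qed
  let ?K = "real k * (real k + 1) / 2"
  let ?f = "\<lambda>n. norm (real_expsum k P (taylor_freq n))"
  have P0: "real P > 0" using P_bounds by simp
  have lnN: "ln (real N) \<ge> 0" using N1 by simp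
  have "(\<Sum>n\<in>I. ?f n ^ (2 * s)) \<le> real (vinogradov k s P) * (\<Sum>v\<in>freq_box k s P. norm (\<Sum>n\<in>I. cis (\<Sum>j=1..k. taylor_freq n j * real_of_int (v j))))"
    by (rule sum_expsum_power_le)
  also have "\<dots> \<le> (C * real P powr (2 * real s - ?K + 1 / 8)) *
      (((3 * real s) ^ k * real P powr ?K) * (real N powr (3 / 4) * (4 * 2 ^ k * (1 + ln (real N)))))"
    by (intro mult_mono vmv order_trans[OF box] root card_freq_box_le mult_nonneg_nonneg)
      (use P_bounds C s N1 \<delta> in \<open>auto intro!: sum_nonneg\<close>)
  also have "\<dots> = C * (6 * real s) ^ k * (4 * (1 + ln (real N))) * (real P powr (2 * real s - ?K + 1 / 8) * real P powr ?K) * real N powr (3 / 4)"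
  proof -
    have "(6 * real s) ^ k = ((3 * real s) * 2) ^ k" by simp
    then have "(6 * real s) ^ k = (3 * real s) ^ k * 2 ^ k" by (simp only: power_mult_distrib)
    then show ?thesis by (simp only: mult_ac)
  qed
  also have "real P powr (2 * real s - ?K + 1 / 8) * real P powr ?K = real P powr (1 / 8) * real P ^ (2 * s)"
  proof -
    have "real P powr (2 * real s - ?K + 1 / 8) * real P powr ?K = real P powr (1 / 8 + 2 * real s)"
      by (simp flip: powr_add add: add_ac)
    also have "\<dots> = real P powr (1 / 8) * real P powr (2 * real s)" by (rule powr_add)
    finally show ?thesis using P0 powr_realpow[of "real P" "2 * s"] by simp
  qed
  also have "C * (6 * real s) ^ k * (4 * (1 + ln (real N))) * (real P powr (1 / 8) * real P ^ (2 * s)) * real N powr (3 / 4) =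
     (C * (6 * real s) ^ k * (4 * (1 + ln (real N)))) * (real P powr (1 / 8) * real N powr (3 / 4)) * real P ^ (2 * s)"
    by (simp only: mult_ac)
  also have "\<dots> \<le> (C * (6 * real s) ^ k * (4 * (1 + ln (real N)))) * (real N powr (7 / 8)) * real P ^ (2 * s)"
  proof (intro mult_right_mono mult_left_mono)
    have "real P powr (1 / 8) \<le> (real N powr (3 / 4)) powr (1 / 8)" using P_bounds by (intro powr_mono2) auto
    then have "real P powr (1 / 8) * real N powr (3 / 4) \<le> (real N powr (3 / 4)) powr (1 / 8) * real N powr (3 / 4)"
      by (rule mult_right_mono) auto
    also have "\<dots> = real N powr (27 / 32)" by (simp add: powr_powr flip: powr_add)
    also have "\<dots> \<le> real N powr (7 / 8)" using N1 by (intro powr_mono) auto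
    finally show "real P powr (1 / 8) * real N powr (3 / 4) \<le> real N powr (7 / 8)" .
  qed (use C lnN in auto)
  finally have fsum: "(\<Sum>n\<in>I. ?f n ^ (2 * s)) \<le> (C * (6 * real s) ^ k * (4 * (1 + ln (real N)))) * real N powr (7 / 8) * real P ^ (2 * s)" .
  have "(\<Sum>n\<in>I. ?f n / P) \<le> (\<Sum>n\<in>I. 1 / L + L ^ (2 * s - 1) * (?f n / P) ^ (2 * s))"
    using L s by (intro sum_mono le_inverse_plus_power) auto
  also have "\<dots> = real (card I) / L + L ^ (2 * s - 1) * ((\<Sum>n\<in>I. ?f n ^ (2 * s)) / real P ^ (2 * s))"
    by (simp add: sum.distrib sum_distrib_left sum_divide_distrib power_divide)
  also have "\<dots> \<le> real N / L + L ^ (2 * s - 1) * (real N / L ^ (2 * s))"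
  proof (intro add_mono mult_left_mono divide_right_mono)
    have "card I \<le> N" using card_mono[OF _ I] by simp
    then show "real (card I) \<le> real N" by simp
    have "(\<Sum>n\<in>I. ?f n ^ (2 * s)) / real P ^ (2 * s) \<le> (C * (6 * real s) ^ k * (4 * (1 + ln (real N)))) * real N powr (7 / 8)"
      using fsum P0 by (simp add: field_simps)
    also have "\<dots> \<le> (real N powr (1 / 8) / L ^ (2 * s)) * real N powr (7 / 8)"
      using large L by (intro mult_right_mono) (auto simp: field_simps)
    also have "\<dots> = real N / L ^ (2 * s)" using N1 by (simp flip: powr_add)
    finally show "(\<Sum>n\<in>I. ?f n ^ (2 * s)) / real P ^ (2 * s) \<le> real N / L ^ (2 * s)" .
  qed (use L in auto)
  also have "L ^ (2 * s - 1) * (real N / L ^ (2 * s)) = real N / L"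
  proof -
    have "L ^ (2 * s) = L * L ^ (2 * s - 1)" using s by (simp flip: power_Suc)
    then show ?thesis using L by simp
  qed
  finally show ?thesis by simp
qed

text \<open>Averaging over the shifts n \<mapsto> n + x with x < P costs O(P/N) and produces short
  sums in x. In these the modulus of the summand is frozen at x = 0 and the phase is replaced by its
  Taylor polynomial; \<open>mean_expsum_le\<close> then saves the factor L on average over n. The
  term 5 N^(-1/4) collects the Taylor error and four times P/N.\<close>

lemma block_sum_le:
  assumes ab: "N \<le> a" "a \<le> b" "b \<le> 2 * N" and \<sigma>: "0 \<le> \<sigma>" "\<sigma> \<le> 1"
  shows "norm (\<Sum>n=a..<b. inv_pow (Complex (1 + \<sigma>) (- \<tau>)) (real n + \<beta>)) \<le> 2 / L + 5 * real N powr (- 1 / 4)"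
proof -
  let ?g = "\<lambda>n. inv_pow (Complex (1 + \<sigma>) (- \<tau>)) (real n + \<beta>)"
  let ?f = "\<lambda>n. norm (real_expsum k P (taylor_freq n))"
  have N1: "real N \<ge> 2" using N by simp
  have P0: "real P > 0" using P_bounds by simp
  have PN: "real P / real N \<le> real N powr (- 1 / 4)"
  proof -
    have "real P / real N \<le> real N powr (3 / 4) / real N powr 1" using P_bounds N1 by (simp add: divide_right_mono)
    also have "\<dots> = real N powr (3 / 4 - 1)" by (rule powr_diff[symmetric])
    finally show ?thesis by simp
  qed
  have u: "real N \<le> real n + \<beta>" if "n \<ge> N" for n using that \<beta> by simp
  have small: "(real n + \<beta>) powr (- (1 + \<sigma>)) \<le> 1 / real N" if "n \<ge> N" for n
  proof -
    have "(real n + \<beta>) powr (- (1 + \<sigma>)) \<le> (real n + \<beta>) powr (- 1)"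
      using u[OF that] N1 \<sigma> by (intro powr_mono) auto
    also have "\<dots> = 1 / (real n + \<beta>)" using u[OF that] N1 by (simp add: powr_minus_divide)
    also have "\<dots> \<le> 1 / real N" using u[OF that] N1 by (intro divide_left_mono) auto
    finally show ?thesis .
  qed
  have gN: "norm (?g n) \<le> 1 / real N" if "n \<ge> N" for n
    using small[OF that] u[OF that] N1 by (subst norm_inv_pow) auto
  have inner: "norm (\<Sum>x<P. ?g (n + x)) \<le> 1 / real N * (?f n + real P * real N powr (- 1 / 4)) + real P * (2 * real P / real N ^ 2)"
    if n: "n \<ge> N" for n
  proof -
    define v where "v = real n + \<beta>"
    have v: "real N \<le> v" "v > 0" using u[OF n] N1 by (auto simp: v_def)
    \<comment> \<open>Freezing the modulus at x = 0: by 1 - 1/y^2 \<le> 2 (y - 1) with y = (v +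
      x)/v, its relative change is at most 2x/v, uniformly for 0 \<le> \<sigma> \<le> 1.\<close>
    have "norm (?g (n + x) - of_real (v powr (- (1 + \<sigma>))) * cis (\<tau> * ln (v + real x))) \<le> 2 * real P / real N ^ 2" if "x < P" for x
    proof -
      have "?g (n + x) = of_real ((v + real x) powr (- (1 + \<sigma>))) * cis (\<tau> * ln (v + real x))"
        using v inv_pow_eq[of "v + real x" "1 + \<sigma>" \<tau>] by (simp add: v_def add_ac)
      then have "?g (n + x) - of_real (v powr (- (1 + \<sigma>))) * cis (\<tau> * ln (v + real x)) =
         of_real ((v + real x) powr (- (1 + \<sigma>)) - v powr (- (1 + \<sigma>))) * cis (\<tau> * ln (v + real x))"
        by (simp add: algebra_simps)
      then have "norm (?g (n + x) - of_real (v powr (- (1 + \<sigma>))) * cis (\<tau> * ln (v + real x))) =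
         \<bar>(v + real x) powr (- (1 + \<sigma>)) - v powr (- (1 + \<sigma>))\<bar>"
        by (simp only: norm_mult norm_cis norm_of_real mult_1_right)
      also have "\<dots> = v powr (- (1 + \<sigma>)) - (v + real x) powr (- (1 + \<sigma>))"
      proof -
        have "(v + real x) powr (- (1 + \<sigma>)) \<le> v powr (- (1 + \<sigma>))" using v \<sigma> by (intro powr_mono2') auto
        then show ?thesis by simp
      qed
      also have "\<dots> = v powr (- (1 + \<sigma>)) * (1 - ((v + real x) / v) powr (- (1 + \<sigma>)))"
        using v by (simp add: powr_divide right_diff_distrib)
      also have "\<dots> \<le> 1 / real N * (2 * real x / v)"
      proof (rule mult_mono)
        show "v powr (- (1 + \<sigma>)) \<le> 1 / real N" using small[OF n] by (simp add: v_def)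
        define y where "y = (v + real x) / v"
        have y: "y \<ge> 1" using v by (simp add: y_def)
        have "y powr (- 2) \<le> y powr (- (1 + \<sigma>))" using y \<sigma> by (intro powr_mono) auto
        moreover have "1 - y powr (- 2) \<le> 2 * (y - 1)"
        proof -
          have "y powr (- 2) = 1 / y ^ 2" using y powr_realpow[of y 2] by (simp add: powr_minus_divide)
          moreover have "(1 - 1 / y) ^ 2 \<ge> 0" by simp
          then have "1 - 1 / y ^ 2 \<le> 2 - 2 / y" unfolding power2_diff power_divide by simp
          moreover have "2 - 2 / y \<le> 2 * (y - 1)"
          proof -
            have "1 - 1 / y = (y - 1) / y" using y by (simp add: field_simps)
            also have "\<dots> \<le> (y - 1) / 1" using y by (intro divide_left_mono) auto
            finally show ?thesis by simp
          qed
          ultimately show ?thesis by linarith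
        qed
        moreover have "2 * (y - 1) = 2 * real x / v" using v by (simp add: y_def field_simps)
        ultimately show "1 - ((v + real x) / v) powr (- (1 + \<sigma>)) \<le> 2 * real x / v"
          unfolding y_def[symmetric] by linarith
        have "y powr (- (1 + \<sigma>)) \<le> y powr 0" using y \<sigma> by (intro powr_mono) auto
        then show "0 \<le> 1 - ((v + real x) / v) powr (- (1 + \<sigma>))" unfolding y_def[symmetric] using y by simp
      qed (use N1 in auto)
      also have "\<dots> \<le> 1 / real N * (2 * real P / real N)"
        using that v N1 by (intro mult_left_mono frac_le) auto
      finally show ?thesis by (simp add: power2_eq_square)
    qed
    then have "norm (\<Sum>x<P. ?g (n + x) - of_real (v powr (- (1 + \<sigma>))) * cis (\<tau> * ln (v + real x))) \<le> (\<Sum>x<P. 2 * real P / real N ^ 2)"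
      by (intro order_trans[OF norm_sum] sum_mono) auto
    then have 1: "norm ((\<Sum>x<P. ?g (n + x)) - of_real (v powr (- (1 + \<sigma>))) * (\<Sum>x<P. cis (\<tau> * ln (v + real x)))) \<le> real P * (2 * real P / real N ^ 2)"
      by (simp add: sum_subtractf sum_distrib_left)
    have 2: "norm (\<Sum>x<P. cis (\<tau> * ln (v + real x))) \<le> ?f n + real P * real N powr (- 1 / 4)"
    proof -
      have "norm (cis (\<tau> * (ln (v + real x) - ln v)) - cis (\<Sum>j=1..k. taylor_freq n j * real x ^ j)) \<le> real N powr (- 1 / 4)" if "x < P" for x
      proof -
        have "ln ((v + real x) / v) = ln (v + real x) - ln v" using v by (simp add: ln_div)
        moreover have "(v + real x) / v = 1 + real x / v" using v by (simp add: field_simps)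
        ultimately have "ln (v + real x) - ln v = ln (1 + real x / v)" by simp
        moreover have "(\<Sum>j=1..k. taylor_freq n j * real x ^ j) = \<tau> * (\<Sum>j=1..k. (- 1) ^ (j + 1) * (real x / v) ^ j / real j)"
          by (simp add: sum_distrib_left v_def power_divide mult_ac)
        ultimately have "norm (cis (\<tau> * (ln (v + real x) - ln v)) - cis (\<Sum>j=1..k. taylor_freq n j * real x ^ j)) \<le>
           \<bar>\<tau> * ln (1 + real x / v) - \<tau> * (\<Sum>j=1..k. (- 1) ^ (j + 1) * (real x / v) ^ j / real j)\<bar>"
          by (simp only: norm_cis_diff_le)
        also have "\<dots> = \<bar>\<tau>\<bar> * \<bar>ln (1 + real x / v) - (\<Sum>j=1..k. (- 1) ^ (j + 1) * (real x / v) ^ j / real j)\<bar>"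
          by (simp add: abs_mult flip: right_diff_distrib)
        also have "\<dots> \<le> real N powr (real k / 4) * (real x / v) ^ (k + 1)"
          using v by (intro mult_mono \<tau> ln_one_plus_taylor) auto
        also have "\<dots> \<le> real N powr (real k / 4) * (real N powr (- 1 / 4)) ^ (k + 1)"
        proof (intro mult_left_mono power_mono)
          have "real x / v \<le> real P / real N" using that v N1 by (intro frac_le) auto
          then show "real x / v \<le> real N powr (- 1 / 4)" using PN by linarith
        qed (use v in auto)
        also have "\<dots> = real N powr (- 1 / 4)"
          using N1 by (simp add: powr_powr field_simps flip: powr_realpow powr_add)
        finally show ?thesis .
      qed
      then have "norm (\<Sum>x<P. cis (\<tau> * (ln (v + real x) - ln v)) - cis (\<Sum>j=1..k. taylor_freq n j * real x ^ j)) \<le> (\<Sum>x<P. real N powr (- 1 / 4))"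
        by (intro order_trans[OF norm_sum] sum_mono) auto
      then have "norm ((\<Sum>x<P. cis (\<tau> * (ln (v + real x) - ln v))) - real_expsum k P (taylor_freq n)) \<le> real P * real N powr (- 1 / 4)"
        by (simp add: sum_subtractf real_expsum_def)
      then have "norm (\<Sum>x<P. cis (\<tau> * (ln (v + real x) - ln v))) \<le> ?f n + real P * real N powr (- 1 / 4)"
        using norm_triangle_sub[of "\<Sum>x<P. cis (\<tau> * (ln (v + real x) - ln v))" "real_expsum k P (taylor_freq n)"] by linarith
      moreover have "(\<Sum>x<P. cis (\<tau> * ln (v + real x))) = cis (\<tau> * ln v) * (\<Sum>x<P. cis (\<tau> * (ln (v + real x) - ln v)))"
        by (simp add: sum_distrib_left cis_mult algebra_simps)
      ultimately show ?thesis by (simp add: norm_mult)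
    qed
    have "norm (of_real (v powr (- (1 + \<sigma>))) * (\<Sum>x<P. cis (\<tau> * ln (v + real x)))) \<le> 1 / real N * (?f n + real P * real N powr (- 1 / 4))"
      unfolding norm_mult using small[OF n] by (intro mult_mono 2) (auto simp: v_def)
    then show ?thesis using 1 norm_triangle_sub[of "\<Sum>x<P. ?g (n + x)" "of_real (v powr (- (1 + \<sigma>))) * (\<Sum>x<P. cis (\<tau> * ln (v + real x)))"]
      by linarith
  qed
  let ?T = "\<Sum>n=a..<b. ?g n"
  have cardab: "real (card {a..<b}) \<le> real N" using ab by simp
  \<comment> \<open>A shift by x exchanges at most 2x terms, each of size at most 1/N.\<close>
  have "norm (of_nat P * ?T - (\<Sum>x<P. \<Sum>n=a..<b. ?g (n + x))) \<le> real P * (2 * real P * (1 / real N))"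
  proof -
    have "of_nat P * ?T - (\<Sum>x<P. \<Sum>n=a..<b. ?g (n + x)) = (\<Sum>x<P. ?T - (\<Sum>n=a..<b. ?g (n + x)))"
      by (simp add: sum_subtractf)
    also have "norm \<dots> \<le> (\<Sum>x<P. 2 * real P * (1 / real N))"
    proof (intro order_trans[OF norm_sum] sum_mono)
      fix x assume x: "x \<in> {..<P}"
      have "norm (?T - (\<Sum>n=a..<b. ?g (n + x))) \<le> 2 * real x * (1 / real N)"
        using sum_shift_le[of a b ?g "1 / real N" x] gN ab by simp
      also have "\<dots> \<le> 2 * real P * (1 / real N)" using x by (intro mult_right_mono) auto
      finally show "norm (?T - (\<Sum>n=a..<b. ?g (n + x))) \<le> 2 * real P * (1 / real N)" .
    qed
    finally show ?thesis by simp
  qed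
  moreover have "norm (\<Sum>x<P. \<Sum>n=a..<b. ?g (n + x)) \<le> real P * (2 / L + real N powr (- 1 / 4) + 2 * real P / real N)"
  proof -
    have "norm (\<Sum>x<P. \<Sum>n=a..<b. ?g (n + x)) = norm (\<Sum>n=a..<b. \<Sum>x<P. ?g (n + x))"
      by (rule arg_cong[OF sum.swap])
    also have "\<dots> \<le> (\<Sum>n=a..<b. 1 / real N * (?f n + real P * real N powr (- 1 / 4)) + real P * (2 * real P / real N ^ 2))"
    proof (rule order_trans[OF norm_sum], rule sum_mono)
      fix n assume "n \<in> {a..<b}"
      then show "norm (\<Sum>x<P. ?g (n + x)) \<le> 1 / real N * (?f n + real P * real N powr (- 1 / 4)) + real P * (2 * real P / real N ^ 2)"
        using ab by (intro inner) simp
    qed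
    also have "\<dots> = real P / real N * (\<Sum>n=a..<b. ?f n / real P) +
        real (card {a..<b}) * (1 / real N * (real P * real N powr (- 1 / 4)) + real P * (2 * real P / real N ^ 2))"
    proof -
      have "real P / real N * (\<Sum>n\<in>A. h n / real P) = 1 / real N * (\<Sum>n\<in>A. h n)" for A :: "nat set" and h :: "nat \<Rightarrow> real"
        unfolding sum_divide_distrib[symmetric] using P0 by simp
      moreover have "(\<Sum>n\<in>A. 1 / real N * (h n + c) + d) = 1 / real N * (\<Sum>n\<in>A. h n) + real (card A) * (1 / real N * c + d)"
        for A :: "nat set" and h :: "nat \<Rightarrow> real" and c d :: real
        by (simp only: distrib_left sum.distrib sum_constant sum_distrib_left add.assoc)
      ultimately show ?thesis by (simp only:)
    qed
    also have "\<dots> \<le> real P / real N * (2 * real N / L) +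
        real N * (1 / real N * (real P * real N powr (- 1 / 4)) + real P * (2 * real P / real N ^ 2))"
    proof (rule add_mono)
      show "real P / real N * (\<Sum>n=a..<b. ?f n / real P) \<le> real P / real N * (2 * real N / L)"
        using ab by (intro mult_left_mono mean_expsum_le) auto
    qed (rule mult_right_mono[OF cardab], simp)
    also have "\<dots> = real P * (2 / L + real N powr (- 1 / 4) + 2 * real P / real N)"
    proof -
      have "real P / real N * (2 * real N / L) = real P * (2 / L)" using N1 by simp
      moreover have "real N * (1 / real N * (real P * r) + real P * (2 * real P / real N ^ 2)) =
          real P * r + real P * (2 * real P / real N)" for r
        using N1 by (simp add: distrib_left power2_eq_square)
      ultimately show ?thesis by (simp only: distrib_left add.assoc)
    qed
    finally show ?thesis .
  qed
  ultimately have "norm (of_nat P * ?T) \<le> real P * (2 * real P * (1 / real N)) + real P * (2 / L + real N powr (- 1 / 4) + 2 * real P / real N)"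
    using norm_triangle_sub[of "of_nat P * ?T" "\<Sum>x<P. \<Sum>n=a..<b. ?g (n + x)"] by linarith
  also have "\<dots> = real P * (2 / L + real N powr (- 1 / 4) + 4 * (real P / real N))" by (simp add: algebra_simps)
  finally have "norm ?T \<le> 2 / L + real N powr (- 1 / 4) + 4 * (real P / real N)"
    using P0 by (simp add: norm_mult)
  then show ?thesis using PN by linarith
qed

end

section \<open>Zeta sums up to the height\<close>

lemma dyadic_sum_le:
  fixes g :: "nat \<Rightarrow> complex"
  assumes B: "B \<ge> 0"
    and block: "\<And>N a b. m0 \<le> N \<Longrightarrow> N < M \<Longrightarrow> N \<le> a \<Longrightarrow> a \<le> b \<Longrightarrow> b \<le> 2 * N \<Longrightarrow> norm (\<Sum>n=a..<b. g n) \<le> B"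
  shows "norm (\<Sum>n=m0..<min M (m0 * 2 ^ J). g n) \<le> real J * B"
proof (induction J)
  case (Suc J)
  let ?N = "m0 * 2 ^ J"
  show ?case
  proof (cases "M \<le> ?N")
    case True
    then have "min M (m0 * 2 ^ Suc J) = min M ?N" by simp
    then show ?thesis using Suc B by (simp add: algebra_simps)
  next
    case False
    \<comment> \<open>The last block may be cut off at M, which is why \<open>block\<close> speaks
      of arbitrary subintervals of [N, 2N).\<close>
    let ?b = "min M (2 * ?N)"
    have N: "m0 \<le> ?N" by simp
    have "(\<Sum>n=m0..<?b. g n) = (\<Sum>n=m0..<?N. g n) + (\<Sum>n=?N..<?b. g n)"
      using False by (intro sum.atLeastLessThan_concat[symmetric]) auto
    then have "norm (\<Sum>n=m0..<?b. g n) \<le> norm (\<Sum>n=m0..<?N. g n) + norm (\<Sum>n=?N..<?b. g n)"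
      by (simp only: norm_triangle_ineq)
    also have "norm (\<Sum>n=?N..<?b. g n) \<le> B" using False by (intro block[OF N]) auto
    also have "norm (\<Sum>n=m0..<?N. g n) \<le> real J * B" using Suc False by simp
    finally show ?thesis by (simp add: algebra_simps mult_ac)
  qed
qed simp

lemma norm_inv_pow_shift_le:
  assumes "m > 0" "0 \<le> \<beta>" "0 \<le> \<sigma>"
  shows "norm (inv_pow (Complex (1 + \<sigma>) t) (real m + \<beta>)) \<le> 1 / real m"
proof -
  have "norm (inv_pow (Complex (1 + \<sigma>) t) (real m + \<beta>)) = (real m + \<beta>) powr (- (1 + \<sigma>))"
    using assms by (subst norm_inv_pow) auto
  also have "\<dots> \<le> (real m + \<beta>) powr (- 1)" using assms by (intro powr_mono) auto
  also have "\<dots> = 1 / (real m + \<beta>)" using assms by (simp add: powr_minus_divide)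
  also have "\<dots> \<le> 1 / real m" using assms by (intro divide_left_mono) auto
  finally show ?thesis .
qed

lemma norm_sum_inv_pow_trivial:
  assumes "0 \<le> \<beta>" "0 \<le> \<sigma>" "M \<ge> 1"
  shows "norm (\<Sum>m=1..<M. inv_pow (Complex (1 + \<sigma>) t) (real m + \<beta>)) \<le> 1 + ln (real M)"
proof -
  have "norm (\<Sum>m=1..<M. inv_pow (Complex (1 + \<sigma>) t) (real m + \<beta>)) \<le> (\<Sum>m=1..<M. 1 / real m)"
    by (rule order_trans[OF norm_sum], rule sum_mono) (use assms in \<open>auto intro: norm_inv_pow_shift_le\<close>)
  also have "\<dots> \<le> (\<Sum>m=1..M. 1 / real m)" by (intro sum_mono2) auto
  also have "\<dots> \<le> 1 + ln (real M)" using assms by (intro sum_inverse_le) auto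
  finally show ?thesis .
qed

lemma one_plus_ln_le:
  assumes "N \<ge> (1::real)"
  shows "1 + ln N \<le> 16 * N powr (1 / 16)"
proof -
  have "ln (N powr (1 / 16)) \<le> N powr (1 / 16) - 1" using assms by (intro ln_le_minus_one) auto
  moreover have "ln (N powr (1 / 16)) = ln N / 16" using assms by (simp add: ln_powr)
  ultimately show ?thesis by simp
qed

text \<open>In the application x is ln X. With k about x^(1/40), the condition |\<tau>| \<le>
  N^(k/4) holds once ln N \<ge> B k^39; such N also dominate C and x^(2s), so that each dyadic block
  can save L = x. The O(x) blocks then contribute O(1), while the terms below m0, about exp(B k^39),
  are estimated trivially by 1 + ln m0, of order x^(39/40). The summation stops at |\<tau>|, so that
  every block starts at some N \<le> |\<tau>|.\<close>

theorem zeta_sum_bound: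
  fixes A :: real
  assumes A: "A > 0"
  shows "\<exists>c x0. \<forall>x\<ge>x0. \<forall>\<tau> \<beta> \<sigma>. \<bar>\<tau>\<bar> \<le> exp (A * x) \<and> 0 \<le> \<beta> \<and> \<beta> \<le> 1 \<and> 0 \<le> \<sigma> \<and> \<sigma> \<le> 1 \<longrightarrow>
     norm (\<Sum>m=1..<nat \<lfloor>\<bar>\<tau>\<bar>\<rfloor> + 1. inv_pow (Complex (1 + \<sigma>) (- \<tau>)) (real m + \<beta>)) \<le> c * x powr (39 / 40)"
proof -
  define B where "B = 4 * A + 1"
  have B: "B \<ge> 1" using A by (simp add: B_def)
  obtain k0 where k0: "\<And>k. k \<ge> k0 \<Longrightarrow> \<exists>s C. s > 0 \<and> s \<le> 2 * k ^ 3 \<and> C \<ge> 1 \<and> ln C \<le> real k ^ 16 \<and>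
     (\<forall>P>0. real (vinogradov k s P) \<le> C * real P powr (2 * real s - real k * (real k + 1) / 2 + 1 / 8))"
    using vinogradov_mean_value by blast
  \<comment> \<open>The logarithms of the factors in \<open>large\<close>: 64 is 4 times the 16 from
    \<open>one_plus_ln_le\<close>, followed by C, (6 s)^k and x^(2s), with s \<le> 2 k^3 and ln x
    \<le> 40 ln k.\<close>
  have "eventually (\<lambda>k::real. ln 64 + k ^ 16 + k * ln (12 * k ^ 3) + 4 * k ^ 3 * (40 * ln k) \<le> k ^ 39 / 16) at_top"
    by real_asymp
  moreover have "eventually (\<lambda>k::real. 40 * ln k \<le> k ^ 39 / 4) at_top" by real_asymp
  ultimately have "eventually (\<lambda>k::real. ln 64 + k ^ 16 + k * ln (12 * k ^ 3) + 4 * k ^ 3 * (40 * ln k) \<le> k ^ 39 / 16 \<and>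
      40 * ln k \<le> k ^ 39 / 4) at_top" by (rule eventually_conj)
  then obtain k1 where k1: "\<And>k::real. k \<ge> k1 \<Longrightarrow> ln 64 + k ^ 16 + k * ln (12 * k ^ 3) + 4 * k ^ 3 * (40 * ln k) \<le> k ^ 39 / 16"
      "\<And>k::real. k \<ge> k1 \<Longrightarrow> 40 * ln k \<le> k ^ 39 / 4"
    by (auto simp: eventually_at_top_linorder)
  define y0 where "y0 = Max {1, k1, real k0}"
  define c where "c = B * 2 ^ 39 + 14 * A + 23"
  show ?thesis
  proof (rule exI[of _ c], rule exI[of _ "y0 ^ 40"], intro allI impI, elim conjE)
    fix x \<tau> \<beta> \<sigma> :: real
    assume x: "x \<ge> y0 ^ 40" and \<tau>: "\<bar>\<tau>\<bar> \<le> exp (A * x)" and \<beta>: "0 \<le> \<beta>" "\<beta> \<le> 1" and \<sigma>: "0 \<le> \<sigma>" "\<sigma> \<le> 1"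
    have y0: "y0 \<ge> 1" "y0 \<ge> k1" "y0 \<ge> real k0" by (auto simp: y0_def)
    have "1 \<le> y0 ^ 40" using y0 by (intro one_le_power)
    then have x1: "x \<ge> 1" using x by linarith
    define z where "z = x powr (1 / 40)"
    have z40: "z ^ 40 = x" using x1 by (simp add: z_def powr_powr flip: powr_realpow)
    have z: "z \<ge> y0"
    proof (rule ccontr)
      assume "\<not> ?thesis"
      then have "z ^ 40 < y0 ^ 40" using x1 by (intro power_strict_mono) (auto simp: z_def)
      then show False using z40 x by simp
    qed
    define k where "k = nat \<lceil>z\<rceil>"
    have kz: "z \<le> real k" "real k \<le> z + 1" "real k \<le> 2 * z" using z y0 unfolding k_def by linarith+
    have k: "k \<ge> k0" "real k \<ge> k1" "real k \<ge> 1" using kz z y0 by linarith+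
    have k39: "real k ^ 39 \<le> 2 ^ 39 * x powr (39 / 40)"
    proof -
      have "real k ^ 39 \<le> (2 * z) ^ 39" using kz by (intro power_mono) auto
      also have "(2 * z) ^ 39 = 2 ^ 39 * z ^ 39" by (rule power_mult_distrib)
      also have "z ^ 39 = x powr (39 / 40)" using x1 by (simp add: z_def powr_powr flip: powr_realpow)
      finally show ?thesis .
    qed
    have xk: "x \<le> real k ^ 40" unfolding z40[symmetric] using kz z y0 by (intro power_mono) auto
    have lnx: "ln x \<le> 40 * ln (real k)"
    proof -
      have "ln x \<le> ln (real k ^ 40)" using xk x1 k by (subst ln_le_cancel_iff) auto
      then show ?thesis using k by (simp add: ln_realpow)
    qed
    define m0 where "m0 = nat \<lceil>exp (B * real k ^ 39)\<rceil>"
    have m0: "exp (B * real k ^ 39) \<le> real m0" "real m0 \<le> exp (B * real k ^ 39 + 1)"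
    proof -
      show "exp (B * real k ^ 39) \<le> real m0" unfolding m0_def by linarith
      have "real m0 \<le> exp (B * real k ^ 39) + 1" unfolding m0_def using exp_gt_zero[of "B * real k ^ 39"] by linarith
      also have "\<dots> \<le> exp (B * real k ^ 39) * exp 1"
      proof -
        have "1 \<le> exp (B * real k ^ 39)" using B by simp
        moreover have "exp (B * real k ^ 39) * 2 \<le> exp (B * real k ^ 39) * exp 1"
          using exp_ge_add_one_self[of 1] by (intro mult_left_mono) auto
        ultimately show ?thesis by linarith
      qed
      finally show "real m0 \<le> exp (B * real k ^ 39 + 1)" by (simp add: exp_add)
    qed
    have Bk: "B * real k ^ 39 \<ge> 1"
    proof -
      have "1 * 1 \<le> B * real k ^ 39" using B k by (intro mult_mono one_le_power) auto
      then show ?thesis by simp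
    qed
    have m02: "m0 \<ge> 2"
    proof -
      have "2 \<le> exp (B * real k ^ 39)" using exp_ge_add_one_self[of "B * real k ^ 39"] Bk by linarith
      then have "2 \<le> real m0" using m0 by linarith
      then show ?thesis by simp
    qed
    have lnm0: "ln (real m0) \<le> B * real k ^ 39 + 1"
    proof -
      have "ln (real m0) \<le> ln (exp (B * real k ^ 39 + 1))" using m0 m02 by (subst ln_le_cancel_iff) auto
      then show ?thesis by simp
    qed
    obtain s C where s: "s > 0" "s \<le> 2 * k ^ 3" and C: "C \<ge> 1" "ln C \<le> real k ^ 16"
      and vmv: "\<And>P. P > 0 \<Longrightarrow> real (vinogradov k s P) \<le> C * real P powr (2 * real s - real k * (real k + 1) / 2 + 1 / 8)"
      using k0[OF k(1)] by blast
    let ?M = "nat \<lfloor>\<bar>\<tau>\<bar>\<rfloor> + 1"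
    let ?g = "\<lambda>m. inv_pow (Complex (1 + \<sigma>) (- \<tau>)) (real m + \<beta>)"
    have large: "64 * (C * (6 * real s) ^ k * x ^ (2 * s)) \<le> real m0 powr (1 / 16)"
    proof -
      have "ln (64 * (C * (6 * real s) ^ k * x ^ (2 * s))) = ln 64 + (ln C + real k * ln (6 * real s) + real (2 * s) * ln x)"
        using C s x1 by (simp add: ln_mult ln_realpow distrib_left)
      also have "\<dots> \<le> ln 64 + (real k ^ 16 + real k * ln (12 * real k ^ 3) + real (4 * k ^ 3) * (40 * ln (real k)))"
      proof (intro add_mono mult_mono)
        have "6 * real s \<le> 12 * real k ^ 3" using s(2) by (simp flip: of_nat_power)
        then show "ln (6 * real s) \<le> ln (12 * real k ^ 3)" using s k by (subst ln_le_cancel_iff) auto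
        have "1 \<le> 6 * real s" using s by simp
        then show "0 \<le> ln (6 * real s)" by simp
        show "real (2 * s) \<le> real (4 * k ^ 3)" using s(2) by linarith
        show "0 \<le> ln x" using x1 by simp
      qed (use C lnx in auto)
      also have "\<dots> \<le> real k ^ 39 / 16" using k1(1)[OF k(2)] by simp
      also have "\<dots> \<le> B * real k ^ 39 / 16" using B mult_right_mono[of 1 B "real k ^ 39"] by simp
      finally have "exp (ln (64 * (C * (6 * real s) ^ k * x ^ (2 * s)))) \<le> exp (B * real k ^ 39 / 16)"
        by (simp only: exp_le_cancel_iff)
      moreover have "0 < 64 * (C * (6 * real s) ^ k * x ^ (2 * s))" using C s x1 by simp
      ultimately have "64 * (C * (6 * real s) ^ k * x ^ (2 * s)) \<le> exp (B * real k ^ 39 / 16)"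
        by (simp only: exp_ln)
      also have "\<dots> = (exp (B * real k ^ 39)) powr (1 / 16)" by (simp add: powr_def)
      also have "\<dots> \<le> real m0 powr (1 / 16)" using m0 by (intro powr_mono2) auto
      finally show ?thesis .
    qed
    have blk: "norm (\<Sum>n=a..<b. ?g n) \<le> 7 / x" if N: "m0 \<le> N" "N < ?M" and ab: "N \<le> a" "a \<le> b" "b \<le> 2 * N" for N a b
    proof -
      have N2: "N \<ge> 2" using N m02 by linarith
      have Nm: "real m0 \<le> real N" using N by simp
      have expN: "exp (B * real k ^ 39) \<le> real N" using m0 Nm by linarith
      have "norm (\<Sum>n=a..<b. ?g n) \<le> 2 / x + 5 * real N powr (- 1 / 4)"
      proof (rule block_sum_le[OF _ s(1) C(1) vmv N2 _ _ \<beta> x1 _ ab \<sigma>])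
        show "0 < k" using k by linarith
        show "real N \<le> \<bar>\<tau>\<bar>" using N(2) by linarith
        have "\<bar>\<tau>\<bar> \<le> exp (A * x)" by (rule \<tau>)
        also have "A * x \<le> B * real k ^ 39 * (real k / 4)"
        proof -
          have "A * x \<le> A * real k ^ 40" using xk A by (intro mult_left_mono) auto
          also have "\<dots> \<le> B / 4 * real k ^ 40" by (intro mult_right_mono) (auto simp: B_def)
          also have "\<dots> = B * real k ^ 39 * (real k / 4)" using power_add[of "real k" 39 1] by simp
          finally show ?thesis .
        qed
        then have "exp (A * x) \<le> exp (B * real k ^ 39 * (real k / 4))" by simp
        also have "\<dots> = exp (B * real k ^ 39) powr (real k / 4)" by (simp add: powr_def mult.commute)
        also have "\<dots> \<le> real N powr (real k / 4)" using expN by (intro powr_mono2) auto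
        finally show "\<bar>\<tau>\<bar> \<le> real N powr (real k / 4)" .
        have "C * (6 * real s) ^ k * (4 * (1 + ln (real N))) * x ^ (2 * s) = (4 * (C * (6 * real s) ^ k * x ^ (2 * s))) * (1 + ln (real N))"
          by simp
        also have "\<dots> \<le> (4 * (C * (6 * real s) ^ k * x ^ (2 * s))) * (16 * real N powr (1 / 16))"
          using C x1 N2 by (intro mult_left_mono one_plus_ln_le) auto
        also have "\<dots> = (64 * (C * (6 * real s) ^ k * x ^ (2 * s))) * real N powr (1 / 16)" by simp
        also have "\<dots> \<le> real N powr (1 / 16) * real N powr (1 / 16)"
        proof (intro mult_right_mono order_trans[OF large])
          show "real m0 powr (1 / 16) \<le> real N powr (1 / 16)" using Nm by (intro powr_mono2) auto
        qed auto
        also have "\<dots> = real N powr (1 / 8)" by (simp flip: powr_add)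
        finally show "C * (6 * real s) ^ k * (4 * (1 + ln (real N))) * x ^ (2 * s) \<le> real N powr (1 / 8)" .
      qed
      also have "real N powr (- 1 / 4) \<le> 1 / x"
      proof -
        have "ln x \<le> B * real k ^ 39 / 4"
          using lnx k1(2)[OF k(2)] mult_right_mono[OF B, of "real k ^ 39"] by simp
        then have "x \<le> exp (B * real k ^ 39 / 4)" using x1 by (metis exp_le_cancel_iff exp_ln less_le_trans zero_less_one)
        also have "\<dots> = exp (B * real k ^ 39) powr (1 / 4)" by (simp add: powr_def)
        also have "\<dots> \<le> real N powr (1 / 4)" using expN by (intro powr_mono2) auto
        finally have "1 / real N powr (1 / 4) \<le> 1 / x" using x1 N2 by (intro divide_left_mono mult_pos_pos) auto
        then show ?thesis by (simp add: powr_minus_divide)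
      qed
      finally show ?thesis by simp
    qed
    \<comment> \<open>Enough doublings to reach exp(A x + 1), using ln 2 \<ge> 1/2.\<close>
    define J where "J = nat \<lceil>2 * (A * x + 1)\<rceil>"
    have Ax: "A * x \<ge> 0" using A x1 by simp
    have J: "2 * (A * x + 1) \<le> real J" "real J \<le> 2 * A * x + 3"
    proof -
      have "y \<le> real (nat \<lceil>y\<rceil>) \<and> real (nat \<lceil>y\<rceil>) \<le> y + 1" if "y \<ge> 0" for y :: real
        using that by linarith
      from this[of "2 * (A * x + 1)"] show "2 * (A * x + 1) \<le> real J" "real J \<le> 2 * A * x + 3"
        using Ax by (simp_all add: J_def)
    qed
    have MJ: "?M \<le> m0 * 2 ^ J"
    proof -
      have "real ?M \<le> exp (A * x) + 1" using \<tau> by linarith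
      also have "\<dots> \<le> exp (A * x) * exp 1"
      proof -
        have "1 \<le> exp (A * x)" using Ax by simp
        moreover have "exp (A * x) * 2 \<le> exp (A * x) * exp 1"
          using exp_ge_add_one_self[of 1] by (intro mult_left_mono) auto
        ultimately show ?thesis by linarith
      qed
      also have "\<dots> = exp (A * x + 1)" by (simp add: exp_add)
      also have "\<dots> \<le> exp (real J * ln 2)"
      proof -
        have "1 / 2 \<le> ln (2::real)" using ln2_ge_two_thirds by linarith
        then have "real J * (1 / 2) \<le> real J * ln 2" by (intro mult_left_mono) auto
        then show ?thesis using J by simp
      qed
      also have "\<dots> = 2 ^ J" by (simp add: exp_of_nat_mult)
      also have "\<dots> \<le> real m0 * 2 ^ J" using m02 by simp
      also have "\<dots> = real (m0 * 2 ^ J)" by simp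
      finally show ?thesis by (simp only: of_nat_le_iff)
    qed
    have x39: "1 \<le> x powr (39 / 40)" using x1 by (intro ge_one_powr_ge_zero) auto
    have fin: "2 + B * real k ^ 39 + (14 * A + 21) \<le> c * x powr (39 / 40)"
    proof -
      have "2 + B * real k ^ 39 + (14 * A + 21) \<le> B * (2 ^ 39 * x powr (39 / 40)) + (14 * A + 23) * 1"
        using mult_left_mono[OF k39, of B] B by simp
      also have "\<dots> \<le> B * (2 ^ 39 * x powr (39 / 40)) + (14 * A + 23) * x powr (39 / 40)"
        using A x39 by (intro add_left_mono mult_left_mono) auto
      also have "\<dots> = c * x powr (39 / 40)" by (simp add: c_def algebra_simps)
      finally show ?thesis .
    qed
    show "norm (\<Sum>m=1..<?M. ?g m) \<le> c * x powr (39 / 40)"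
    proof (cases "?M \<le> m0")
      case True
      have "norm (\<Sum>m=1..<?M. ?g m) \<le> 1 + ln (real ?M)" using \<beta> \<sigma> by (intro norm_sum_inv_pow_trivial) auto
      also have "ln (real ?M) \<le> ln (real m0)"
      proof (rule ln_mono)
        show "real ?M \<le> real m0" using True by (simp only: of_nat_le_iff)
        have "0 < ?M" by simp
        then show "0 < real ?M" by (simp only: of_nat_0_less_iff)
      qed
      also have "\<dots> \<le> B * real k ^ 39 + 1" by (rule lnm0)
      finally show ?thesis using fin A by linarith
    next
      case False
      have "(\<Sum>m=1..<?M. ?g m) = (\<Sum>m=1..<m0. ?g m) + (\<Sum>m=m0..<?M. ?g m)"
        using False m02 by (intro sum.atLeastLessThan_concat[symmetric]) auto
      then have "norm (\<Sum>m=1..<?M. ?g m) \<le> norm (\<Sum>m=1..<m0. ?g m) + norm (\<Sum>m=m0..<?M. ?g m)"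
        by (simp only: norm_triangle_ineq)
      moreover have "norm (\<Sum>m=1..<m0. ?g m) \<le> 1 + ln (real m0)" using \<beta> \<sigma> m02 by (intro norm_sum_inv_pow_trivial) auto
      moreover have "norm (\<Sum>m=m0..<?M. ?g m) \<le> real J * (7 / x)"
      proof -
        have "norm (\<Sum>m=m0..<min ?M (m0 * 2 ^ J). ?g m) \<le> real J * (7 / x)"
          by (rule dyadic_sum_le) (use x1 blk in auto)
        then show ?thesis using MJ by (simp only: min_absorb1)
      qed
      moreover have "real J * (7 / x) \<le> 14 * A + 21"
      proof -
        have "real J * (7 / x) \<le> (2 * A * x + 3) * (7 / x)" using J x1 by (intro mult_right_mono) auto
        also have "\<dots> = 14 * A + 21 / x" using x1 by (simp add: field_simps)
        also have "21 / x \<le> 21 / 1" using x1 by (intro divide_left_mono) auto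
        finally show ?thesis by simp
      qed
      ultimately show ?thesis using lnm0 fin by linarith
    qed
  qed
qed

section \<open>Dirichlet series of characters\<close>

lemma inv_pow_mult: "u > 0 \<Longrightarrow> v > 0 \<Longrightarrow> inv_pow s (u * v) = inv_pow s u * inv_pow s v"
  by (simp add: inv_pow_def ln_mult algebra_simps flip: exp_add)

lemma inv_pow_one [simp]: "inv_pow s 1 = 1"
  by (simp add: inv_pow_def)

lemma inv_pow_has_vector_derivative:
  assumes "u > 0"
  shows "(inv_pow s has_vector_derivative (- s * inv_pow (s + 1) u)) (at u within S)"
proof -
  have "((\<lambda>u. complex_of_real (ln u)) has_vector_derivative of_real (1 / u)) (at u within S)"
    by (rule has_vector_derivative_of_real) (use assms in \<open>auto intro!: derivative_eq_intros\<close>)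
  then have "((\<lambda>u. - s * of_real (ln u)) has_vector_derivative - s * of_real (1 / u)) (at u within S)"
    by (rule has_vector_derivative_mult_right)
  moreover have "(exp has_field_derivative exp (- s * of_real (ln u))) (at (- s * of_real (ln u)) within (\<lambda>u. - s * of_real (ln u)) ` S)"
    by (rule has_field_derivative_at_within[OF DERIV_exp])
  ultimately have "((\<lambda>u. exp (- s * of_real (ln u))) has_vector_derivative (- s * of_real (1 / u) * exp (- s * of_real (ln u)))) (at u within S)"
    by (rule field_vector_diff_chain_within[unfolded o_def])
  moreover have "of_real (1 / u) * exp (- s * of_real (ln u)) = inv_pow (s + 1) u"
  proof -
    have "of_real (1 / u) = exp (- of_real (ln u) :: complex)"
      using assms by (simp add: exp_minus exp_of_real divide_inverse)
    then show ?thesis by (simp add: inv_pow_def algebra_simps flip: exp_add)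
  qed
  ultimately have "((\<lambda>u. exp (- s * of_real (ln u))) has_vector_derivative (- s * inv_pow (s + 1) u)) (at u within S)"
    by (simp only: mult.assoc)
  then show ?thesis unfolding inv_pow_def[abs_def] .
qed

lemma norm_inv_pow_le:
  assumes "u \<ge> 1" "Re s \<ge> r"
  shows "norm (inv_pow s u) \<le> u powr (- r)"
  using assms by (subst norm_inv_pow) (auto intro!: powr_mono)

lemma norm_diff_le_deriv:
  fixes f f' :: "real \<Rightarrow> complex"
  assumes "a \<le> b" "\<And>x. x \<in> {a..b} \<Longrightarrow> (f has_vector_derivative f' x) (at x within {a..b})"
    "\<And>x. x \<in> {a..b} \<Longrightarrow> norm (f' x) \<le> B"
  shows "norm (f b - f a) \<le> B * (b - a)"
proof -
  have "norm (f b - f a) \<le> B * norm (b - a)"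
  proof (rule differentiable_bound[of "{a..b}" f "\<lambda>x h. h *\<^sub>R f' x"])
    show "(f has_derivative (\<lambda>h. h *\<^sub>R f' x)) (at x within {a..b})" if "x \<in> {a..b}" for x
      using assms(2)[OF that] by (simp add: has_vector_derivative_def)
    show "onorm (\<lambda>h. h *\<^sub>R f' x) \<le> B" if "x \<in> {a..b}" for x
    proof (rule onorm_bound)
      show "0 \<le> B" using assms(3)[OF that] norm_ge_zero[of "f' x"] by linarith
      show "norm (h *\<^sub>R f' x) \<le> B * norm h" for h
        using mult_right_mono[OF assms(3)[OF that], of "\<bar>h\<bar>"] by (simp add: mult.commute)
    qed
  qed (use assms in auto)
  then show ?thesis using assms(1) by simp
qed

text \<open>On [u, u + 1] a primitive of v^(-s) is compared with the linear function of slope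
  u^(-s). The mean value inequality, once for v^(-s) itself and once for the difference, gives the
  error |s|/u^2.\<close>

lemma euler_maclaurin_step:
  assumes s: "Re s \<ge> 1" "s \<noteq> 1" and u: "u \<ge> 1"
  shows "norm (inv_pow (s - 1) u / (s - 1) - inv_pow (s - 1) (u + 1) / (s - 1) - inv_pow s u) \<le> norm s / u ^ 2"
proof -
  have lip: "norm (inv_pow s v - inv_pow s u) \<le> norm s / u ^ 2" if v: "v \<in> {u..u + 1}" for v
  proof -
    have "norm (inv_pow s v - inv_pow s u) \<le> norm s / u ^ 2 * (v - u)"
    proof (rule norm_diff_le_deriv)
      fix x assume x: "x \<in> {u..v}"
      show "(inv_pow s has_vector_derivative (- s * inv_pow (s + 1) x)) (at x within {u..v})"
        using x u by (intro inv_pow_has_vector_derivative) auto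
      have "norm (inv_pow (s + 1) x) \<le> x powr (- 2)" using x u s by (intro norm_inv_pow_le) auto
      also have "\<dots> \<le> u powr (- 2)" using x u by (intro powr_mono2') auto
      also have "\<dots> = 1 / u ^ 2" using u powr_realpow[of u 2] by (simp add: powr_minus_divide)
      finally have "norm s * norm (inv_pow (s + 1) x) \<le> norm s * (1 / u ^ 2)" by (rule mult_left_mono) simp
      then show "norm (- s * inv_pow (s + 1) x) \<le> norm s / u ^ 2" by (simp add: norm_mult)
    qed (use v in auto)
    also have "\<dots> \<le> norm s / u ^ 2 * 1" using v by (intro mult_left_mono) auto
    finally show ?thesis by simp
  qed
  define F where "F v = inv_pow (s - 1) v / (s - 1) + of_real (v - u) * inv_pow s u" for v
  have "norm (F (u + 1) - F u) \<le> norm s / u ^ 2 * (u + 1 - u)"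
  proof (rule norm_diff_le_deriv)
    fix x assume x: "x \<in> {u..u + 1}"
    have "((\<lambda>v. inv_pow (s - 1) v / (s - 1)) has_vector_derivative (- (s - 1) * inv_pow (s - 1 + 1) x) / (s - 1)) (at x within {u..u + 1})"
      using x u by (intro has_vector_derivative_divide inv_pow_has_vector_derivative) auto
    moreover have "- (s - 1) * inv_pow (s - 1 + 1) x / (s - 1) = - inv_pow s x" using s by (simp add: field_simps)
    ultimately have "((\<lambda>v. inv_pow (s - 1) v / (s - 1)) has_vector_derivative (- inv_pow s x)) (at x within {u..u + 1})"
      by (simp only:)
    moreover have "((\<lambda>v. of_real (v - u) * inv_pow s u) has_vector_derivative inv_pow s u) (at x within {u..u + 1})"
      by (auto intro!: derivative_eq_intros simp: has_vector_derivative_def scaleR_conv_of_real)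
    ultimately show "(F has_vector_derivative (- inv_pow s x + inv_pow s u)) (at x within {u..u + 1})"
      unfolding F_def by (rule has_vector_derivative_add)
    show "norm (- inv_pow s x + inv_pow s u) \<le> norm s / u ^ 2"
      using lip[OF x] by (simp add: norm_minus_commute add.commute)
  qed auto
  then have "norm (- (F (u + 1) - F u)) \<le> norm s / u ^ 2" by (simp only: norm_minus_cancel) simp
  then show ?thesis by (simp add: F_def algebra_simps)
qed

lemma sum_inverse_squares_le:
  assumes "M > 0"
  shows "(\<Sum>m=M..<M'. 1 / real m ^ 2) \<le> 2 / real M"
proof (cases "M < M'")
  case True
  have "(\<Sum>m=M..n. 1 / real m ^ 2) \<le> 2 / real M - 1 / real n" if "M \<le> n" for n
    using that
  proof (induction n rule: nat_induct_at_least)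
    case base
    have "1 / real M ^ 2 \<le> 1 / real M" using assms by (intro divide_left_mono) (auto simp: power2_eq_square)
    then show ?case by simp
  next
    case (Suc n)
    have n: "real n > 0" using assms Suc by simp
    have "1 / real (Suc n) ^ 2 \<le> 1 / (real n * real (Suc n))"
      using n by (intro divide_left_mono) (auto simp: power2_eq_square intro!: mult_right_mono)
    also have "\<dots> = 1 / real n - 1 / real (Suc n)" using n by (simp add: field_simps)
    finally show ?case using Suc by simp
  qed
  from this[of "M' - 1"] have "(\<Sum>m=M..M' - 1. 1 / real m ^ 2) \<le> 2 / real M - 1 / real (M' - 1)" using True by simp
  also have "\<dots> \<le> 2 / real M" by simp
  also have "{M..M' - 1} = {M..<M'}" using True by auto
  finally show ?thesis .
qed simp

text \<open>The errors of the single steps add up to 2|s|/M, which is bounded as soon as M is of the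
  order of |s|. Exponential sum estimates therefore concern only the part of a zeta sum below the
  height |Im s|.\<close>

lemma inv_pow_tail:
  assumes s: "Re s \<ge> 1" "s \<noteq> 1" and M: "M > 0" "M \<le> M'" and \<beta>: "\<beta> \<ge> 0"
  shows "norm ((\<Sum>m=M..<M'. inv_pow s (real m + \<beta>)) -
     (inv_pow (s - 1) (real M + \<beta>) / (s - 1) - inv_pow (s - 1) (real M' + \<beta>) / (s - 1))) \<le> 2 * norm s / real M"
proof -
  let ?G = "\<lambda>m. inv_pow (s - 1) (real m + \<beta>) / (s - 1)"
  have tel: "(\<Sum>m=M..<M'. ?G m - ?G (Suc m)) = ?G M - ?G M'"
    using M(2) by (induction M' rule: dec_induct) auto
  have "norm ((\<Sum>m=M..<M'. inv_pow s (real m + \<beta>)) - (?G M - ?G M')) = norm (\<Sum>m=M..<M'. ?G m - ?G (Suc m) - inv_pow s (real m + \<beta>))"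
  proof -
    have "(\<Sum>m=M..<M'. inv_pow s (real m + \<beta>)) - (?G M - ?G M') = - (\<Sum>m=M..<M'. ?G m - ?G (Suc m) - inv_pow s (real m + \<beta>))"
      unfolding tel[symmetric] by (simp only: sum_subtractf minus_diff_eq)
    then show ?thesis by (simp only: norm_minus_cancel)
  qed
  also have "\<dots> \<le> (\<Sum>m=M..<M'. norm s * (1 / real m ^ 2))"
  proof (rule order_trans[OF norm_sum], rule sum_mono)
    fix m assume "m \<in> {M..<M'}"
    then have m: "real m \<ge> 1" using M by simp
    have "norm (?G m - ?G (Suc m) - inv_pow s (real m + \<beta>)) \<le> norm s / (real m + \<beta>) ^ 2"
      using euler_maclaurin_step[OF s, of "real m + \<beta>"] m \<beta> by (simp add: add_ac)
    also have "\<dots> \<le> norm s / real m ^ 2" using m \<beta> by (intro divide_left_mono power_mono mult_pos_pos) auto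
    finally show "norm (?G m - ?G (Suc m) - inv_pow s (real m + \<beta>)) \<le> norm s * (1 / real m ^ 2)" by simp
  qed
  also have "\<dots> \<le> norm s * (2 / real M)"
    unfolding sum_distrib_left[symmetric] by (intro mult_left_mono sum_inverse_squares_le M) auto
  finally show ?thesis by (simp add: mult.commute)
qed

section \<open>Characters and their L-series\<close>

definition principal :: "nat \<Rightarrow> (nat \<Rightarrow> complex) \<Rightarrow> bool" where
  "principal q \<chi> \<longleftrightarrow> (\<forall>a. coprime a q \<longrightarrow> \<chi> a = 1)"

lemma character_sum_nonprincipal:
  assumes \<chi>: "dirichlet_character q \<chi>" and np: "\<not> principal q \<chi>"
  shows "(\<Sum>a=1..q. \<chi> a) = 0"
proof -
  have q: "q > 0" and mult: "\<And>a b. \<chi> (a * b) = \<chi> a * \<chi> b" using \<chi> by (auto simp: dirichlet_character_def)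
  obtain b where b: "coprime b q" "\<chi> b \<noteq> 1" using np by (auto simp: principal_def)
  have range: "(\<Sum>a=1..q. \<chi> a) = (\<Sum>a<q. \<chi> a)"
  proof -
    have "{1..q} = insert q {1..<q}" "{..<q} = insert 0 {1..<q}" using q by auto
    moreover have "\<chi> q = \<chi> 0" using dirichlet_character_mod[OF \<chi>, of q] by simp
    ultimately show ?thesis by simp
  qed
  have "bij_betw (\<lambda>a. b * a mod q) {..<q} {..<q}"
  proof -
    have "inj_on (\<lambda>a. b * a mod q) {..<q}"
    proof (rule inj_onI)
      fix x y assume xy: "x \<in> {..<q}" "y \<in> {..<q}" "b * x mod q = b * y mod q"
      then have "[x = y] (mod q)" using b(1) cong_mult_lcancel_nat[of b q x y] by (simp add: cong_def)
      then show "x = y" using xy by (simp add: cong_def)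
    qed
    moreover have "(\<lambda>a. b * a mod q) ` {..<q} \<subseteq> {..<q}" using q by auto
    ultimately show ?thesis by (simp add: bij_betw_def endo_inj_surj)
  qed
  then have "(\<Sum>a<q. \<chi> a) = (\<Sum>a<q. \<chi> (b * a mod q))" by (rule sum.reindex_bij_betw[symmetric])
  also have "\<dots> = \<chi> b * (\<Sum>a<q. \<chi> a)" by (simp add: dirichlet_character_mod[OF \<chi>] mult sum_distrib_left)
  finally have "(1 - \<chi> b) * (\<Sum>a<q. \<chi> a) = 0" by (simp add: algebra_simps)
  then show ?thesis using b range by simp
qed

text \<open>Writing n = q m + a with 1 \<le> a \<le> q pulls out q^(-s) and leaves Hurwitz sums with
  shift a/q in (0, 1]. Taking the representatives from 1 to q makes the blocks open on the left and
  closed on the right.\<close>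

lemma sum_residue_blocks:
  assumes \<chi>: "dirichlet_character q \<chi>" and M: "M \<le> M'" "M > 0"
  shows "(\<Sum>n\<in>{q * M<..q * M'}. \<chi> n * inv_pow s (real n)) =
    inv_pow s (real q) * (\<Sum>a=1..q. \<chi> a * (\<Sum>m=M..<M'. inv_pow s (real m + real a / real q)))"
proof -
  have q: "q > 0" using \<chi> by (simp add: dirichlet_character_def)
  have "(\<Sum>n\<in>{q * M<..q * M'}. \<chi> n * inv_pow s (real n)) =
    (\<Sum>m=M..<M'. \<Sum>a=1..q. \<chi> a * inv_pow s (real (q * m + a)))"
    using M(1)
  proof (induction M' rule: dec_induct)
    case (step N)
    have "{q * M<..q * Suc N} = {q * M<..q * N} \<union> {q * N<..q * Suc N}"
    proof (rule Set.set_eqI)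
      fix x
      have "q * M \<le> q * N" "q * N \<le> q * Suc N" by (auto intro: step(1))
      then show "x \<in> {q * M<..q * Suc N} \<longleftrightarrow> x \<in> {q * M<..q * N} \<union> {q * N<..q * Suc N}"
        unfolding greaterThanAtMost_iff Un_iff by linarith
    qed
    then have "(\<Sum>n\<in>{q * M<..q * Suc N}. \<chi> n * inv_pow s (real n)) =
       (\<Sum>n\<in>{q * M<..q * N}. \<chi> n * inv_pow s (real n)) + (\<Sum>n\<in>{q * N<..q * Suc N}. \<chi> n * inv_pow s (real n))"
      by (simp only:) (rule sum.union_disjoint, auto)
    also have "(\<Sum>n\<in>{q * N<..q * Suc N}. \<chi> n * inv_pow s (real n)) = (\<Sum>a=1..q. \<chi> (q * N + a) * inv_pow s (real (q * N + a)))"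
      by (rule sum.reindex_bij_witness[where i = "\<lambda>a. q * N + a" and j = "\<lambda>n. n - q * N"]) auto
    also have "\<dots> = (\<Sum>a=1..q. \<chi> a * inv_pow s (real (q * N + a)))"
    proof (intro sum.cong refl)
      fix a
      have "\<chi> (q * N + a) = \<chi> a"
        using dirichlet_character_mod[OF \<chi>, of "q * N + a"] dirichlet_character_mod[OF \<chi>, of a] by simp
      then show "\<chi> (q * N + a) * inv_pow s (real (q * N + a)) = \<chi> a * inv_pow s (real (q * N + a))" by simp
    qed
    finally show ?case using step by simp
  qed simp
  also have "\<dots> = (\<Sum>m=M..<M'. \<Sum>a=1..q. inv_pow s (real q) * (\<chi> a * inv_pow s (real m + real a / real q)))"
  proof (intro sum.cong refl)
    fix m a assume "m \<in> {M..<M'}" "a \<in> {1..q}"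
    then have "real m + real a / real q > 0" using q M by (intro add_pos_nonneg) auto
    moreover have "real (q * m + a) = real q * (real m + real a / real q)" using q by (simp add: field_simps)
    ultimately show "\<chi> a * inv_pow s (real (q * m + a)) = inv_pow s (real q) * (\<chi> a * inv_pow s (real m + real a / real q))"
      using q inv_pow_mult[of "real q" "real m + real a / real q" s] by simp
  qed
  also have "\<dots> = inv_pow s (real q) * (\<Sum>a=1..q. \<Sum>m=M..<M'. \<chi> a * inv_pow s (real m + real a / real q))"
    unfolding sum_distrib_left by (rule sum.swap)
  finally show ?thesis by (simp only: sum_distrib_left)
qed

lemma norm_inv_pow_nat_le:
  assumes "q > 0" "Re s \<ge> 1"
  shows "norm (inv_pow s (real q)) \<le> 1 / real q"
  using norm_inv_pow_le[of "real q" 1 s] assms by (simp add: powr_minus_divide)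

text \<open>Up to O((1 + |s|)/M) each Hurwitz tail equals G(M) - G(M'), the same for all residues.
  Weighting with \<chi>(a) annihilates this main term unless \<chi> is principal, when the pole
  leaves 2/|s - 1|. The q classes are paid for by |q^(-s)| \<le> 1/q.\<close>

lemma character_tail_bound:
  assumes \<chi>: "dirichlet_character q \<chi>" and M: "M \<le> M'" "M > 0" and s: "Re s \<ge> 1" "s \<noteq> 1"
  shows "norm (\<Sum>n\<in>{q * M<..q * M'}. \<chi> n * inv_pow s (real n)) \<le>
     (if principal q \<chi> then 2 / norm (s - 1) else 0) + 2 * (1 + norm s) / real M"
proof -
  have q: "q > 0" using \<chi> by (simp add: dirichlet_character_def)
  let ?G = "\<lambda>u. inv_pow (s - 1) u / (s - 1)"
  let ?S = "\<Sum>a=1..q. \<chi> a"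
  let ?H = "\<lambda>a. \<Sum>m=M..<M'. inv_pow s (real m + real a / real q)"
  have G: "norm (?G u) \<le> 1 / norm (s - 1)" if "u \<ge> 1" for u
    using norm_inv_pow_le[OF that, of 0 "s - 1"] s that by (simp add: norm_divide divide_right_mono)
  have Gd: "norm (?G (real N + \<beta>) - ?G (real N)) \<le> 1 / real M" if "N \<ge> M" "0 \<le> \<beta>" "\<beta> \<le> 1" for N \<beta>
  proof -
    have N: "real N \<ge> 1" "real N \<ge> real M" using that M by auto
    have "norm (?G (real N + \<beta>) - ?G (real N)) \<le> 1 / real M * (real N + \<beta> - real N)"
    proof (rule norm_diff_le_deriv)
      fix x assume x: "x \<in> {real N..real N + \<beta>}"
      have "(?G has_vector_derivative (- (s - 1) * inv_pow (s - 1 + 1) x) / (s - 1)) (at x within {real N..real N + \<beta>})"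
        using x N by (intro has_vector_derivative_divide inv_pow_has_vector_derivative) auto
      moreover have "- (s - 1) * inv_pow (s - 1 + 1) x / (s - 1) = - inv_pow s x" using s by (simp add: field_simps)
      ultimately show "(?G has_vector_derivative (- inv_pow s x)) (at x within {real N..real N + \<beta>})"
        by (simp only:)
      have "norm (inv_pow s x) \<le> x powr (- 1)" using x N s by (intro norm_inv_pow_le) auto
      also have "\<dots> = 1 / x" using x N by (simp add: powr_minus_divide)
      also have "\<dots> \<le> 1 / real M" using x N M by (intro divide_left_mono) auto
      finally show "norm (- inv_pow s x) \<le> 1 / real M" by simp
    qed (use that in auto)
    also have "\<dots> \<le> 1 / real M * 1" using that by (intro mult_left_mono) auto
    finally show ?thesis by simp
  qed
  have \<chi>1: "norm (\<chi> a) \<le> 1" for a using norm_dirichlet_character_le_1[OF \<chi>] .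
  have H: "norm (?H a - (?G (real M) - ?G (real M'))) \<le> 2 * (1 + norm s) / real M" if "a \<in> {1..q}" for a
  proof -
    have \<beta>: "0 \<le> real a / real q" "real a / real q \<le> 1" using that q by auto
    have "?H a - (?G (real M) - ?G (real M')) = (?H a - (?G (real M + real a / real q) - ?G (real M' + real a / real q)))
       + (?G (real M + real a / real q) - ?G (real M)) - (?G (real M' + real a / real q) - ?G (real M'))"
      by (simp add: algebra_simps)
    moreover have "norm (x + y - z) \<le> norm x + norm y + norm z" for x y z :: complex
      using norm_triangle_ineq4[of "x + y" z] norm_triangle_ineq[of x y] by linarith
    ultimately have "norm (?H a - (?G (real M) - ?G (real M'))) \<le>
       norm (?H a - (?G (real M + real a / real q) - ?G (real M' + real a / real q)))
       + norm (?G (real M + real a / real q) - ?G (real M)) + norm (?G (real M' + real a / real q) - ?G (real M'))"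
      by (simp only:)
    also have "\<dots> \<le> 2 * norm s / real M + 1 / real M + 1 / real M"
      by (intro add_mono inv_pow_tail[OF s M(2,1) \<beta>(1)] Gd[of M, OF order_refl \<beta>] Gd[OF M(1) \<beta>])
    also have "\<dots> = 2 * (1 + norm s) / real M" by (simp add: add_divide_distrib)
    finally show ?thesis .
  qed
  have "(\<Sum>a=1..q. \<chi> a * ?H a) = ?S * (?G (real M) - ?G (real M')) + (\<Sum>a=1..q. \<chi> a * (?H a - (?G (real M) - ?G (real M'))))"
  proof -
    have "(\<Sum>a=1..q. \<chi> a * (?H a - g)) = (\<Sum>a=1..q. \<chi> a * ?H a) - ?S * g" for g
      by (simp only: right_diff_distrib sum_subtractf sum_distrib_right)
    then show ?thesis by simp
  qed
  then have "norm (\<Sum>a=1..q. \<chi> a * ?H a) \<le> norm ?S * norm (?G (real M) - ?G (real M')) +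
     norm (\<Sum>a=1..q. \<chi> a * (?H a - (?G (real M) - ?G (real M'))))"
    using norm_triangle_ineq[of "?S * (?G (real M) - ?G (real M'))" "\<Sum>a=1..q. \<chi> a * (?H a - (?G (real M) - ?G (real M')))"]
    by (simp only: norm_mult)
  also have "norm ?S * norm (?G (real M) - ?G (real M')) \<le> real q * (if principal q \<chi> then 2 / norm (s - 1) else 0)"
  proof (cases "principal q \<chi>")
    case True
    have nS: "norm ?S \<le> (\<Sum>a=1..q. 1)" by (rule order_trans[OF norm_sum], rule sum_mono, rule \<chi>1)
    have "norm (?G (real M) - ?G (real M')) \<le> 1 / norm (s - 1) + 1 / norm (s - 1)"
      by (rule order_trans[OF norm_triangle_ineq4], rule add_mono) (use M in \<open>auto intro!: G\<close>)
    with nS have "norm ?S * norm (?G (real M) - ?G (real M')) \<le> real q * (1 / norm (s - 1) + 1 / norm (s - 1))"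
      by (intro mult_mono) auto
    then show ?thesis using True by simp
  next
    case False
    then show ?thesis using character_sum_nonprincipal[OF \<chi> False] by simp
  qed
  also have "norm (\<Sum>a=1..q. \<chi> a * (?H a - (?G (real M) - ?G (real M')))) \<le> (\<Sum>a=1..q. 1 * (2 * (1 + norm s) / real M))"
    by (rule order_trans[OF norm_sum], rule sum_mono, subst norm_mult, rule mult_mono) (use \<chi>1 H in auto)
  finally have "norm (\<Sum>a=1..q. \<chi> a * ?H a) \<le> real q * ((if principal q \<chi> then 2 / norm (s - 1) else 0) + 2 * (1 + norm s) / real M)"
    by (simp add: algebra_simps)
  then have "norm (inv_pow s (real q)) * norm (\<Sum>a=1..q. \<chi> a * ?H a) \<le>
     1 / real q * (real q * ((if principal q \<chi> then 2 / norm (s - 1) else 0) + 2 * (1 + norm s) / real M))"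
    using norm_inv_pow_nat_le[OF q s(1)] by (intro mult_mono) auto
  then show ?thesis unfolding sum_residue_blocks[OF \<chi> M] norm_mult using q by simp
qed

lemma summable_inv_pow:
  fixes \<sigma> :: real
  assumes "\<sigma> > 0" "\<And>n. n > 0 \<Longrightarrow> norm (F n) \<le> real n powr (- (1 + \<sigma>))"
  shows "summable (\<lambda>n. F (Suc n) :: complex)"
proof (rule summable_comparison_test')
  have "summable (\<lambda>n. real n powr (- (1 + \<sigma>)))" using assms(1) by (subst summable_real_powr_iff) auto
  then show "summable (\<lambda>n. real (Suc n) powr (- (1 + \<sigma>)))" by (subst summable_Suc_iff)
  show "norm (F (Suc n)) \<le> real (Suc n) powr (- (1 + \<sigma>))" for n using assms(2)[of "Suc n"] by simp
qed

lemma norm_character_inv_pow_le: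
  assumes "dirichlet_character q \<chi>" "n > 0"
  shows "norm (\<chi> n * inv_pow s (real n)) \<le> real n powr (- Re s)"
  using mult_mono[OF norm_dirichlet_character_le_1[OF assms(1), of n] order_refl[of "real n powr (- Re s)"]] assms(2)
  by (simp add: norm_mult norm_inv_pow)

text \<open>Three ranges: n \<le> q by the harmonic sum, q < n \<le> q M0 by the hypothesis on
  shifted zeta sums, and the tail by \<open>character_tail_bound\<close>. In the middle range
  \<open>X\<close> is averaged over the residues and so enters without a factor q.\<close>

theorem norm_L_series_le:
  assumes \<chi>: "dirichlet_character q \<chi>" and \<sigma>: "\<sigma> > 0" and M0: "M0 > 0"
    and s: "s = Complex (1 + \<sigma>) t"
    and X: "\<And>\<beta>. 0 \<le> \<beta> \<Longrightarrow> \<beta> \<le> 1 \<Longrightarrow> norm (\<Sum>m=1..<M0. inv_pow s (real m + \<beta>)) \<le> X"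
  shows "norm (\<Sum>n. \<chi> (Suc n) * inv_pow s (real (Suc n))) \<le>
    1 + ln (real q) + X + ((if principal q \<chi> then 2 / norm (s - 1) else 0) + 2 * (1 + norm s) / real M0)"
proof -
  have q: "q > 0" using \<chi> by (simp add: dirichlet_character_def)
  have s1: "Re s \<ge> 1" "s \<noteq> 1" "Re s = 1 + \<sigma>" using s \<sigma> by (auto simp: complex_eq_iff)
  let ?F = "\<lambda>n. \<chi> n * inv_pow s (real n)"
  let ?B = "1 + ln (real q) + X + ((if principal q \<chi> then 2 / norm (s - 1) else 0) + 2 * (1 + norm s) / real M0)"
  have part: "norm (\<Sum>n<q * M'. ?F (Suc n)) \<le> ?B" if M': "M' \<ge> M0" for M'
  proof -
    have qM: "q \<le> q * M0" "q * M0 \<le> q * M'" using M0 M' by auto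
    have "(\<Sum>n<q * M'. ?F (Suc n)) = (\<Sum>n\<in>{0<..q * M'}. ?F n)"
      by (rule sum.reindex_bij_witness[where i = "\<lambda>n. n - 1" and j = Suc]) auto
    also have "\<dots> = (\<Sum>n\<in>{0<..q * M0}. ?F n) + (\<Sum>n\<in>{q * M0<..q * M'}. ?F n)"
      using sum.ub_add_nat[of 1 "q * M0" ?F "q * M' - q * M0"] qM by (simp add: atLeastSucAtMost_greaterThanAtMost)
    also have "(\<Sum>n\<in>{0<..q * M0}. ?F n) = (\<Sum>n\<in>{0<..q}. ?F n) + (\<Sum>n\<in>{q * 1<..q * M0}. ?F n)"
      using sum.ub_add_nat[of 1 q ?F "q * M0 - q"] qM by (simp add: atLeastSucAtMost_greaterThanAtMost)
    finally have eq: "(\<Sum>n<q * M'. ?F (Suc n)) =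
       (\<Sum>n\<in>{0<..q}. ?F n) + (\<Sum>n\<in>{q * 1<..q * M0}. ?F n) + (\<Sum>n\<in>{q * M0<..q * M'}. ?F n)" .
    have "norm (\<Sum>n\<in>{0<..q}. ?F n) \<le> (\<Sum>n=1..q. 1 / real n)"
    proof -
      have "norm (\<Sum>n\<in>{0<..q}. ?F n) \<le> (\<Sum>n\<in>{0<..q}. 1 / real n)"
      proof (rule order_trans[OF norm_sum], rule sum_mono)
        fix n assume n: "n \<in> {0<..q}"
        have "norm (?F n) \<le> real n powr (- Re s)" using n by (intro norm_character_inv_pow_le[OF \<chi>]) auto
        also have "\<dots> \<le> real n powr (- 1)" using n s1 by (intro powr_mono) auto
        finally show "norm (?F n) \<le> 1 / real n" using n by (simp add: powr_minus_divide)
      qed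
      moreover have "{0<..q} = {1..q}" by auto
      ultimately show ?thesis by simp
    qed
    also have "\<dots> \<le> 1 + ln (real q)" using q by (rule sum_inverse_le)
    finally have 1: "norm (\<Sum>n\<in>{0<..q}. ?F n) \<le> 1 + ln (real q)" .
    have 2: "norm (\<Sum>n\<in>{q * 1<..q * M0}. ?F n) \<le> X"
    proof -
      have "norm (\<Sum>a=1..q. \<chi> a * (\<Sum>m=1..<M0. inv_pow s (real m + real a / real q))) \<le> (\<Sum>a=1..q. 1 * X)"
        by (rule order_trans[OF norm_sum], rule sum_mono, subst norm_mult, rule mult_mono)
          (use norm_dirichlet_character_le_1[OF \<chi>] X q in auto)
      then have "norm (inv_pow s (real q)) * norm (\<Sum>a=1..q. \<chi> a * (\<Sum>m=1..<M0. inv_pow s (real m + real a / real q)))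
          \<le> 1 / real q * (real q * X)"
        using norm_inv_pow_nat_le[OF q s1(1)] by (intro mult_mono) auto
      then show ?thesis using q M0 by (subst sum_residue_blocks[OF \<chi>]) (auto simp: norm_mult)
    qed
    have 3: "norm (\<Sum>n\<in>{q * M0<..q * M'}. ?F n) \<le> (if principal q \<chi> then 2 / norm (s - 1) else 0) + 2 * (1 + norm s) / real M0"
      by (rule character_tail_bound[OF \<chi> M' M0 s1(1,2)])
    have "norm (x + y + z) \<le> norm x + norm y + norm z" for x y z :: complex
      using norm_triangle_ineq[of "x + y" z] norm_triangle_ineq[of x y] by linarith
    then have "norm (\<Sum>n<q * M'. ?F (Suc n)) \<le> norm (\<Sum>n\<in>{0<..q}. ?F n) + norm (\<Sum>n\<in>{q * 1<..q * M0}. ?F n) + norm (\<Sum>n\<in>{q * M0<..q * M'}. ?F n)"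
      unfolding eq .
    then show ?thesis using 1 2 3 by linarith
  qed
  have "summable (\<lambda>n. ?F (Suc n))"
    by (rule summable_inv_pow[OF \<sigma>]) (use norm_character_inv_pow_le[OF \<chi>, of _ s] s1(3) in simp)
  then have "(\<lambda>N. \<Sum>n<N. ?F (Suc n)) \<longlonglongrightarrow> (\<Sum>n. ?F (Suc n))" by (rule summable_LIMSEQ)
  \<comment> \<open>The partial sums were bounded only at multiples of q; convergence of the series
    passes the bound to the limit.\<close>
  moreover have "strict_mono (\<lambda>M. q * M)" using q by (auto simp: strict_mono_def)
  ultimately have "((\<lambda>N. \<Sum>n<N. ?F (Suc n)) \<circ> (\<lambda>M. q * M)) \<longlonglongrightarrow> (\<Sum>n. ?F (Suc n))"
    by (rule LIMSEQ_subseq_LIMSEQ)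
  then have "(\<lambda>M. norm (\<Sum>n<q * M. ?F (Suc n))) \<longlonglongrightarrow> norm (\<Sum>n. ?F (Suc n))"
    unfolding o_def by (rule tendsto_norm)
  then show ?thesis by (rule LIMSEQ_le_const2) (use part in blast)
qed

section \<open>Prime sums from Euler products\<close>

lemma powr_neg_diff_bounds:
  fixes \<sigma> :: real
  assumes "\<sigma> > 0" "u > 0"
  shows "\<sigma> * (u + 1) powr (- (1 + \<sigma>)) \<le> u powr (- \<sigma>) - (u + 1) powr (- \<sigma>)"
    "u powr (- \<sigma>) - (u + 1) powr (- \<sigma>) \<le> \<sigma> * u powr (- (1 + \<sigma>))"
proof -
  have "\<exists>z. u < z \<and> z < u + 1 \<and> (u + 1) powr (- \<sigma>) - u powr (- \<sigma>) = (u + 1 - u) * (- \<sigma> * z powr (- \<sigma> - 1))"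
    by (rule MVT2) (use assms in \<open>auto intro!: derivative_eq_intros\<close>)
  then obtain z where z': "u < z" "z < u + 1" "(u + 1) powr (- \<sigma>) - u powr (- \<sigma>) = (u + 1 - u) * (- \<sigma> * z powr (- \<sigma> - 1))"
    by blast
  have "- \<sigma> - 1 = - (1 + \<sigma>)" by simp
  with z' have z: "u < z" "z < u + 1" "u powr (- \<sigma>) - (u + 1) powr (- \<sigma>) = \<sigma> * z powr (- (1 + \<sigma>))"
    by simp_all
  have "(u + 1) powr (- (1 + \<sigma>)) \<le> z powr (- (1 + \<sigma>))" "z powr (- (1 + \<sigma>)) \<le> u powr (- (1 + \<sigma>))"
    using z assms by (auto intro!: powr_mono2')
  then show "\<sigma> * (u + 1) powr (- (1 + \<sigma>)) \<le> u powr (- \<sigma>) - (u + 1) powr (- \<sigma>)"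
    "u powr (- \<sigma>) - (u + 1) powr (- \<sigma>) \<le> \<sigma> * u powr (- (1 + \<sigma>))"
    using z assms by auto
qed

lemma sum_powr_tail_le:
  fixes \<sigma> :: real
  assumes "\<sigma> > 0" "Y > 0" "finite T" "\<And>n. n \<in> T \<Longrightarrow> n > Y"
  shows "(\<Sum>n\<in>T. real n powr (- (1 + \<sigma>))) \<le> real Y powr (- \<sigma>) / \<sigma>"
proof -
  obtain N where N: "T \<subseteq> {Y<..N}" "Y \<le> N"
  proof -
    have "T \<subseteq> {Y<..Max (insert Y T)}" using assms by auto
    moreover have "Y \<le> Max (insert Y T)" using assms by simp
    ultimately show ?thesis using that by blast
  qed
  have "(\<Sum>n\<in>T. real n powr (- (1 + \<sigma>))) \<le> (\<Sum>n\<in>{Y<..N}. real n powr (- (1 + \<sigma>)))"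
    using N by (intro sum_mono2) auto
  also have "\<dots> \<le> (real Y powr (- \<sigma>) - real N powr (- \<sigma>)) / \<sigma>"
    using N(2)
  proof (induction N rule: dec_induct)
    case (step n)
    have "{Y<..Suc n} = insert (Suc n) {Y<..n}" using step by auto
    then have "(\<Sum>n\<in>{Y<..Suc n}. real n powr (- (1 + \<sigma>))) \<le> real (Suc n) powr (- (1 + \<sigma>)) + (real Y powr (- \<sigma>) - real n powr (- \<sigma>)) / \<sigma>"
      using step by simp
    also have "real (Suc n) powr (- (1 + \<sigma>)) \<le> (real n powr (- \<sigma>) - real (Suc n) powr (- \<sigma>)) / \<sigma>"
      using powr_neg_diff_bounds(1)[OF assms(1), of "real n"] step assms by (simp add: field_simps)
    finally show ?case by (simp add: add_divide_distrib[symmetric])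
  qed simp
  also have "\<dots> \<le> real Y powr (- \<sigma>) / \<sigma>" using assms by (intro divide_right_mono) auto
  finally show ?thesis .
qed

lemma zeta_lower_bound:
  fixes \<sigma> :: real
  assumes "\<sigma> > 0"
  shows "(\<Sum>n. real (Suc n) powr (- (1 + \<sigma>))) \<ge> 1 / \<sigma>"
proof -
  have "summable (\<lambda>n. real n powr (- (1 + \<sigma>)))" using assms by (subst summable_real_powr_iff) auto
  then have sm: "summable (\<lambda>n. real (Suc n) powr (- (1 + \<sigma>)))" by (subst summable_Suc_iff)
  have part: "(1 - real (Suc N) powr (- \<sigma>)) / \<sigma> \<le> (\<Sum>n<N. real (Suc n) powr (- (1 + \<sigma>)))" for N
  proof (induction N)
    case (Suc N)
    have "(real (Suc N) powr (- \<sigma>) - real (Suc (Suc N)) powr (- \<sigma>)) / \<sigma> \<le> real (Suc N) powr (- (1 + \<sigma>))"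
      using powr_neg_diff_bounds(2)[OF assms, of "real (Suc N)"] assms by (simp add: field_simps)
    then have "(1 - real (Suc N) powr (- \<sigma>)) / \<sigma> + (real (Suc N) powr (- \<sigma>) - real (Suc (Suc N)) powr (- \<sigma>)) / \<sigma> \<le>
       (\<Sum>n<Suc N. real (Suc n) powr (- (1 + \<sigma>)))" using Suc by simp
    then show ?case by (simp add: add_divide_distrib[symmetric])
  qed simp
  have "(\<lambda>N. real (Suc N) powr (- \<sigma>)) \<longlonglongrightarrow> 0"
    using assms by (intro tendsto_neg_powr filterlim_compose[OF filterlim_real_sequentially filterlim_Suc]) auto
  then have "(\<lambda>N. (1 - real (Suc N) powr (- \<sigma>)) / \<sigma>) \<longlonglongrightarrow> (1 - 0) / \<sigma>"
    using assms by (intro tendsto_intros) auto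
  then have "(1 - 0) / \<sigma> \<le> (\<Sum>n. real (Suc n) powr (- (1 + \<sigma>)))"
    using summable_LIMSEQ[OF sm] by (rule LIMSEQ_le) (use part in blast)
  then show ?thesis by simp
qed

text \<open>The estimate ln |1 + y| \<le> Re y + |y|^2/2 follows from ln w \<le> w - 1 at w = |1 +
  y|^2. It is used for y = -z and for y = z/(1 - z), the latter belonging to the reciprocal of 1 -
  z.\<close>

lemma log_euler_factor:
  fixes z :: complex
  assumes "norm z \<le> 1 / 2"
  shows "\<bar>ln (norm (1 - z)) + Re z\<bar> \<le> 4 * norm z ^ 2"
proof -
  have up: "ln (norm (1 + y)) \<le> Re y + norm y ^ 2 / 2" if "1 + y \<noteq> 0" for y :: complex
  proof -
    have sq: "norm (1 + y) ^ 2 = 1 + (2 * Re y + norm y ^ 2)"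
      unfolding cmod_power2 by (simp add: power2_eq_square algebra_simps)
    have "2 * ln (norm (1 + y)) = ln (norm (1 + y) ^ 2)" using that by (simp add: ln_realpow)
    also have "\<dots> \<le> norm (1 + y) ^ 2 - 1" using that by (intro ln_le_minus_one) auto
    finally show ?thesis unfolding sq by simp
  qed
  have nz: "1 - z \<noteq> 0" using assms by auto
  have n1: "norm (1 - z) \<ge> 1 / 2" using norm_triangle_ineq2[of 1 z] assms by simp
  have "ln (norm (1 - z)) \<le> - Re z + norm z ^ 2 / 2" using up[of "- z"] nz by simp
  moreover have "- ln (norm (1 - z)) \<le> Re z + 4 * norm z ^ 2"
  proof -
    define y where "y = z / (1 - z)"
    have inv: "1 + y = 1 / (1 - z)" using nz by (simp add: y_def field_simps)
    then have "- ln (norm (1 - z)) = ln (norm (1 + y))" using nz by (simp add: norm_divide ln_div)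
    also have "\<dots> \<le> Re y + norm y ^ 2 / 2" by (rule up) (use inv nz in auto)
    also have "y = z + z ^ 2 / (1 - z)" using nz by (simp add: y_def field_simps power2_eq_square)
    then have "Re y \<le> Re z + norm (z ^ 2 / (1 - z))" using complex_Re_le_cmod[of "z ^ 2 / (1 - z)"] by simp
    also have "norm (z ^ 2 / (1 - z)) \<le> norm z ^ 2 / (1 / 2)"
      unfolding norm_divide norm_power using n1 by (intro divide_left_mono) auto
    also have "norm y \<le> norm z / (1 / 2)"
      unfolding y_def norm_divide using n1 by (intro divide_left_mono) auto
    then have "norm y ^ 2 \<le> (2 * norm z) ^ 2" by (intro power_mono) auto
    finally show ?thesis by (simp add: power_mult_distrib)
  qed
  ultimately show ?thesis using zero_le_power2[of "norm z"] by linarith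
qed

definition coprime_to :: "nat set \<Rightarrow> nat set" where
  "coprime_to P = {n. n > 0 \<and> (\<forall>p\<in>P. \<not> p dvd n)}"

text \<open>The multiples of p within the sifted set are p times that set, so they contribute F(p)
  times its sum.\<close>

lemma sieve_step:
  fixes F :: "nat \<Rightarrow> complex"
  assumes mult: "\<And>m n. m > 0 \<Longrightarrow> n > 0 \<Longrightarrow> F (m * n) = F m * F n"
    and sm: "F summable_on {0<..}" and p: "prime p" "p \<notin> P" and P: "\<And>p. p \<in> P \<Longrightarrow> prime p"
  shows "infsum F (coprime_to (insert p P)) = (1 - F p) * infsum F (coprime_to P)"
proof -
  have p0: "p > 0" using p by (simp add: prime_gt_0_nat)
  have sub: "coprime_to P \<subseteq> {0<..}" for P by (auto simp: coprime_to_def)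
  have split: "coprime_to P = coprime_to (insert p P) \<union> (\<lambda>m. p * m) ` coprime_to P"
  proof
    show "coprime_to P \<subseteq> coprime_to (insert p P) \<union> (\<lambda>m. p * m) ` coprime_to P"
    proof
      fix n assume n: "n \<in> coprime_to P"
      show "n \<in> coprime_to (insert p P) \<union> (\<lambda>m. p * m) ` coprime_to P"
      proof (cases "p dvd n")
        case True
        then obtain m where m: "n = p * m" by auto
        then have "m \<in> coprime_to P" using n by (auto simp: coprime_to_def)
        then show ?thesis using m by blast
      qed (use n in \<open>auto simp: coprime_to_def\<close>)
    qed
    have "\<not> l dvd p * m" if "l \<in> P" "\<not> l dvd m" for l m
    proof
      assume "l dvd p * m"
      then have "l dvd p" using P[OF that(1)] that(2) by (simp add: prime_dvd_mult_iff)
      then show False using P[OF that(1)] p that(1) primes_dvd_imp_eq by blast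
    qed
    then show "coprime_to (insert p P) \<union> (\<lambda>m. p * m) ` coprime_to P \<subseteq> coprime_to P"
      using p0 by (auto simp: coprime_to_def)
  qed
  have inj: "inj_on (\<lambda>m. p * m) (coprime_to P)" using p0 by (auto simp: inj_on_def)
  have "infsum F (coprime_to P) = infsum F (coprime_to (insert p P)) + infsum F ((\<lambda>m. p * m) ` coprime_to P)"
    by (subst split, rule infsum_Un_disjoint)
      (use p0 in \<open>auto intro!: summable_on_subset_banach[OF sm] simp: coprime_to_def\<close>)
  also have "infsum F ((\<lambda>m. p * m) ` coprime_to P) = infsum (\<lambda>m. F p * F m) (coprime_to P)"
    unfolding infsum_reindex[OF inj] o_def using p0 mult by (intro infsum_cong) (auto simp: coprime_to_def)
  also have "\<dots> = F p * infsum F (coprime_to P)" by (rule infsum_cmult_right')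
  finally have e: "infsum F (coprime_to P) = infsum F (coprime_to (insert p P)) + F p * infsum F (coprime_to P)" .
  have "b + c * a = a \<Longrightarrow> b = (1 - c) * a" for a b c :: complex
    by (simp add: left_diff_distrib eq_diff_eq)
  from this[OF e[symmetric]] show ?thesis .
qed

lemma sieve:
  fixes F :: "nat \<Rightarrow> complex"
  assumes "\<And>m n. m > 0 \<Longrightarrow> n > 0 \<Longrightarrow> F (m * n) = F m * F n" "F summable_on {0<..}"
    and "finite P" "\<And>p. p \<in> P \<Longrightarrow> prime p"
  shows "infsum F (coprime_to P) = (\<Prod>p\<in>P. 1 - F p) * infsum F {0<..}"
  using assms(3,4)
proof (induction P rule: finite_induct)
  case empty
  have "coprime_to {} = {0<..}" by (auto simp: coprime_to_def)
  then show ?case by simp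
next
  case (insert p P)
  then show ?case using sieve_step[OF assms(1,2), of p P] by (simp add: mult.assoc)
qed

text \<open>Sieving out the primes up to Y leaves 1 and integers exceeding Y, whose total is at most
  Y^(-\<sigma>)/\<sigma> \<le> 1/2. So the product of the finitely many factors 1 - F(p) with the
  series has modulus between 1/2 and 3/2. The constant 9 is 1 for the logarithm of that modulus plus
  8 for replacing ln |1 - F(p)| by -Re F(p).\<close>

theorem log_euler_product:
  fixes F :: "nat \<Rightarrow> complex" and \<sigma> :: real
  assumes \<sigma>: "\<sigma> > 0" and one: "F 1 = 1" and mult: "\<And>m n. m > 0 \<Longrightarrow> n > 0 \<Longrightarrow> F (m * n) = F m * F n"
    and bound: "\<And>n. n > 0 \<Longrightarrow> norm (F n) \<le> real n powr (- (1 + \<sigma>))"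
    and Y: "Y > 0" "real Y powr (- \<sigma>) / \<sigma> \<le> 1 / 2"
  shows "(\<Sum>n. F (Suc n)) \<noteq> 0"
    "\<bar>ln (norm (\<Sum>n. F (Suc n))) - (\<Sum>p | prime p \<and> p \<le> Y. Re (F p))\<bar> \<le> 9"
proof -
  let ?P = "{p. prime p \<and> p \<le> Y}"
  let ?Z = "\<Sum>n. F (Suc n)"
  have finP: "finite ?P" by simp
  have abs: "(\<lambda>n. norm (F n)) summable_on {0<..}"
  proof (rule nonneg_bdd_above_summable_on)
    show "bdd_above (sum (\<lambda>n. norm (F n)) ` {T. T \<subseteq> {0<..} \<and> finite T})"
    proof (rule bdd_aboveI2)
      fix T :: "nat set" assume T: "T \<in> {T. T \<subseteq> {0<..} \<and> finite T}"
      have "(\<Sum>n\<in>T. norm (F n)) \<le> (\<Sum>n\<in>insert 1 T. norm (F n))" using T by (intro sum_mono2) auto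
      also have "\<dots> = norm (F 1) + (\<Sum>n\<in>T - {1}. norm (F n))" using T by (subst sum.insert_remove) auto
      also have "(\<Sum>n\<in>T - {1}. norm (F n)) \<le> (\<Sum>n\<in>T - {1}. real n powr (- (1 + \<sigma>)))"
        using T by (intro sum_mono bound) auto
      also have "\<dots> \<le> real 1 powr (- \<sigma>) / \<sigma>"
        by (rule sum_powr_tail_le[OF \<sigma>]) (use T in \<open>auto simp: greaterThan_def subset_iff\<close>)
      finally show "(\<Sum>n\<in>T. norm (F n)) \<le> norm (F 1) + real 1 powr (- \<sigma>) / \<sigma>" by simp
    qed
  qed auto
  then have sm: "F summable_on {0<..}" by (rule abs_summable_summable)
  have Z: "infsum F {0<..} = ?Z"
  proof -
    have "(F has_sum infsum F {0<..}) {0<..}" using sm by simp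
    then have "((\<lambda>n. F (Suc n)) has_sum infsum F {0<..}) UNIV"
      using has_sum_reindex[of Suc UNIV F "infsum F {0<..}"] by (simp add: o_def lessThan_Suc_eq_insert_0 greaterThan_0)
    then show ?thesis using has_sum_imp_sums sums_unique by blast
  qed
  have sv: "infsum F (coprime_to ?P) = (\<Prod>p\<in>?P. 1 - F p) * ?Z"
    unfolding Z[symmetric] by (rule sieve[OF mult sm]) auto
  have near: "norm (infsum F (coprime_to ?P) - 1) \<le> 1 / 2"
  proof -
    have split: "coprime_to ?P = {1} \<union> (coprime_to ?P - {1})"
      by (auto simp: coprime_to_def dest: prime_gt_1_nat)
    have smd: "F summable_on (coprime_to ?P - {1})"
      by (rule summable_on_subset_banach[OF sm]) (auto simp: coprime_to_def)
    have "infsum F (coprime_to ?P) = infsum F {1} + infsum F (coprime_to ?P - {1})"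
      by (subst split, rule infsum_Un_disjoint) (use smd in auto)
    then have "norm (infsum F (coprime_to ?P) - 1) = norm (infsum F (coprime_to ?P - {1}))" using one by simp
    also have "\<dots> \<le> infsum (\<lambda>n. norm (F n)) (coprime_to ?P - {1})"
      by (rule norm_infsum_bound) (rule summable_on_subset_banach[OF abs], auto simp: coprime_to_def)
    also have "\<dots> \<le> 1 / 2"
    proof (rule infsum_le_finite_sums)
      show "(\<lambda>n. norm (F n)) summable_on (coprime_to ?P - {1})"
        by (rule summable_on_subset_banach[OF abs]) (auto simp: coprime_to_def)
      fix T assume T: "finite T" "T \<subseteq> coprime_to ?P - {1}"
      have big: "n > Y" "n > 0" if "n \<in> T" for n
      proof -
        have n: "n > 0" "n \<noteq> 1" "\<And>p. prime p \<Longrightarrow> p \<le> Y \<Longrightarrow> \<not> p dvd n" using that T by (auto simp: coprime_to_def)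
        obtain p where p: "prime p" "p dvd n" using prime_factor_nat[OF n(2)] by blast
        then have "p \<le> n" using n by (intro dvd_imp_le) auto
        then show "n > Y" using n(3)[OF p(1)] p(2) by (meson not_le order_trans)
        show "n > 0" by (rule n)
      qed
      have "(\<Sum>n\<in>T. norm (F n)) \<le> (\<Sum>n\<in>T. real n powr (- (1 + \<sigma>)))" using big by (intro sum_mono bound) auto
      also have "\<dots> \<le> real Y powr (- \<sigma>) / \<sigma>" by (rule sum_powr_tail_le[OF \<sigma> Y(1) T(1)]) (use big in auto)
      finally show "(\<Sum>n\<in>T. norm (F n)) \<le> 1 / 2" using Y by linarith
    qed
    finally show ?thesis .
  qed
  have W: "1 / 2 \<le> norm (infsum F (coprime_to ?P))" "norm (infsum F (coprime_to ?P)) \<le> 3 / 2"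
    using norm_triangle_ineq2[of 1 "infsum F (coprime_to ?P)"] norm_triangle_ineq2[of "infsum F (coprime_to ?P)" 1] near
    by (simp_all add: norm_minus_commute)
  then have "infsum F (coprime_to ?P) \<noteq> 0" by auto
  then have nz: "(\<Prod>p\<in>?P. 1 - F p) * ?Z \<noteq> 0" unfolding sv .
  then show "?Z \<noteq> 0" by simp
  have fac: "1 - F p \<noteq> 0" if "p \<in> ?P" for p using nz finP that by (auto simp: prod_zero_iff)
  have "ln (norm (infsum F (coprime_to ?P))) = (\<Sum>p\<in>?P. ln (norm (1 - F p))) + ln (norm ?Z)"
  proof -
    have "ln (norm (infsum F (coprime_to ?P))) = ln (\<Prod>p\<in>?P. norm (1 - F p)) + ln (norm ?Z)"
      unfolding sv norm_mult prod_norm[symmetric] using fac \<open>?Z \<noteq> 0\<close> by (intro ln_mult_pos prod_pos) auto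
    also have "ln (\<Prod>p\<in>?P. norm (1 - F p)) = (\<Sum>p\<in>?P. ln (norm (1 - F p)))"
      by (rule ln_prod) (use fac finP in auto)
    finally show ?thesis .
  qed
  moreover have "\<bar>ln (norm (infsum F (coprime_to ?P)))\<bar> \<le> 1"
  proof -
    have "ln (norm (infsum F (coprime_to ?P))) \<le> 3 / 2 - 1" using W
      by (intro order_trans[OF ln_le_minus_one]) auto
    moreover have "ln (1 / 2) \<le> ln (norm (infsum F (coprime_to ?P)))" using W by (intro ln_mono) auto
    moreover have "ln (1 / 2) \<ge> - (1::real)" using ln_le_minus_one[of 2] by (simp add: ln_div)
    ultimately show ?thesis by linarith
  qed
  moreover have "\<bar>\<Sum>p\<in>?P. ln (norm (1 - F p)) + Re (F p)\<bar> \<le> 8"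
  proof -
    have "\<bar>\<Sum>p\<in>?P. ln (norm (1 - F p)) + Re (F p)\<bar> \<le> (\<Sum>p\<in>?P. 4 * (1 / real p ^ 2))"
    proof (rule order_trans[OF sum_abs], rule sum_mono)
      fix p assume p: "p \<in> ?P"
      then have p2: "real p \<ge> 2" using prime_ge_2_nat[of p] by simp
      have "norm (F p) \<le> real p powr (- (1 + \<sigma>))" using p2 by (intro bound) auto
      also have "\<dots> \<le> real p powr (- 1)" using p2 \<sigma> by (intro powr_mono) auto
      also have "\<dots> = 1 / real p" using p2 by (simp add: powr_minus_divide)
      finally have Fp: "norm (F p) \<le> 1 / real p" .
      also have "1 / real p \<le> 1 / 2" using p2 by simp
      finally have "norm (F p) \<le> 1 / 2" .
      then have "\<bar>ln (norm (1 - F p)) + Re (F p)\<bar> \<le> 4 * norm (F p) ^ 2" by (rule log_euler_factor)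
      also have "\<dots> \<le> 4 * (1 / real p) ^ 2" using Fp by (intro mult_left_mono power_mono) auto
      finally show "\<bar>ln (norm (1 - F p)) + Re (F p)\<bar> \<le> 4 * (1 / real p ^ 2)" by (simp add: power_divide)
    qed
    also have "\<dots> \<le> (\<Sum>n=1..<Y + 1. 4 * (1 / real n ^ 2))"
      by (intro sum_mono2) (auto dest: prime_gt_0_nat)
    also have "\<dots> = 4 * (\<Sum>n=1..<Y + 1. 1 / real n ^ 2)" by (simp only: sum_distrib_left)
    also have "\<dots> \<le> 4 * (2 / real 1)" by (intro mult_left_mono sum_inverse_squares_le) auto
    finally show ?thesis by simp
  qed
  ultimately show "\<bar>ln (norm ?Z) - (\<Sum>p\<in>?P. Re (F p))\<bar> \<le> 9"
    unfolding sum.distrib by linarith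
qed

section \<open>The distance of a twisted character to 1\<close>

lemma nat_powr_imaginary:
  assumes "n > 0"
  shows "of_nat n powr (\<i> * of_real t) = cis (t * ln (real n))"
proof -
  have "ln (of_nat n :: complex) = of_real (ln (real n))"
    using assms Ln_of_real[of "real n"] by simp
  then show ?thesis using assms by (simp add: powr_def cis_conv_exp mult_ac)
qed

definition L_series :: "(nat \<Rightarrow> complex) \<Rightarrow> complex \<Rightarrow> complex" where
  "L_series \<chi> s = (\<Sum>n. \<chi> (Suc n) * inv_pow s (real (Suc n)))"

text \<open>For x = ln X and \<sigma> \<ge> x^(-79/80) the product \<sigma> x is at least x^(1/80),
  so X^(-\<sigma>) beats 1/\<sigma>: the primes up to X then determine the size of an L-series at 1
  + \<sigma> up to a bounded factor.\<close>

lemma sieve_length: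
  "\<exists>x0\<ge>1. \<forall>X \<sigma>. ln X \<ge> x0 \<and> X > 0 \<and> \<sigma> \<le> 1 \<and> \<sigma> \<ge> ln X powr (- 79 / 80) \<longrightarrow>
     nat \<lfloor>X\<rfloor> > 0 \<and> real (nat \<lfloor>X\<rfloor>) powr (- \<sigma>) / \<sigma> \<le> 1 / 2"
proof -
  have "eventually (\<lambda>x::real. x powr (79 / 80) * exp (- (x powr (- 79 / 80) * (x - 1))) \<le> 1 / 2) at_top"
    by real_asymp
  then obtain x0 where x0: "\<And>x::real. x \<ge> x0 \<Longrightarrow> x powr (79 / 80) * exp (- (x powr (- 79 / 80) * (x - 1))) \<le> 1 / 2"
    by (auto simp: eventually_at_top_linorder)
  show ?thesis
  proof (rule exI[of _ "max 1 x0"], rule conjI, simp, intro allI impI, elim conjE)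
    fix X \<sigma> :: real assume X: "max 1 x0 \<le> ln X" "X > 0" and \<sigma>: "\<sigma> \<ge> ln X powr (- 79 / 80)"
    let ?Y = "nat \<lfloor>X\<rfloor>"
    have X2: "X \<ge> 2"
    proof -
      have "2 \<le> exp (1::real)" using exp_ge_add_one_self[of 1] by simp
      also have "\<dots> \<le> exp (ln X)" unfolding exp_le_cancel_iff using X by simp
      finally show ?thesis using X by simp
    qed
    have \<sigma>0: "\<sigma> > 0" using \<sigma> X by (intro less_le_trans[OF _ \<sigma>]) auto
    have Y: "real ?Y \<ge> X / 2" using X2 by linarith
    have "real ?Y \<ge> exp (ln X - 1)"
    proof -
      have "2 \<le> exp (1::real)" using exp_ge_add_one_self[of 1] by simp
      then have "X / exp 1 \<le> X / 2" using X2 by (intro divide_left_mono) auto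
      moreover have "exp (ln X - 1) = X / exp 1" using X by (simp add: exp_diff)
      ultimately show ?thesis using Y by linarith
    qed
    then have "real ?Y powr (- \<sigma>) \<le> exp (ln X - 1) powr (- \<sigma>)" using \<sigma>0 by (intro powr_mono2') auto
    also have "\<dots> = exp (- (\<sigma> * (ln X - 1)))" by (simp add: powr_def)
    also have "\<dots> \<le> exp (- (ln X powr (- 79 / 80) * (ln X - 1)))"
      using \<sigma> X mult_right_mono[OF \<sigma>, of "ln X - 1"] by simp
    finally have "real ?Y powr (- \<sigma>) / \<sigma> \<le> exp (- (ln X powr (- 79 / 80) * (ln X - 1))) / (ln X powr (- 79 / 80))"
      using \<sigma> \<sigma>0 X by (intro frac_le) auto
    also have "\<dots> = ln X powr (79 / 80) * exp (- (ln X powr (- 79 / 80) * (ln X - 1)))"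
      using X by (simp add: powr_minus field_simps)
    also have "\<dots> \<le> 1 / 2" using X by (intro x0) simp
    finally have "real ?Y powr (- \<sigma>) / \<sigma> \<le> 1 / 2" .
    moreover have "?Y > 0" using X2 by linarith
    ultimately show "?Y > 0 \<and> real ?Y powr (- \<sigma>) / \<sigma> \<le> 1 / 2" by blast
  qed
qed

text \<open>The Euler product estimate for n^(-1 - \<sigma>), combined with \<zeta>(1 + \<sigma>)
  \<ge> 1/\<sigma>.\<close>

lemma sum_primes_powr_ge:
  fixes \<sigma> :: real
  assumes \<sigma>: "\<sigma> > 0" and Y: "Y > 0" "real Y powr (- \<sigma>) / \<sigma> \<le> 1 / 2"
  shows "(\<Sum>p | prime p \<and> p \<le> Y. real p powr (- (1 + \<sigma>))) \<ge> ln (1 / \<sigma>) - 9"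
proof -
  define F where "F n = complex_of_real (real n powr (- (1 + \<sigma>)))" for n
  have sm: "summable (\<lambda>n. real (Suc n) powr (- (1 + \<sigma>)))"
  proof -
    have "summable (\<lambda>n. real n powr (- (1 + \<sigma>)))" using \<sigma> by (subst summable_real_powr_iff) auto
    then show ?thesis by (subst summable_Suc_iff)
  qed
  have Z: "(\<Sum>n. F (Suc n)) = of_real (\<Sum>n. real (Suc n) powr (- (1 + \<sigma>)))"
    unfolding F_def by (rule suminf_of_real[OF sm, symmetric])
  have "\<bar>ln (norm (\<Sum>n. F (Suc n))) - (\<Sum>p | prime p \<and> p \<le> Y. Re (F p))\<bar> \<le> 9"
    by (rule log_euler_product[OF \<sigma> _ _ _ Y]) (auto simp: F_def powr_mult)
  moreover have "ln (norm (\<Sum>n. F (Suc n))) \<ge> ln (1 / \<sigma>)"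
  proof -
    have pos: "0 < 1 / \<sigma>" using \<sigma> by simp
    then have "1 / \<sigma> \<le> norm (\<Sum>n. F (Suc n))" unfolding Z norm_of_real using zeta_lower_bound[OF \<sigma>] by linarith
    then show ?thesis using pos by (rule ln_mono)
  qed
  ultimately show ?thesis by (simp add: F_def)
qed

text \<open>The argument is 1 + \<sigma> - i\<tau>, so that the coefficient at p carries
  p^(i\<tau>), matching the twist in the distance.\<close>

lemma log_L_series:
  fixes \<sigma> :: real
  assumes \<chi>: "dirichlet_character q \<chi>" and \<sigma>: "\<sigma> > 0" and Y: "Y > 0" "real Y powr (- \<sigma>) / \<sigma> \<le> 1 / 2"
  shows "L_series \<chi> (Complex (1 + \<sigma>) (- \<tau>)) \<noteq> 0"
    "\<bar>ln (norm (L_series \<chi> (Complex (1 + \<sigma>) (- \<tau>)))) -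
       (\<Sum>p | prime p \<and> p \<le> Y. real p powr (- (1 + \<sigma>)) * Re (\<chi> p * of_nat p powr (\<i> * of_real \<tau>)))\<bar> \<le> 9"
proof -
  define F where "F n = \<chi> n * inv_pow (Complex (1 + \<sigma>) (- \<tau>)) (real n)" for n
  have mult: "\<chi> (m * n) = \<chi> m * \<chi> n" for m n using \<chi> by (simp add: dirichlet_character_def)
  have "F 1 = 1" using dirichlet_character_one[OF \<chi>] inv_pow_one by (simp add: F_def)
  moreover have "F (m * n) = F m * F n" if "m > 0" "n > 0" for m n
    using that inv_pow_mult[of "real m" "real n"] by (simp add: F_def mult)
  moreover have "norm (F n) \<le> real n powr (- (1 + \<sigma>))" if "n > 0" for n
    using norm_character_inv_pow_le[OF \<chi> that, of "Complex (1 + \<sigma>) (- \<tau>)"] by (simp add: F_def)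
  ultimately have E: "(\<Sum>n. F (Suc n)) \<noteq> 0"
    "\<bar>ln (norm (\<Sum>n. F (Suc n))) - (\<Sum>p | prime p \<and> p \<le> Y. Re (F p))\<bar> \<le> 9"
    using log_euler_product[OF \<sigma> _ _ _ Y, of F] by blast+
  have "Re (F p) = real p powr (- (1 + \<sigma>)) * Re (\<chi> p * of_nat p powr (\<i> * of_real \<tau>))" if "prime p" for p
  proof -
    have p: "p > 0" using that by (simp add: prime_gt_0_nat)
    have "F p = of_real (real p powr (- (1 + \<sigma>))) * (\<chi> p * cis (\<tau> * ln (real p)))"
      using p by (subst F_def, subst inv_pow_eq) auto
    then show ?thesis unfolding nat_powr_imaginary[OF p] by (simp only: times_complex.sel Re_complex_of_real Im_complex_of_real)
  qed
  then have "(\<Sum>p | prime p \<and> p \<le> Y. Re (F p)) =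
     (\<Sum>p | prime p \<and> p \<le> Y. real p powr (- (1 + \<sigma>)) * Re (\<chi> p * of_nat p powr (\<i> * of_real \<tau>)))"
    by (intro sum.cong) auto
  then show "L_series \<chi> (Complex (1 + \<sigma>) (- \<tau>)) \<noteq> 0"
    "\<bar>ln (norm (L_series \<chi> (Complex (1 + \<sigma>) (- \<tau>)))) -
       (\<Sum>p | prime p \<and> p \<le> Y. real p powr (- (1 + \<sigma>)) * Re (\<chi> p * of_nat p powr (\<i> * of_real \<tau>)))\<bar> \<le> 9"
    using E by (simp_all add: L_series_def F_def)
qed

lemma prime_set_real: "X \<ge> 0 \<Longrightarrow> {p::nat. prime p \<and> real p \<le> X} = {p. prime p \<and> p \<le> nat \<lfloor>X\<rfloor>}"
  by (auto simp: le_nat_floor) (metis le_floor_iff nat_le_iff of_int_of_nat_eq of_nat_le_iff order_trans of_nat_floor)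

lemma norm_character_twist_le:
  assumes "dirichlet_character q \<chi>" "prime p"
  shows "norm (\<chi> p * of_nat p powr (\<i> * of_real \<tau>)) \<le> 1"
  using norm_dirichlet_character_le_1[OF assms(1), of p] prime_gt_0_nat[OF assms(2)]
  by (simp add: nat_powr_imaginary norm_mult)

text \<open>Each factor 1 + e Re(...) is nonnegative, so the weights p^(-1 - \<sigma>) may be
  enlarged to 1/p. The sign e = -1 measures the distance of the twist to 1, and e = 1 that to -1,
  the value of \<lambda> at primes.\<close>

lemma weighted_distance_le:
  fixes \<sigma> :: real
  assumes \<chi>: "dirichlet_character q \<chi>" and \<sigma>: "\<sigma> > 0" and X: "X \<ge> 0" and e: "\<bar>e\<bar> = 1"
  shows "(\<Sum>p | prime p \<and> p \<le> nat \<lfloor>X\<rfloor>. real p powr (- (1 + \<sigma>))) +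
      e * (\<Sum>p | prime p \<and> p \<le> nat \<lfloor>X\<rfloor>. real p powr (- (1 + \<sigma>)) * Re (\<chi> p * of_nat p powr (\<i> * of_real \<tau>))) \<le>
    (\<Sum>p | prime p \<and> real p \<le> X. 1 / real p * (1 + e * Re (\<chi> p * of_nat p powr (\<i> * of_real \<tau>))))"
proof -
  have "(\<Sum>p | prime p \<and> p \<le> nat \<lfloor>X\<rfloor>. real p powr (- (1 + \<sigma>))) +
      e * (\<Sum>p | prime p \<and> p \<le> nat \<lfloor>X\<rfloor>. real p powr (- (1 + \<sigma>)) * Re (\<chi> p * of_nat p powr (\<i> * of_real \<tau>))) =
    (\<Sum>p | prime p \<and> p \<le> nat \<lfloor>X\<rfloor>. real p powr (- (1 + \<sigma>)) * (1 + e * Re (\<chi> p * of_nat p powr (\<i> * of_real \<tau>))))"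
    unfolding sum_distrib_left sum.distrib[symmetric] by (intro sum.cong refl) (simp add: algebra_simps)
  also have "\<dots> \<le> (\<Sum>p | prime p \<and> p \<le> nat \<lfloor>X\<rfloor>. 1 / real p * (1 + e * Re (\<chi> p * of_nat p powr (\<i> * of_real \<tau>))))"
  proof (intro sum_mono mult_right_mono)
    fix p assume "p \<in> {p. prime p \<and> p \<le> nat \<lfloor>X\<rfloor>}"
    then have p: "prime p" "real p \<ge> 1" using prime_ge_1_nat[of p] by auto
    have "real p powr (- (1 + \<sigma>)) \<le> real p powr (- 1)" using p \<sigma> by (intro powr_mono) auto
    then show "real p powr (- (1 + \<sigma>)) \<le> 1 / real p" using p by (simp add: powr_minus_divide)
    have "\<bar>e * Re (\<chi> p * of_nat p powr (\<i> * of_real \<tau>))\<bar> \<le> 1"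
      unfolding abs_mult e using abs_Re_le_cmod[of "\<chi> p * of_nat p powr (\<i> * of_real \<tau>)"] norm_character_twist_le[OF \<chi> p(1), of \<tau>] by linarith
    then show "0 \<le> 1 + e * Re (\<chi> p * of_nat p powr (\<i> * of_real \<tau>))" by linarith
  qed
  finally show ?thesis unfolding prime_set_real[OF X] .
qed

text \<open>Pretending to be \<open>1\<close> on most primes up to \<open>X\<close> would make the \<open>L\<close>-series at
  \<open>1 + \<sigma> - i\<tau>\<close> almost as large as \<open>1/\<sigma>\<close>, where \<open>\<sigma> = (ln X)\<^sup>-\<^sup>7\<^sup>9\<^sup>/\<^sup>8\<^sup>0\<close>.\<close>
theorem distance_to_one_ge:
  fixes A :: real
  assumes A: "A > 0"
  shows "\<exists>x0. \<forall>X q \<chi> \<tau>. ln X \<ge> x0 \<and> X > 0 \<and> real q \<le> ln X powr A \<and> dirichlet_character q \<chi> \<and> \<bar>\<tau>\<bar> \<le> X powr A \<and>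
     (principal q \<chi> \<longrightarrow> \<bar>\<tau>\<bar> \<ge> ln X powr (- 39 / 40)) \<longrightarrow>
     (\<Sum>p | prime p \<and> real p \<le> X. 1 / real p * (1 - Re (\<chi> p * of_nat p powr (\<i> * of_real \<tau>)))) \<ge> ln (ln X) / 100"
proof -
  obtain x1 where x1: "x1 \<ge> 1" "\<And>X \<sigma>. ln X \<ge> x1 \<and> X > 0 \<and> \<sigma> \<le> 1 \<and> \<sigma> \<ge> ln X powr (- 79 / 80) \<Longrightarrow>
     nat \<lfloor>X\<rfloor> > 0 \<and> real (nat \<lfloor>X\<rfloor>) powr (- \<sigma>) / \<sigma> \<le> 1 / 2"
    using sieve_length by blast
  obtain c x2 where x2: "\<And>x \<tau> \<beta> \<sigma>. x \<ge> x2 \<Longrightarrow> \<bar>\<tau>\<bar> \<le> exp (A * x) \<Longrightarrow> 0 \<le> \<beta> \<Longrightarrow> \<beta> \<le> 1 \<Longrightarrow> 0 \<le> \<sigma> \<Longrightarrow> \<sigma> \<le> 1 \<Longrightarrow>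
     norm (\<Sum>m=1..<nat \<lfloor>\<bar>\<tau>\<bar>\<rfloor> + 1. inv_pow (Complex (1 + \<sigma>) (- \<tau>)) (real m + \<beta>)) \<le> c * x powr (39 / 40)"
    using zeta_sum_bound[OF A] by blast
  \<comment> \<open>The 11 is 1 from the harmonic sum, 2 from a possible pole and 8 from the tail;
    ln q is at most 40 A x^(39/40).\<close>
  define c' where "c' = 11 + 40 * A + \<bar>c\<bar>"
  have c': "c' \<ge> 1" using A by (simp add: c'_def)
  \<comment> \<open>The gain of \<Sum>p^(-1 - \<sigma>) over ln |L| is 79/80 - 39/40 = 1/80, and 18
    collects the errors 9 of the two Euler products.\<close>
  have "eventually (\<lambda>x::real. ln x / 80 - ln c' - 18 \<ge> ln x / 100) at_top" by real_asymp
  then obtain x3 where x3: "\<And>x::real. x \<ge> x3 \<Longrightarrow> ln x / 80 - ln c' - 18 \<ge> ln x / 100"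
    by (auto simp: eventually_at_top_linorder)
  show ?thesis
  proof (rule exI[of _ "max x1 (max x2 x3)"], intro allI impI, elim conjE)
    fix X \<tau> q \<chi>
    assume lX: "max x1 (max x2 x3) \<le> ln X" and X: "0 < X" and qA: "real q \<le> ln X powr A"
      and \<chi>: "dirichlet_character q \<chi>" and \<tau>: "\<bar>\<tau>\<bar> \<le> X powr A"
      and pr: "principal q \<chi> \<longrightarrow> ln X powr (- 39 / 40) \<le> \<bar>\<tau>\<bar>"
    define x where "x = ln X"
    have x: "x \<ge> 1" "x \<ge> x1" "x \<ge> x2" "x \<ge> x3" using lX x1(1) by (auto simp: x_def)
    have q: "q > 0" using \<chi> by (simp add: dirichlet_character_def)
    define \<sigma> where "\<sigma> = x powr (- 79 / 80)"
    have \<sigma>: "\<sigma> > 0" "\<sigma> \<le> 1"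
    proof -
      show "\<sigma> > 0" using x by (simp add: \<sigma>_def)
      have "x powr (- 79 / 80) \<le> x powr 0" using x by (intro powr_mono) auto
      then show "\<sigma> \<le> 1" using x by (simp add: \<sigma>_def)
    qed
    have Y: "nat \<lfloor>X\<rfloor> > 0" "real (nat \<lfloor>X\<rfloor>) powr (- \<sigma>) / \<sigma> \<le> 1 / 2"
      using x1(2)[of X \<sigma>] x X \<sigma> by (auto simp: x_def \<sigma>_def)
    define s where "s = Complex (1 + \<sigma>) (- \<tau>)"
    let ?M = "nat \<lfloor>\<bar>\<tau>\<bar>\<rfloor> + 1"
    let ?w = "x powr (39 / 40)"
    have w: "?w \<ge> 1" using x by (intro ge_one_powr_ge_zero) auto
    have "norm (L_series \<chi> s) \<le> 1 + ln (real q) + c * ?w + ((if principal q \<chi> then 2 / norm (s - 1) else 0) + 2 * (1 + norm s) / real ?M)"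
      unfolding L_series_def
    proof (rule norm_L_series_le[OF \<chi> \<sigma>(1) _ s_def])
      fix \<beta> :: real assume \<beta>: "0 \<le> \<beta>" "\<beta> \<le> 1"
      have "X powr A = exp (A * x)" using X by (simp add: powr_def x_def)
      then show "norm (\<Sum>m=1..<?M. inv_pow s (real m + \<beta>)) \<le> c * ?w"
        unfolding s_def using \<tau> \<beta> \<sigma> x by (intro x2) auto
    qed simp
    also have "\<dots> \<le> 1 + 40 * A * ?w + \<bar>c\<bar> * ?w + (2 * ?w + 8)"
    proof (intro add_mono)
      show "ln (real q) \<le> 40 * A * ?w"
      proof -
        have "ln (real q) \<le> ln (x powr A)" using qA q by (intro ln_mono) (auto simp: x_def)
        also have "\<dots> = A * ln x" using x by (simp add: ln_powr)
        also have "ln x \<le> 40 * ?w"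
        proof -
          have "ln (x powr (39 / 40)) \<le> ?w - 1" using x by (intro ln_le_minus_one) auto
          then have "39 / 40 * ln x \<le> ?w - 1" using x by (simp add: ln_powr)
          then show ?thesis using w by linarith
        qed
        finally show ?thesis using A by (simp add: mult_left_mono mult_ac)
      qed
      show "c * ?w \<le> \<bar>c\<bar> * ?w" by (intro mult_right_mono) auto
      \<comment> \<open>The assumed lower bound on |\<tau>| keeps the contribution of the pole
        within 2 x^(39/40).\<close>
      show "(if principal q \<chi> then 2 / norm (s - 1) else 0) \<le> 2 * ?w"
      proof (cases "principal q \<chi>")
        case True
        have "x powr (- 39 / 40) \<le> norm (s - 1)"
          using pr True abs_Im_le_cmod[of "s - 1"] by (simp add: s_def x_def)
        then have "2 / norm (s - 1) \<le> 2 / x powr (- 39 / 40)" using x by (intro divide_left_mono) (auto intro!: mult_pos_pos elim: less_le_trans[rotated])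
        also have "\<dots> = 2 * ?w" using x by (simp add: powr_minus field_simps)
        finally show ?thesis using True by simp
      qed (use w in simp)
      show "2 * (1 + norm s) / real ?M \<le> 8"
      proof -
        have "norm s \<le> (1 + \<sigma>) + \<bar>\<tau>\<bar>" using cmod_le[of s] \<sigma> by (simp add: s_def)
        moreover have M: "\<bar>\<tau>\<bar> \<le> real ?M" "1 \<le> real ?M" by linarith+
        moreover have "2 * (1 + a) \<le> 8 * r" if "a \<le> 1 + \<sigma> + t" "t \<le> r" "1 \<le> r" for a t r :: real
          using that \<sigma>(2) by (simp add: algebra_simps)
        ultimately have "2 * (1 + norm s) \<le> 8 * real ?M" by blast
        then show ?thesis using M by (simp only: pos_divide_le_eq)
      qed
    qed auto
    also have "\<dots> \<le> c' * ?w"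
    proof -
      have "c' * ?w = 11 * ?w + 40 * A * ?w + \<bar>c\<bar> * ?w" by (simp add: c'_def algebra_simps)
      then show ?thesis using w by linarith
    qed
    finally have Zle: "norm (L_series \<chi> s) \<le> c' * ?w" .
    have Z0: "L_series \<chi> s \<noteq> 0" unfolding s_def by (rule log_L_series[OF \<chi> \<sigma>(1) Y])
    have "ln (norm (L_series \<chi> s)) \<le> ln (c' * ?w)" using Zle Z0 by (intro ln_mono) auto
    also have "\<dots> = ln c' + 39 / 40 * ln x" using c' x by (simp add: ln_mult ln_powr)
    finally have lnZ: "ln (norm (L_series \<chi> s)) \<le> ln c' + 39 / 40 * ln x" .
    let ?R = "\<Sum>p | prime p \<and> p \<le> nat \<lfloor>X\<rfloor>. real p powr (- (1 + \<sigma>)) * Re (\<chi> p * of_nat p powr (\<i> * of_real \<tau>))"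
    have "?R \<le> ln (norm (L_series \<chi> s)) + 9"
      using log_L_series(2)[OF \<chi> \<sigma>(1) Y, of \<tau>] unfolding s_def by linarith
    moreover have "ln (1 / \<sigma>) - 9 \<le> (\<Sum>p | prime p \<and> p \<le> nat \<lfloor>X\<rfloor>. real p powr (- (1 + \<sigma>)))"
      by (rule sum_primes_powr_ge[OF \<sigma>(1) Y])
    moreover have "ln (1 / \<sigma>) = 79 / 80 * ln x" using x by (simp add: \<sigma>_def ln_div ln_powr)
    moreover have "(\<Sum>p | prime p \<and> p \<le> nat \<lfloor>X\<rfloor>. real p powr (- (1 + \<sigma>))) + (- 1) * ?R \<le>
        (\<Sum>p | prime p \<and> real p \<le> X. 1 / real p * (1 + (- 1) * Re (\<chi> p * of_nat p powr (\<i> * of_real \<tau>))))"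
      using X by (intro weighted_distance_le[OF \<chi> \<sigma>(1)]) auto
    moreover have "ln x / 80 - ln c' - 18 \<ge> ln x / 100" using x by (intro x3)
    moreover have "1 + (- 1) * r = 1 - r" for r :: real by simp
    ultimately show "ln (ln X) / 100 \<le> (\<Sum>p | prime p \<and> real p \<le> X. 1 / real p * (1 - Re (\<chi> p * of_nat p powr (\<i> * of_real \<tau>))))"
      using lnZ unfolding x_def by (simp only:)
  qed
qed

section \<open>Real characters\<close>

locale real_character =
  fixes q :: nat and \<chi> :: "nat \<Rightarrow> complex"
  assumes char: "dirichlet_character q \<chi>" and nonprincipal: "\<not> principal q \<chi>"
    and square: "principal q (\<lambda>n. \<chi> n * \<chi> n)"
begin

definition c :: "nat \<Rightarrow> real" where
  "c n = Re (\<chi> n)"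

lemma q_pos: "q > 0"
  using char by (simp add: dirichlet_character_def)

lemma character_values: "\<chi> n = 0 \<or> \<chi> n = 1 \<or> \<chi> n = -1"
proof (cases "coprime n q")
  case True
  then have "\<chi> n * \<chi> n = 1" using square by (simp add: principal_def)
  then have "(\<chi> n - 1) * (\<chi> n + 1) = 0" by (simp add: algebra_simps)
  then show ?thesis by (auto simp: eq_neg_iff_add_eq_0)
next
  case False
  then have "\<chi> n = 0" using char unfolding dirichlet_character_def by blast
  then show ?thesis by simp
qed

lemma of_real_c: "complex_of_real (c n) = \<chi> n"
  using character_values[of n] by (auto simp: c_def)

lemma c_values: "c n = 0 \<or> c n = 1 \<or> c n = -1"
  using character_values[of n] by (auto simp: c_def)

lemma abs_c_le: "\<bar>c n\<bar> \<le> 1"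
  using c_values[of n] by auto

lemma c_mult: "c (m * n) = c m * c n"
proof -
  have "complex_of_real (c (m * n)) = complex_of_real (c m * c n)"
    using char by (simp add: of_real_c dirichlet_character_def)
  then show ?thesis by (simp only: of_real_eq_iff)
qed

lemma c_one: "c 1 = 1"
  using dirichlet_character_one[OF char] by (simp add: c_def)

lemma c_period: "c (n + q) = c n"
  using char by (simp add: c_def dirichlet_character_def)

lemma c_partial_sums: "\<bar>\<Sum>n=1..N. c n\<bar> \<le> real q"
proof -
  have full: "(\<Sum>n=1..q. c n) = 0"
  proof -
    have "complex_of_real (\<Sum>n=1..q. c n) = 0"
      using character_sum_nonprincipal[OF char nonprincipal] by (simp add: of_real_c)
    then show ?thesis by (simp only: of_real_eq_0_iff)
  qed
  have shift: "(\<Sum>n=1..N + q. c n) = (\<Sum>n=1..N. c n)" for N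
  proof (induction N)
    case (Suc N)
    then show ?case using c_period[of "Suc N"] by simp
  qed (use full in simp)
  show ?thesis
  proof (induction N rule: less_induct)
    case (less N)
    show ?case
    proof (cases "N < q")
      case True
      have "\<bar>\<Sum>n=1..N. c n\<bar> \<le> (\<Sum>n=1..N. 1)" by (rule order_trans[OF sum_abs], rule sum_mono, rule abs_c_le)
      then show ?thesis using True by simp
    next
      case False
      then have "\<bar>\<Sum>n=1..N - q. c n\<bar> \<le> real q" using q_pos by (intro less) auto
      then show ?thesis using shift[of "N - q"] False by simp
    qed
  qed
qed

lemma abel_bound:
  fixes b :: "nat \<Rightarrow> real"
  assumes dec: "\<And>n. n \<ge> 1 \<Longrightarrow> b (Suc n) \<le> b n" and nonneg: "\<And>n. n \<ge> 1 \<Longrightarrow> 0 \<le> b n"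
  shows "\<bar>\<Sum>n=1..N. c n * b n\<bar> \<le> real q * b 1"
proof (cases "N = 0")
  case False
  let ?C = "\<lambda>N. \<Sum>n=1..N. c n"
  have abel: "(\<Sum>n=1..N. c n * b n) = ?C N * b N + (\<Sum>n=1..<N. ?C n * (b n - b (Suc n)))" if "N \<ge> 1" for N
    using that by (induction N rule: nat_induct_at_least) (auto simp: algebra_simps)
  have tel: "(\<Sum>n=1..<N. b n - b (Suc n)) = b 1 - b N" if "N \<ge> 1" for N
    using that by (induction N rule: nat_induct_at_least) auto
  have "\<bar>\<Sum>n=1..N. c n * b n\<bar> \<le> \<bar>?C N * b N\<bar> + \<bar>\<Sum>n=1..<N. ?C n * (b n - b (Suc n))\<bar>"
    using abel[of N] False by (simp only: abs_triangle_ineq)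
  also have "\<bar>?C N * b N\<bar> \<le> real q * b N"
    unfolding abs_mult using c_partial_sums[of N] nonneg[of N] False by (intro mult_mono) auto
  also have "\<bar>\<Sum>n=1..<N. ?C n * (b n - b (Suc n))\<bar> \<le> (\<Sum>n=1..<N. real q * (b n - b (Suc n)))"
  proof (rule order_trans[OF sum_abs], rule sum_mono)
    fix n assume n: "n \<in> {1..<N}"
    then show "\<bar>?C n * (b n - b (Suc n))\<bar> \<le> real q * (b n - b (Suc n))"
      unfolding abs_mult using c_partial_sums[of n] dec[of n] by (intro mult_mono) auto
  qed
  also have "\<dots> = real q * (b 1 - b N)" using tel[of N] False by (simp only: sum_distrib_left[symmetric])
  finally show ?thesis by (simp add: algebra_simps)
qed (use nonneg[of 1] in simp)

text \<open>The Dirichlet convolution of 1 and \<chi>, that is, the coefficients of \<zeta>(s) L(s,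
  \<chi>).\<close>

definition divisor_sum :: "nat \<Rightarrow> real" where
  "divisor_sum l = (\<Sum>d | d dvd l. c d)"

lemma divisor_sum_prime_power:
  assumes p: "prime p" and m: "\<not> p dvd m" "m > 0"
  shows "divisor_sum (p ^ a * m) = (\<Sum>i\<le>a. c p ^ i) * divisor_sum m"
proof -
  have p0: "p > 0" using p by (simp add: prime_gt_0_nat)
  have cp: "c (p ^ i) = c p ^ i" for i by (induction i) (use c_one in \<open>auto simp: c_mult\<close>)
  have "bij_betw (\<lambda>(i, d). p ^ i * d) ({..a} \<times> {d. d dvd m}) {d. d dvd p ^ a * m}"
  proof (rule bij_betwI')
    fix x y assume "x \<in> {..a} \<times> {d. d dvd m}" "y \<in> {..a} \<times> {d. d dvd m}"
    then obtain i d j e where xy: "x = (i, d)" "y = (j, e)" "d dvd m" "e dvd m" by auto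
    have nd: "\<not> p dvd d" "\<not> p dvd e" using xy m dvd_trans by blast+
    show "(case x of (i, d) \<Rightarrow> p ^ i * d) = (case y of (i, d) \<Rightarrow> p ^ i * d) \<longleftrightarrow> x = y"
    proof
      assume "(case x of (i, d) \<Rightarrow> p ^ i * d) = (case y of (i, d) \<Rightarrow> p ^ i * d)"
      then have eq: "p ^ i * d = p ^ j * e" using xy by simp
      then have "i = j" using prime_power_cancel[OF p, of d i e j] nd by (auto simp: mult.commute)
      then show "x = y" using eq xy p0 by simp
    qed auto
  next
    fix x assume "x \<in> {..a} \<times> {d. d dvd m}"
    then show "(case x of (i, d) \<Rightarrow> p ^ i * d) \<in> {d. d dvd p ^ a * m}"
      by (auto intro!: mult_dvd_mono le_imp_power_dvd)
  next
    fix y assume "y \<in> {d. d dvd p ^ a * m}"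
    then obtain u v where uv: "y = u * v" "u dvd p ^ a" "v dvd m" using division_decomp[of y "p ^ a" m] by auto
    obtain i where "i \<le> a" "u = p ^ i" using uv(2) p by (auto simp: divides_primepow_nat)
    then show "\<exists>x\<in>{..a} \<times> {d. d dvd m}. y = (case x of (i, d) \<Rightarrow> p ^ i * d)" using uv by auto
  qed
  then have "(\<Sum>d | d dvd p ^ a * m. c d) = (\<Sum>(i, d)\<in>{..a} \<times> {d. d dvd m}. c (p ^ i * d))"
    by (subst sum.reindex_bij_betw[symmetric]) (auto simp: case_prod_unfold)
  also have "\<dots> = (\<Sum>i\<le>a. c p ^ i) * (\<Sum>d | d dvd m. c d)"
    unfolding sum_product sum.cartesian_product by (simp add: c_mult cp)
  finally show ?thesis by (simp add: divisor_sum_def)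
qed

text \<open>The factor at p^a is 1 + \<chi>(p) + ... + \<chi>(p)^a, which is nonnegative, and at
  least 1 for even a. Splitting off the full power of one prime leaves a square if the number was a
  square, so both claims go through a single induction.\<close>

lemma divisor_sum_bounds:
  assumes "l > 0"
  shows "divisor_sum l \<ge> 0 \<and> (\<forall>n. l = n ^ 2 \<longrightarrow> divisor_sum l \<ge> 1)"
  using assms
proof (induction l rule: less_induct)
  case (less l)
  show ?case
  proof (cases "l = 1")
    case True
    moreover have "divisor_sum 1 = 1" using c_one by (simp add: divisor_sum_def)
    ultimately have "divisor_sum l \<ge> 1" by simp
    then show ?thesis by (metis order_trans zero_le_one)
  next
    case False
    obtain p where p: "prime p" "p dvd l" using prime_factor_nat[OF False] by blast
    define a where "a = multiplicity p l"
    obtain m where m: "l = p ^ a * m" "\<not> p dvd m"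
      using multiplicity_decompose'[of l p] less.prems p(1) not_prime_unit unfolding a_def by (metis not_gr_zero)
    have m0: "m > 0" using m less.prems by (cases m) auto
    have a0: "a > 0" using m p by (cases a) auto
    have "m < l"
    proof -
      have "1 < p ^ a" using prime_gt_1_nat[OF p(1)] a0 by (rule one_less_power)
      then show ?thesis using m m0 by simp
    qed
    then have IH: "divisor_sum m \<ge> 0" "\<And>n. m = n ^ 2 \<Longrightarrow> divisor_sum m \<ge> 1" using less.IH m0 by auto
    have prod: "divisor_sum l = (\<Sum>i\<le>a. c p ^ i) * divisor_sum m"
      unfolding m(1) by (rule divisor_sum_prime_power[OF p(1) m(2) m0])
    have geom: "(\<Sum>i\<le>a. c p ^ i) \<ge> 0 \<and> (even a \<longrightarrow> (\<Sum>i\<le>a. c p ^ i) \<ge> 1)" for a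
    proof -
      have "(\<Sum>i\<le>a. (-1 :: real) ^ i) = (if even a then 1 else 0)" by (induction a) auto
      moreover have "(\<Sum>i\<le>a. (0 :: real) ^ i) = 1" by (induction a) auto
      moreover have "(\<Sum>i\<le>a. (1 :: real) ^ i) = real a + 1" by simp
      ultimately show ?thesis using c_values[of p] by auto
    qed
    have "divisor_sum l \<ge> 1" if "l = n ^ 2" for n
    proof -
      have n0: "n \<noteq> 0" using that less.prems by auto
      define b where "b = multiplicity p n"
      obtain r where r: "n = p ^ b * r" "\<not> p dvd r"
        using multiplicity_decompose'[of n p] n0 p(1) not_prime_unit unfolding b_def by metis
      have "p ^ a * m = p ^ (2 * b) * r ^ 2"
        using that m r by (simp add: power_mult_distrib power_mult mult.commute)
      moreover have "\<not> p dvd r ^ 2" using r(2) p(1) by (simp add: prime_dvd_power_iff)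
      ultimately have ab: "a = 2 * b"
        using prime_power_cancel[OF p(1), of m a "r ^ 2" "2 * b"] m(2) by (auto simp: mult.commute)
      then have "m = r ^ 2" using \<open>p ^ a * m = p ^ (2 * b) * r ^ 2\<close> p(1) by (simp add: prime_gt_0_nat)
      then have "1 * 1 \<le> (\<Sum>i\<le>a. c p ^ i) * divisor_sum m"
        using IH(2) geom[of a] ab by (intro mult_mono) auto
      then show ?thesis using prod by simp
    qed
    then show ?thesis using prod geom[of a] IH(1) by simp
  qed
qed

end

section \<open>Monsky's argument and the lower bound for L(1 + \<sigma>, \<chi>)\<close>

lemma geometric_product_ge:
  fixes x :: real
  assumes "0 \<le> x" "x \<le> 1"
  shows "real n * real (Suc n) * x ^ n \<le> (\<Sum>i<n. x ^ i) * (\<Sum>i<Suc n. x ^ i)"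
proof -
  define y where "y = sqrt x"
  have y: "0 \<le> y" "y \<le> 1" "x = y ^ 2" using assms by (auto simp: y_def)
  have S: "real n * y ^ (n - 1) \<le> (\<Sum>i<n. x ^ i)" for n
  proof -
    \<comment> \<open>The i-th term is paired with the (n - 1 - i)-th one; 2ab \<le> a^2 + b^2 for a
      = y^i and b = y^(n - 1 - i) bounds each pair below by 2 y^(n - 1).\<close>
    have "2 * (\<Sum>i<n. x ^ i) = (\<Sum>i<n. x ^ i) + (\<Sum>i<n. x ^ (n - 1 - i))"
      using sum.nat_diff_reindex[of "\<lambda>i. x ^ i" n] by simp
    also have "\<dots> = (\<Sum>i<n. x ^ i + x ^ (n - 1 - i))" by (simp add: sum.distrib)
    also have "\<dots> \<ge> (\<Sum>i<n. 2 * y ^ (n - 1))"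
    proof (rule sum_mono)
      fix i assume i: "i \<in> {..<n}"
      have "0 \<le> (y ^ i - y ^ (n - 1 - i)) ^ 2" by simp
      then have "2 * (y ^ i * y ^ (n - 1 - i)) \<le> (y ^ i) ^ 2 + (y ^ (n - 1 - i)) ^ 2"
        by (simp add: power2_diff algebra_simps)
      also have "y ^ i * y ^ (n - 1 - i) = y ^ (n - 1)" using i by (simp flip: power_add)
      also have "(y ^ i) ^ 2 + (y ^ (n - 1 - i)) ^ 2 = x ^ i + x ^ (n - 1 - i)"
        unfolding y(3) by (simp add: mult.commute flip: power_mult)
      finally show "2 * y ^ (n - 1) \<le> x ^ i + x ^ (n - 1 - i)" .
    qed
    finally show ?thesis by simp
  qed
  have "real n * real (Suc n) * x ^ n \<le> real n * real (Suc n) * (y ^ (n - 1) * y ^ n)"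
  proof (rule mult_left_mono)
    have "x ^ n = y ^ (2 * n)" by (simp add: y(3) power_mult)
    also have "\<dots> \<le> y ^ (n - 1 + n)" using y by (intro power_decreasing) auto
    finally show "x ^ n \<le> y ^ (n - 1) * y ^ n" by (simp add: power_add)
  qed auto
  also have "\<dots> = (real n * y ^ (n - 1)) * (real (Suc n) * y ^ (Suc n - 1))" by simp
  also have "\<dots> \<le> (\<Sum>i<n. x ^ i) * (\<Sum>i<Suc n. x ^ i)"
    using y assms by (intro mult_mono S sum_nonneg) auto
  finally show ?thesis .
qed

text \<open>The kernel comparison from Monsky's elementary proof that \<open>L(1, \<chi>) \<noteq> 0\<close>.\<close>
lemma lambert_difference_decreasing:
  fixes x :: real
  assumes x: "0 < x" "x < 1" and n: "n \<ge> 1"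
  shows "1 / (real (Suc n) * (1 - x)) - x ^ Suc n / (1 - x ^ Suc n) \<le> 1 / (real n * (1 - x)) - x ^ n / (1 - x ^ n)"
    "0 \<le> 1 / (real n * (1 - x)) - x ^ n / (1 - x ^ n)"
proof -
  define S where "S n = (\<Sum>i<n. x ^ i)" for n
  have geom: "1 - x ^ n = (1 - x) * S n" for n unfolding S_def by (rule one_diff_power_eq)
  have Spos: "S n > 0" if "n \<ge> 1" for n
    unfolding S_def using x that by (intro sum_pos) (auto simp: lessThan_empty_iff)
  have SS: "S (Suc n) = 1 + x * S n" unfolding S_def sum.lessThan_Suc_shift by (simp add: sum_distrib_left)
  have key: "real n * real (Suc n) * x ^ n \<le> S n * S (Suc n)"
    unfolding S_def using x by (intro geometric_product_ge) auto
  have pos: "S n > 0" "S (Suc n) > 0" "real n > 0" using Spos n by auto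
  \<comment> \<open>Since S(n + 1) - x S(n) = 1, monotonicity reduces to \<open>key\<close>.\<close>
  have "x ^ n / S n - x ^ Suc n / S (Suc n) = x ^ n * (S (Suc n) - x * S n) / (S n * S (Suc n))"
    using pos by (simp add: field_simps)
  also have "\<dots> = x ^ n / (S n * S (Suc n))" by (simp add: SS)
  also have "\<dots> \<le> x ^ n / (real n * real (Suc n) * x ^ n)"
    using key pos x by (intro divide_left_mono) auto
  also have "\<dots> = 1 / (real n * real (Suc n))" using x by simp
  also have "\<dots> = 1 / real n - 1 / real (Suc n)" using pos by (simp add: field_simps)
  finally have main: "1 / real (Suc n) - x ^ Suc n / S (Suc n) \<le> 1 / real n - x ^ n / S n" by linarith
  have scale: "1 / (real n * (1 - x)) - x ^ n / (1 - x ^ n) = (1 / real n - x ^ n / S n) / (1 - x)" for n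
    unfolding geom by (simp add: diff_divide_distrib mult.commute)
  show "1 / (real (Suc n) * (1 - x)) - x ^ Suc n / (1 - x ^ Suc n) \<le> 1 / (real n * (1 - x)) - x ^ n / (1 - x ^ n)"
    unfolding scale using main x by (intro divide_right_mono) auto
  have "real n * x ^ n = (\<Sum>i<n. x ^ n)" by simp
  also have "\<dots> \<le> S n" unfolding S_def using x by (intro sum_mono power_decreasing) auto
  finally have "x ^ n / S n \<le> 1 / real n" using pos by (simp add: field_simps)
  then show "0 \<le> 1 / (real n * (1 - x)) - x ^ n / (1 - x ^ n)" unfolding scale using x by simp
qed

text \<open>Both sides run over the pairs n, m with n m = l \<le> N; this is the truncated form of
  the Lambert series identity.\<close>

lemma sum_divisor_sum:
  fixes c g :: "nat \<Rightarrow> real"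
  shows "(\<Sum>l=1..N. (\<Sum>d | d dvd l. c d) * g l) = (\<Sum>n=1..N. c n * (\<Sum>m=1..N div n. g (n * m)))"
proof -
  have "(\<Sum>l=1..N. (\<Sum>d | d dvd l. c d) * g l) = (\<Sum>l=1..N. \<Sum>d=1..N. if d dvd l then c d * g l else 0)"
  proof (intro sum.cong refl)
    fix l assume l: "l \<in> {1..N}"
    have "{d. d dvd l} = {d \<in> {1..N}. d dvd l}"
    proof (rule Set.set_eqI)
      fix d
      show "d \<in> {d. d dvd l} \<longleftrightarrow> d \<in> {d \<in> {1..N}. d dvd l}"
        using l dvd_imp_le[of d l] by (cases "d = 0") auto
    qed
    then have "(\<Sum>d | d dvd l. c d) = (\<Sum>d=1..N. if d dvd l then c d else 0)"
      by (simp only: sum.inter_filter finite_atLeastAtMost)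
    then show "(\<Sum>d | d dvd l. c d) * g l = (\<Sum>d=1..N. if d dvd l then c d * g l else 0)"
      by (simp add: sum_distrib_right if_distrib[of "\<lambda>x. x * g l"] cong: if_cong)
  qed
  also have "\<dots> = (\<Sum>d=1..N. \<Sum>l=1..N. if d dvd l then c d * g l else 0)" by (rule sum.swap)
  also have "\<dots> = (\<Sum>n=1..N. c n * (\<Sum>m=1..N div n. g (n * m)))"
  proof (intro sum.cong refl)
    fix n assume n: "n \<in> {1..N}"
    have "(\<Sum>l=1..N. if n dvd l then c n * g l else 0) = (\<Sum>l\<in>{l \<in> {1..N}. n dvd l}. c n * g l)"
      by (rule sum.inter_filter[symmetric]) simp
    also have "\<dots> = (\<Sum>m=1..N div n. c n * g (n * m))"
    proof (rule sum.reindex_bij_witness[where i = "\<lambda>m. n * m" and j = "\<lambda>l. l div n"])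
      fix m assume "m \<in> {1..N div n}"
      then show "n * m \<in> {l \<in> {1..N}. n dvd l}" "n * m div n = m"
        using n by (auto simp: less_eq_div_iff_mult_less_eq mult.commute)
    next
      fix l assume l: "l \<in> {l \<in> {1..N}. n dvd l}"
      then have "1 \<le> l div n" using n by (auto simp: less_eq_div_iff_mult_less_eq dvd_imp_le)
      then show "l div n \<in> {1..N div n}" using l div_le_mono[of l N n] by auto
    qed auto
    finally show "(\<Sum>l=1..N. if n dvd l then c n * g l else 0) = c n * (\<Sum>m=1..N div n. g (n * m))"
      by (simp only: sum_distrib_left)
  qed
  finally show ?thesis .
qed

text \<open>For x = 1 - 1/K^2 the Lambert sum of c(n) x^n/(1 - x^n) equals the sum of
  \<open>divisor_sum l\<close> x^l up to truncation. Nonnegativity and the squares m^2 with m \<le>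
  K make the latter at least K/9, as x^(K^2) \<ge> exp(-2) \<ge> 1/9. By \<open>abel_bound\<close>
  and the decreasing kernel the Lambert sum differs from K^2 \<Sum>c(n)/n by at most q. With K = 36
  q this leaves K/9 - 1 - q \<ge> 2 q, and 2 q / K^2 = 1/(648 q).\<close>

lemma (in real_character) harmonic_character_sum_ge:
  assumes K: "K = 36 * q" and N: "N = q * K ^ 6"
  shows "(\<Sum>n=1..N. c n / real n) \<ge> 1 / (648 * real q)"
proof -
  define \<epsilon> where "\<epsilon> = 1 / real K ^ 2"
  define x where "x = 1 - \<epsilon>"
  have q1: "real q \<ge> 1" using q_pos by simp
  have K1: "real K \<ge> 36" "real K = 36 * real q" using q1 by (auto simp: K)
  have K2: "real K ^ 2 \<ge> 2"
  proof -
    have "36 ^ 2 \<le> real K ^ 2" using K1 by (intro power_mono) auto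
    then show ?thesis by simp
  qed
  have \<epsilon>: "0 < \<epsilon>" "\<epsilon> \<le> 1 / 2" using K2 K1 by (auto simp: \<epsilon>_def divide_simps)
  have x: "0 < x" "x < 1" "1 - x = \<epsilon>" using \<epsilon> by (auto simp: x_def)
  let ?b = "\<lambda>n. 1 / (real n * \<epsilon>) - x ^ n / (1 - x ^ n)"
  have ab: "\<bar>\<Sum>n=1..N. c n * ?b n\<bar> \<le> real q * ?b 1"
    by (rule abel_bound) (use lambert_difference_decreasing[OF x(1,2)] x(3) in auto)
  have b1: "?b 1 = 1" using \<epsilon> x(3) by (simp add: diff_divide_distrib[symmetric])
  \<comment> \<open>The geometric series is cut where n m exceeds N, as required by
    \<open>sum_divisor_sum\<close>.\<close>
  have geo: "x ^ n / (1 - x ^ n) = (\<Sum>m=1..N div n. x ^ (n * m)) + x ^ (n * (N div n + 1)) / (1 - x ^ n)"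
    if "n \<ge> 1" for n
  proof -
    have y: "x ^ n < 1" using x that by (simp add: power_less_one_iff)
    have "(\<Sum>m=1..M. y ^ m) = (y - y ^ (M + 1)) / (1 - y)" if "y < 1" for y :: real and M
      using that by (auto simp: sum_gp)
    from this[OF y, of "N div n"] show ?thesis
      unfolding power_mult by (simp add: diff_divide_distrib)
  qed
  have err: "\<bar>\<Sum>n=1..N. c n * (x ^ (n * (N div n + 1)) / (1 - x ^ n))\<bar> \<le> 1"
  proof -
    have "\<bar>\<Sum>n=1..N. c n * (x ^ (n * (N div n + 1)) / (1 - x ^ n))\<bar> \<le> (\<Sum>n=1..N. 1 * (x ^ N / \<epsilon>))"
    proof (rule order_trans[OF sum_abs], rule sum_mono)
      fix n assume n: "n \<in> {1..N}"
      have "N \<le> n * (N div n + 1)"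
        using mult_div_mod_eq[of n N] mod_less_divisor[of n N] n unfolding distrib_left mult_1_right atLeastAtMost_iff by linarith
      then have a: "x ^ (n * (N div n + 1)) \<le> x ^ N" using x by (intro power_decreasing) auto
      have "x ^ n \<le> x ^ 1" using x n by (intro power_decreasing) auto
      then have d: "\<epsilon> \<le> 1 - x ^ n" using x(3) by simp
      have "x ^ (n * (N div n + 1)) / (1 - x ^ n) \<le> x ^ N / \<epsilon>"
        using a d \<epsilon> x by (intro frac_le) auto
      moreover have "0 \<le> x ^ (n * (N div n + 1)) / (1 - x ^ n)" using d \<epsilon> x by simp
      ultimately show "\<bar>c n * (x ^ (n * (N div n + 1)) / (1 - x ^ n))\<bar> \<le> 1 * (x ^ N / \<epsilon>)"
      proof -
        have "\<bar>c n * w\<bar> \<le> 1 * u" if "w \<le> u" "0 \<le> w" for w u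
          unfolding abs_mult using abs_c_le[of n] that by (intro mult_mono) auto
        then show ?thesis using \<open>x ^ (n * (N div n + 1)) / (1 - x ^ n) \<le> x ^ N / \<epsilon>\<close> \<open>0 \<le> x ^ (n * (N div n + 1)) / (1 - x ^ n)\<close> by blast
      qed
    qed
    also have "\<dots> = real N * x ^ N * real K ^ 2" by (simp add: \<epsilon>_def)
    also have "\<dots> \<le> 1"
    proof -
      \<comment> \<open>This is N \<epsilon>. The length N = q K^6 is chosen so that the truncation
        error N x^N K^2 \<le> y^2 exp(-y) is at most 1; y \<ge> 27 serves to give y^2 \<le> (y/3)^3
        \<le> exp y.\<close>
      define y where "y = real q * real K ^ 4"
      have y27: "y \<ge> 27"
      proof -
        have "1 * 36 ^ 4 \<le> y" unfolding y_def using q1 K1 by (intro mult_mono power_mono) auto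
        then show ?thesis by simp
      qed
      have "x ^ N \<le> exp (- \<epsilon>) ^ N" using x exp_ge_add_one_self[of "- \<epsilon>"] by (intro power_mono) (auto simp: x_def)
      also have "\<dots> = exp (- (real N * \<epsilon>))" by (simp flip: exp_of_nat_mult)
      also have "real N * \<epsilon> = y"
      proof -
        have e: "real K ^ 6 = real K ^ 4 * real K ^ 2" using power_add[of "real K" 4 2] by simp
        have d: "real K ^ 2 \<noteq> 0" using K2 by linarith
        have g: "a * (b * d) * (1 / d) = a * b" if "d \<noteq> 0" for a b d :: real using that by simp
        show ?thesis unfolding N \<epsilon>_def y_def of_nat_mult of_nat_power e by (rule g[OF d])
      qed
      finally have xN: "x ^ N \<le> exp (- y)" .
      have "real N * real K ^ 2 \<le> y ^ 2"
      proof -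
        have "real N * real K ^ 2 = real q * real K ^ 8" using power_add[of "real K" 6 2] by (simp add: N)
        also have "\<dots> \<le> (real q * real q) * real K ^ 8" using q1 by (intro mult_right_mono) auto
        also have "\<dots> = y ^ 2" by (simp add: y_def power2_eq_square flip: power_add)
        finally show ?thesis .
      qed
      also have "y ^ 2 \<le> exp y"
      proof -
        have "y ^ 2 * 27 \<le> y ^ 2 * y" using y27 by (intro mult_left_mono) auto
        then have "y ^ 2 \<le> (y / 3) ^ 3" by (simp add: power2_eq_square power3_eq_cube)
        also have "\<dots> \<le> exp (y / 3) ^ 3"
        proof (rule power_mono)
          show "y / 3 \<le> exp (y / 3)" using exp_ge_add_one_self[of "y / 3"] by linarith
        qed (use y27 in simp)
        also have "\<dots> = exp y" by (simp flip: exp_of_nat_mult)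
        finally show ?thesis .
      qed
      finally have "real N * real K ^ 2 \<le> exp y" .
      then have "real N * real K ^ 2 * x ^ N \<le> exp y * exp (- y)" using xN x by (intro mult_mono) auto
      then show ?thesis by (simp add: exp_minus mult_ac)
    qed
    finally show ?thesis .
  qed
  have main: "(\<Sum>n=1..N. c n * (\<Sum>m=1..N div n. x ^ (n * m))) \<ge> real K / 9"
  proof -
    have "(\<Sum>n=1..N. c n * (\<Sum>m=1..N div n. x ^ (n * m))) = (\<Sum>l=1..N. divisor_sum l * x ^ l)"
      unfolding divisor_sum_def by (rule sum_divisor_sum[symmetric])
    also have "\<dots> \<ge> (\<Sum>l\<in>(\<lambda>m. m ^ 2) ` {1..K}. divisor_sum l * x ^ l)"
    proof (rule sum_mono2)
      have "m ^ 2 \<le> N" if "m \<le> K" for m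
      proof -
        have "m ^ 2 \<le> K ^ 2" using that by (intro power_mono) auto
        also have "\<dots> \<le> K ^ 6" using q_pos by (intro power_increasing) (auto simp: K)
        also have "\<dots> \<le> N" using q_pos by (simp add: N)
        finally show ?thesis .
      qed
      then show "(\<lambda>m. m ^ 2) ` {1..K} \<subseteq> {1..N}" by auto
      show "0 \<le> divisor_sum l * x ^ l" if "l \<in> {1..N} - (\<lambda>m. m ^ 2) ` {1..K}" for l
        using divisor_sum_bounds[of l] that x by simp
    qed simp
    also have "(\<Sum>l\<in>(\<lambda>m. m ^ 2) ` {1..K}. divisor_sum l * x ^ l) = (\<Sum>m=1..K. divisor_sum (m ^ 2) * x ^ (m ^ 2))"
      by (rule sum.reindex[unfolded o_def]) (auto simp: inj_on_def power2_eq_iff_nonneg)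
    also have "\<dots> \<ge> (\<Sum>m=1..K. 1 * (1 / 9))"
    proof (rule sum_mono, rule mult_mono)
      fix m assume m: "m \<in> {1..K}"
      show "1 \<le> divisor_sum (m ^ 2)" using divisor_sum_bounds[of "m ^ 2"] m by simp
      have "1 / 9 \<le> exp (- 2 :: real)"
      proof -
        have "exp (2::real) = exp 1 ^ 2" by (simp flip: exp_of_nat_mult)
        also have "\<dots> \<le> 3 ^ 2" using exp_le by (intro power_mono) auto
        finally show ?thesis by (simp add: exp_minus divide_simps)
      qed
      also have "\<dots> = exp (real (K ^ 2) * (- 2 * \<epsilon>))" using K1 by (simp add: \<epsilon>_def)
      also have "\<dots> \<le> exp (real (K ^ 2) * ln x)"
      proof -
        have "- \<epsilon> - 2 * \<epsilon> ^ 2 \<le> ln x" unfolding x_def using \<epsilon> by (intro ln_one_minus_pos_lower_bound) auto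
        moreover have "2 * \<epsilon> ^ 2 \<le> \<epsilon>" using \<epsilon> by (simp add: power2_eq_square)
        ultimately have "- 2 * \<epsilon> \<le> ln x" by linarith
        then have "real (K ^ 2) * (- 2 * \<epsilon>) \<le> real (K ^ 2) * ln x" by (rule mult_left_mono) (rule of_nat_0_le_iff)
        then show ?thesis by (simp only: exp_le_cancel_iff)
      qed
      also have "\<dots> = x ^ (K ^ 2)" using x by (simp add: exp_of_nat_mult del: of_nat_power)
      also have "\<dots> \<le> x ^ (m ^ 2)" using x m by (intro power_decreasing power_mono) auto
      finally show "1 / 9 \<le> x ^ (m ^ 2)" .
    qed (use divisor_sum_bounds in auto)
    finally show ?thesis by simp
  qed
  have "(\<Sum>n=1..N. c n * ?b n) = (\<Sum>n=1..N. c n / real n) / \<epsilon> -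
     ((\<Sum>n=1..N. c n * (\<Sum>m=1..N div n. x ^ (n * m))) + (\<Sum>n=1..N. c n * (x ^ (n * (N div n + 1)) / (1 - x ^ n))))"
  proof -
    have "(\<Sum>n=1..N. c n * ?b n) = (\<Sum>n=1..N. c n / real n / \<epsilon> -
       (c n * (\<Sum>m=1..N div n. x ^ (n * m)) + c n * (x ^ (n * (N div n + 1)) / (1 - x ^ n))))"
    proof (intro sum.cong refl)
      fix n assume "n \<in> {1..N}"
      then have g: "x ^ n / (1 - x ^ n) = (\<Sum>m=1..N div n. x ^ (n * m)) + x ^ (n * (N div n + 1)) / (1 - x ^ n)"
        by (intro geo) auto
      have "c n * (1 / (real n * \<epsilon>) - (u + v)) = c n / real n / \<epsilon> - (c n * u + c n * v)" for u v
        by (simp add: algebra_simps)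
      then show "c n * ?b n = c n / real n / \<epsilon> - (c n * (\<Sum>m=1..N div n. x ^ (n * m)) + c n * (x ^ (n * (N div n + 1)) / (1 - x ^ n)))"
        by (subst g)
    qed
    then show ?thesis by (simp only: sum_subtractf sum.distrib sum_divide_distrib)
  qed
  then have "(\<Sum>n=1..N. c n / real n) / \<epsilon> \<ge> real K / 9 - 1 - real q"
    using ab main err unfolding b1 by linarith
  moreover have "real K / 9 - 1 - real q \<ge> 2 * real q" using K1 q1 by simp
  ultimately have "(\<Sum>n=1..N. c n / real n) / \<epsilon> \<ge> 2 * real q" by linarith
  then have "(\<Sum>n=1..N. c n / real n) \<ge> 2 * real q * \<epsilon>" using \<epsilon> by (simp add: pos_le_divide_eq)
  also have "2 * real q * \<epsilon> = 1 / (648 * real q)" using q1 by (simp add: \<epsilon>_def K1(2) power2_eq_square field_simps)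
  finally show ?thesis .
qed

text \<open>Of the lower bound 1/(648 q) at \<sigma> = 0, one quarter is spent on the tail beyond N,
  at most 6/M, and one quarter on changing 1/n into n^(-1 - \<sigma>), at most \<sigma> (44 q)^2.
  The number 6000000 exceeds 2592 times 44^2.\<close>

lemma (in real_character) L_series_ge:
  assumes \<sigma>: "0 < \<sigma>" "\<sigma> \<le> 1 / (6000000 * real q ^ 4)"
  shows "norm (L_series \<chi> (Complex (1 + \<sigma>) 0)) \<ge> 1 / (1296 * real q)"
proof -
  define K where "K = 36 * q"
  define M where "M = K ^ 6"
  define N where "N = q * M"
  let ?s = "Complex (1 + \<sigma>) 0"
  let ?F = "\<lambda>n. \<chi> n * inv_pow ?s (real n)"
  have q1: "real q \<ge> 1" using q_pos by simp
  have M0: "M > 0" using q_pos by (simp add: M_def K_def)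
  have \<sigma>1: "\<sigma> \<le> 1"
  proof -
    have "1 \<le> 6000000 * real q ^ 4" using one_le_power[OF q1, of 4] by simp
    then have "1 / (6000000 * real q ^ 4) \<le> 1 / 1" using q1 by (intro divide_left_mono) auto
    then show ?thesis using \<sigma> by linarith
  qed
  have s1: "Re ?s \<ge> 1" "?s \<noteq> 1" using \<sigma> by (auto simp: complex_eq_iff)
  have tail: "norm (L_series \<chi> ?s - (\<Sum>n=1..N. ?F n)) \<le> 6 / real M"
  proof -
    have part: "norm ((\<Sum>n<q * M'. ?F (Suc n)) - (\<Sum>n=1..N. ?F n)) \<le> 6 / real M" if M': "M' \<ge> M" for M'
    proof -
      have "(\<Sum>n<q * M'. ?F (Suc n)) = (\<Sum>n=1..q * M'. ?F n)"
        by (rule sum.reindex_bij_witness[where i = "\<lambda>n. n - 1" and j = Suc]) auto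
      also have "\<dots> = (\<Sum>n=1..N. ?F n) + (\<Sum>n\<in>{q * M<..q * M'}. ?F n)"
        using sum.ub_add_nat[of 1 "q * M" ?F "q * M' - q * M"] M' by (simp add: N_def atLeastSucAtMost_greaterThanAtMost)
      finally have "norm ((\<Sum>n<q * M'. ?F (Suc n)) - (\<Sum>n=1..N. ?F n)) = norm (\<Sum>n\<in>{q * M<..q * M'}. ?F n)" by simp
      also have "\<dots> \<le> (if principal q \<chi> then 2 / norm (?s - 1) else 0) + 2 * (1 + norm ?s) / real M"
        by (rule character_tail_bound[OF char M' M0 s1])
      also have "\<dots> \<le> 6 / real M"
      proof -
        have "norm ?s \<le> 2" using \<sigma> \<sigma>1 by (simp add: cmod_def)
        then show ?thesis using nonprincipal M0 by (simp add: divide_right_mono)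
      qed
      finally show ?thesis .
    qed
    have "summable (\<lambda>n. ?F (Suc n))"
      by (rule summable_inv_pow[OF \<sigma>(1)]) (use norm_character_inv_pow_le[OF char, of _ ?s] in simp)
    then have "(\<lambda>N. \<Sum>n<N. ?F (Suc n)) \<longlonglongrightarrow> L_series \<chi> ?s"
      unfolding L_series_def by (rule summable_LIMSEQ)
    moreover have "strict_mono (\<lambda>M. q * M)" using q_pos by (auto simp: strict_mono_def)
    ultimately have "((\<lambda>N. \<Sum>n<N. ?F (Suc n)) \<circ> (\<lambda>M. q * M)) \<longlonglongrightarrow> L_series \<chi> ?s"
      by (rule LIMSEQ_subseq_LIMSEQ)
    then have "(\<lambda>M. norm ((\<Sum>n<q * M. ?F (Suc n)) - (\<Sum>n=1..N. ?F n))) \<longlonglongrightarrow> norm (L_series \<chi> ?s - (\<Sum>n=1..N. ?F n))"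
      unfolding o_def by (intro tendsto_intros)
    then show ?thesis by (rule LIMSEQ_le_const2) (use part in blast)
  qed
  have lnN: "1 + ln (real N) \<le> 44 * real q"
  proof -
    have "real N = 36 ^ 6 * real q ^ 7" by (simp add: N_def M_def K_def power_mult_distrib eval_nat_numeral)
    moreover have "ln (a ^ 6 * b ^ 7) = 6 * ln a + 7 * ln b" if "a > 0" "b > 0" for a b :: real
      using that by (simp add: ln_mult ln_realpow)
    ultimately have "ln (real N) = 6 * ln 36 + 7 * ln (real q)" using q1 by (simp only:)
    moreover have "ln (36::real) = 2 * ln 2 + 2 * ln 3"
    proof -
      have "(36::real) = 2 ^ 2 * 3 ^ 2" by simp
      then show ?thesis by (simp only: ln_mult_pos ln_realpow zero_less_power zero_less_numeral of_nat_numeral)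
    qed
    moreover have "ln 2 \<le> (1::real)" "ln 3 \<le> (2::real)" "ln (real q) \<le> real q - 1"
      using ln_le_minus_one[of 2] ln_le_minus_one[of 3] ln_le_minus_one[of "real q"] q1 by auto
    ultimately show ?thesis using q1 by linarith
  qed
  have N1: "N \<ge> 1" using q_pos M0 by (simp add: N_def)
  have lnN0: "ln (real N) \<ge> 0" using N1 by simp
  have cmp: "\<bar>(\<Sum>n=1..N. c n / real n) - (\<Sum>n=1..N. c n * real n powr (- (1 + \<sigma>)))\<bar> \<le> \<sigma> * (44 * real q) ^ 2"
  proof -
    have "\<bar>(\<Sum>n=1..N. c n / real n) - (\<Sum>n=1..N. c n * real n powr (- (1 + \<sigma>)))\<bar> \<le> (\<Sum>n=1..N. 1 * (\<sigma> * ln (real N) * (1 / real n)))"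
      unfolding sum_subtractf[symmetric]
    proof (rule order_trans[OF sum_abs], rule sum_mono)
      fix n assume n: "n \<in> {1..N}"
      then have n1: "real n \<ge> 1" by simp
      have "real n powr (- (1 + \<sigma>)) = 1 / real n * real n powr (- \<sigma>)"
        using n1 by (simp add: powr_diff powr_minus_divide)
      then have "c n / real n - c n * real n powr (- (1 + \<sigma>)) = c n * (1 / real n * (1 - real n powr (- \<sigma>)))"
        by (simp add: algebra_simps)
      moreover have w1: "1 / real n * (1 - real n powr (- \<sigma>)) \<le> \<sigma> * ln (real N) * (1 / real n)"
      proof -
        have "1 - real n powr (- \<sigma>) \<le> \<sigma> * ln (real n)"
          using exp_ge_add_one_self[of "- (\<sigma> * ln (real n))"] n1 by (simp add: powr_def)
        also have "\<dots> \<le> \<sigma> * ln (real N)" using n n1 \<sigma> by (intro mult_left_mono ln_mono) auto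
        finally show ?thesis using n1 by (simp add: divide_right_mono)
      qed
      moreover have w2: "0 \<le> 1 / real n * (1 - real n powr (- \<sigma>))"
      proof -
        have "real n powr (- \<sigma>) \<le> real n powr 0" using n1 \<sigma> by (intro powr_mono) auto
        then show ?thesis using n1 by simp
      qed
      ultimately show "\<bar>c n / real n - c n * real n powr (- (1 + \<sigma>))\<bar> \<le> 1 * (\<sigma> * ln (real N) * (1 / real n))"
      proof -
        have "\<bar>c n * w\<bar> \<le> 1 * u" if "w \<le> u" "0 \<le> w" for w u
          unfolding abs_mult using abs_c_le[of n] that by (intro mult_mono) auto
        from this[OF w1 w2] show ?thesis by (simp only: \<open>c n / real n - c n * real n powr (- (1 + \<sigma>)) = c n * (1 / real n * (1 - real n powr (- \<sigma>)))\<close>)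
      qed
    qed
    also have "\<dots> = \<sigma> * (ln (real N) * (\<Sum>n=1..N. 1 / real n))" by (simp add: sum_distrib_left mult_ac)
    also have "\<dots> \<le> \<sigma> * ((44 * real q) * (44 * real q))"
      using \<sigma> lnN lnN0 sum_inverse_le[of N] N1 by (intro mult_left_mono mult_mono) (auto intro: sum_nonneg)
    finally show ?thesis by (simp add: power2_eq_square)
  qed
  have Re: "Re (\<Sum>n=1..N. ?F n) = (\<Sum>n=1..N. c n * real n powr (- (1 + \<sigma>)))"
  proof -
    have "Re (?F n) = c n * real n powr (- (1 + \<sigma>))" if "n \<in> {1..N}" for n
      using inv_pow_eq[of "real n" "1 + \<sigma>" 0] that by (simp add: c_def)
    then show ?thesis by simp
  qed
  have h: "(\<Sum>n=1..N. c n / real n) \<ge> 1 / (648 * real q)"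
    by (rule harmonic_character_sum_ge[OF K_def]) (simp add: N_def M_def)
  have e1: "\<sigma> * (44 * real q) ^ 2 \<le> 1 / (2592 * real q)"
  proof -
    have "\<sigma> * (44 * real q) ^ 2 \<le> 1 / (6000000 * real q ^ 4) * (44 * real q) ^ 2"
      using \<sigma> by (intro mult_right_mono) auto
    also have "\<dots> = 1936 / 6000000 * (1 / real q ^ 2)" using q1 by (simp add: power_mult_distrib eval_nat_numeral)
    also have "\<dots> \<le> 1 / 2592 * (1 / real q)"
      using q1 by (intro mult_mono divide_left_mono) (auto simp: power2_eq_square)
    finally show ?thesis by simp
  qed
  have e2: "6 / real M \<le> 1 / (2592 * real q)"
  proof -
    have "real q \<le> real q ^ 6" using q1 by (intro self_le_power) auto
    then have "15552 * real q \<le> 15552 * real q ^ 6" by (intro mult_left_mono) auto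
    also have "\<dots> \<le> 36 ^ 6 * real q ^ 6" using q1 by (intro mult_right_mono) auto
    finally have "15552 * real q \<le> 36 ^ 6 * real q ^ 6" .
    then have "15552 * real q \<le> real M" by (simp add: M_def K_def power_mult_distrib)
    then have "6 / real M \<le> 6 / (15552 * real q)" using q1 by (intro divide_left_mono) auto
    then show ?thesis by simp
  qed
  have "1 / (1296 * real q) = 1 / (648 * real q) - 1 / (2592 * real q) - 1 / (2592 * real q)"
    using q1 by (simp add: field_simps)
  also have "\<dots> \<le> (\<Sum>n=1..N. c n / real n) - \<sigma> * (44 * real q) ^ 2 - 6 / real M"
    using h e1 e2 by linarith
  also have "\<dots> \<le> Re (\<Sum>n=1..N. ?F n) - norm (L_series \<chi> ?s - (\<Sum>n=1..N. ?F n))"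
    using cmp tail unfolding Re by linarith
  also have "\<dots> \<le> Re (L_series \<chi> ?s)"
    using abs_Re_le_cmod[of "L_series \<chi> ?s - (\<Sum>n=1..N. ?F n)"] by simp
  also have "\<dots> \<le> norm (L_series \<chi> ?s)" by (rule complex_Re_le_cmod)
  finally show ?thesis .
qed

text \<open>The square root of y is the product of y^(1/4) \<ge> b and y^(1/4) \<ge> q^4; this is
  where the exponent 16 for the modulus comes from.\<close>

lemma powr_minus_half_le:
  fixes b q y :: real
  assumes "b > 0" "y \<ge> b ^ 4" "q \<ge> 1" "q ^ 16 \<le> y"
  shows "y powr (- 1 / 2) \<le> 1 / (b * q ^ 4)"
proof -
  have y: "y > 0" using assms(1,2) zero_less_power[of b 4] by linarith
  have "((b * q ^ 4) ^ 2) ^ 2 = b ^ 4 * q ^ 16" by (simp add: power_mult_distrib flip: power_mult)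
  also have "\<dots> \<le> y * y" using assms y by (intro mult_mono) auto
  finally have "((b * q ^ 4) ^ 2) ^ 2 \<le> y ^ 2" by (simp add: power2_eq_square)
  then have "(b * q ^ 4) ^ 2 \<le> y" using y by (rule power2_le_imp_le[OF _ less_imp_le])
  then have le: "b * q ^ 4 \<le> sqrt y" by (rule real_le_rsqrt)
  have pos: "0 < b * q ^ 4" using assms by simp
  have "y powr (- 1 / 2) = 1 / sqrt y" using y powr_minus_divide[of y "1 / 2"] by (simp add: powr_half_sqrt)
  also have "\<dots> \<le> 1 / (b * q ^ 4)" by (rule divide_left_mono[OF le]) (use pos y in auto)
  finally show ?thesis .
qed

text \<open>With y = ln Y and \<sigma> = y^(-1/2), the sum of p^(-1 - \<sigma>) is at least (ln y)/2
  up to a constant, while the lower bound 1/(1296 q) for the L-series keeps the sum of \<chi>(p)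
  p^(-1 - \<sigma>) above -(ln y)/16 up to a constant. Together they exceed (ln y)/4 for large
  y.\<close>

theorem real_character_distance_ge:
  "\<exists>y0. \<forall>Y q \<chi>. ln Y \<ge> y0 \<and> Y > 0 \<and> dirichlet_character q \<chi> \<and> principal q (\<lambda>n. \<chi> n * \<chi> n) \<and> real q ^ 16 \<le> ln Y \<longrightarrow>
     (\<Sum>p | prime p \<and> real p \<le> Y. 1 / real p * (1 + Re (\<chi> p))) \<ge> ln (ln Y) / 4"
proof -
  define b :: real where "b = 6000000"
  obtain x1 where x1: "x1 \<ge> 1" "\<And>X \<sigma>. ln X \<ge> x1 \<and> X > 0 \<and> \<sigma> \<le> 1 \<and> \<sigma> \<ge> ln X powr (- 79 / 80) \<Longrightarrow>
     nat \<lfloor>X\<rfloor> > 0 \<and> real (nat \<lfloor>X\<rfloor>) powr (- \<sigma>) / \<sigma> \<le> 1 / 2"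
    using sieve_length by blast
  have "eventually (\<lambda>y::real. ln y / 2 - 18 - C - ln y / 16 \<ge> ln y / 4) at_top" for C :: real by real_asymp
  from this[of "ln 1296"] obtain x2 where x2: "\<And>y::real. y \<ge> x2 \<Longrightarrow> ln y / 2 - 18 - ln 1296 - ln y / 16 \<ge> ln y / 4"
    by (auto simp: eventually_at_top_linorder)
  show ?thesis
  proof (rule exI[of _ "max x1 (max x2 (b ^ 4))"], intro allI impI, elim conjE)
    fix Y q \<chi>
    assume lY: "max x1 (max x2 (b ^ 4)) \<le> ln Y" and Y0: "0 < Y" and \<chi>: "dirichlet_character q \<chi>"
      and sq: "principal q (\<lambda>n. \<chi> n * \<chi> n)" and qY: "real q ^ 16 \<le> ln Y"
    define y where "y = ln Y"
    have y: "y \<ge> x1" "y \<ge> x2" "y \<ge> b ^ 4" "y \<ge> 1" using lY x1(1) by (auto simp: y_def)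
    define \<sigma> where "\<sigma> = y powr (- 1 / 2)"
    have \<sigma>: "\<sigma> > 0" "\<sigma> \<le> 1" "\<sigma> \<ge> y powr (- 79 / 80)"
    proof -
      show "\<sigma> > 0" using y by (simp add: \<sigma>_def)
      have "y powr (- 1 / 2) \<le> y powr 0" using y by (intro powr_mono) auto
      then show "\<sigma> \<le> 1" using y by (simp add: \<sigma>_def)
      show "\<sigma> \<ge> y powr (- 79 / 80)" unfolding \<sigma>_def using y by (intro powr_mono) auto
    qed
    have Y: "nat \<lfloor>Y\<rfloor> > 0" "real (nat \<lfloor>Y\<rfloor>) powr (- \<sigma>) / \<sigma> \<le> 1 / 2"
      using x1(2)[of Y \<sigma>] y \<sigma> Y0 by (auto simp: y_def)
    have P: "(\<Sum>p | prime p \<and> p \<le> nat \<lfloor>Y\<rfloor>. real p powr (- (1 + \<sigma>))) \<ge> ln y / 2 - 9"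
      using sum_primes_powr_ge[OF \<sigma>(1) Y] y by (simp add: \<sigma>_def ln_div ln_powr)
    let ?R = "\<Sum>p | prime p \<and> p \<le> nat \<lfloor>Y\<rfloor>. real p powr (- (1 + \<sigma>)) * Re (\<chi> p * of_nat p powr (\<i> * of_real 0))"
    have R: "?R \<ge> - 9 - ln 1296 - ln y / 16"
    proof (cases "principal q \<chi>")
      case True
      have "\<chi> n = 0 \<or> \<chi> n = 1" for n
        using True \<chi> unfolding principal_def dirichlet_character_def by blast
      then have nn: "Re (\<chi> n) \<ge> 0" for n by (metis order_refl one_complex.sel(1) zero_complex.sel(1) zero_le_one)
      have "?R = (\<Sum>p | prime p \<and> p \<le> nat \<lfloor>Y\<rfloor>. real p powr (- (1 + \<sigma>)) * Re (\<chi> p))"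
        by (intro sum.cong refl) (auto dest: prime_gt_0_nat)
      also have "\<dots> \<ge> 0" using nn by (intro sum_nonneg mult_nonneg_nonneg) auto
      finally show ?thesis using y ln_ge_zero[of y] ln_ge_zero[of 1296] by linarith
    next
      case False
      have rc: "real_character q \<chi>" using \<chi> False sq by (rule real_character.intro)
      have b0: "b > 0" by (simp add: b_def)
      have q1: "real q \<ge> 1" using \<chi> by (simp add: dirichlet_character_def)
      have "\<sigma> \<le> 1 / (6000000 * real q ^ 4)"
        unfolding \<sigma>_def b_def[symmetric] by (rule powr_minus_half_le[OF b0 y(3) q1 qY[folded y_def]])
      from real_character.L_series_ge[OF rc \<sigma>(1) this]
      have "norm (L_series \<chi> (Complex (1 + \<sigma>) 0)) \<ge> 1 / (1296 * real q)" .
      then have "ln (1 / (1296 * real q)) \<le> ln (norm (L_series \<chi> (Complex (1 + \<sigma>) 0)))" using q1 by (intro ln_mono) auto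
      moreover have "ln (1 / (1296 * real q)) = - ln 1296 - ln (real q)" using q1 by (simp add: ln_div ln_mult)
      moreover have "16 * ln (real q) \<le> ln y"
      proof -
        have "ln (real q ^ 16) \<le> ln y" using qY q1 by (intro ln_mono) (auto simp: y_def)
        then show ?thesis using q1 by (simp add: ln_realpow)
      qed
      moreover have "\<bar>ln (norm (L_series \<chi> (Complex (1 + \<sigma>) 0))) - ?R\<bar> \<le> 9"
        using log_L_series(2)[OF \<chi> \<sigma>(1) Y, of 0] by simp
      ultimately show ?thesis by linarith
    qed
    have "(\<Sum>p | prime p \<and> p \<le> nat \<lfloor>Y\<rfloor>. real p powr (- (1 + \<sigma>))) + 1 * ?R \<le>
      (\<Sum>p | prime p \<and> real p \<le> Y. 1 / real p * (1 + 1 * Re (\<chi> p * of_nat p powr (\<i> * of_real 0))))"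
      using Y0 by (intro weighted_distance_le[OF \<chi> \<sigma>(1)]) auto
    also have "\<dots> = (\<Sum>p | prime p \<and> real p \<le> Y. 1 / real p * (1 + Re (\<chi> p)))"
      by (intro sum.cong refl) (auto dest: prime_gt_0_nat)
    finally show "ln (ln Y) / 4 \<le> (\<Sum>p | prime p \<and> real p \<le> Y. 1 / real p * (1 + Re (\<chi> p)))"
      using P R x2[OF y(2)] unfolding y_def by linarith
  qed
qed

section \<open>The Liouville function\<close>

lemma dirichlet_character_norm:
  assumes "dirichlet_character q \<chi>"
  shows "\<chi> a = 0 \<or> norm (\<chi> a) = 1"
proof (cases "coprime a q")
  case True
  have "totient q > 0" using assms by (simp add: dirichlet_character_def)
  then show ?thesis using power_eq_1_iff[OF dirichlet_character_root_of_unity[OF assms True]] by auto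
qed (use assms in \<open>auto simp: dirichlet_character_def\<close>)

lemma dirichlet_character_mult:
  assumes "dirichlet_character q \<chi>" "dirichlet_character r \<psi>"
  shows "dirichlet_character (q * r) (\<lambda>n. \<chi> n * \<psi> n)"
proof -
  have "\<chi> (a + q * r) = \<chi> a" "\<psi> (a + q * r) = \<psi> a" for a
    using dirichlet_character_mod[OF assms(1), of "a + q * r"] dirichlet_character_mod[OF assms(1), of a]
      dirichlet_character_mod[OF assms(2), of "a + q * r"] dirichlet_character_mod[OF assms(2), of a] by simp_all
  then show ?thesis using assms unfolding dirichlet_character_def by (auto simp: mult_ac)
qed

lemma dirichlet_character_square:
  "dirichlet_character q \<chi> \<Longrightarrow> dirichlet_character q (\<lambda>n. \<chi> n * \<chi> n)"
  unfolding dirichlet_character_def by (auto simp: mult_ac)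

lemma real_character_values:
  assumes "dirichlet_character q \<chi>" "principal q (\<lambda>n. \<chi> n * \<chi> n)"
  shows "\<chi> a \<in> {0, 1, - 1}"
proof (cases "coprime a q")
  case True
  then have "\<chi> a ^ 2 = 1" using assms(2) by (simp add: principal_def power2_eq_square)
  then show ?thesis by (simp add: power2_eq_1_iff)
qed (use assms(1) in \<open>auto simp: dirichlet_character_def\<close>)

text \<open>For |z| = 1 the two sides differ by 2 (1 + Re z)^2; this is the triangle inequality of
  pretentious distances in the case of a square. The value 0 occurs at primes dividing the
  modulus.\<close>

lemma one_minus_Re_square_le:
  assumes "z = 0 \<or> norm z = 1"
  shows "1 - Re (z * z) \<le> 4 * (1 + Re z)"
  using assms
proof
  assume "norm z = 1"
  then have "(Re z) ^ 2 + (Im z) ^ 2 = 1" using cmod_power2[of z] by simp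
  moreover have "0 \<le> (1 + Re z) ^ 2" by simp
  ultimately show ?thesis by (simp add: power2_eq_square algebra_simps)
qed simp

lemma norm_cis_minus_one_le: "norm (cis x - 1) \<le> \<bar>x\<bar>"
  using dist_exp_i_1[of x] abs_sin_x_le_abs_x[of "x / 2"] by (simp add: cis_conv_exp)

lemma finite_primes_le: "finite {p::nat. prime p \<and> real p \<le> X}"
  by (rule finite_subset[of _ "{..nat \<lfloor>X\<rfloor>}"]) (auto simp: le_nat_floor)

lemma sum_prime_inverse_le:
  assumes "X \<ge> 1"
  shows "(\<Sum>p | prime p \<and> real p \<le> X. 1 / real p) \<le> 1 + ln X"
proof -
  have N: "nat \<lfloor>X\<rfloor> > 0" "real (nat \<lfloor>X\<rfloor>) \<le> X" using assms by auto
  have "(\<Sum>p | prime p \<and> real p \<le> X. 1 / real p) \<le> (\<Sum>n=1..nat \<lfloor>X\<rfloor>. 1 / real n)"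
    by (intro sum_mono2) (auto simp: le_nat_floor dest: prime_ge_1_nat)
  also have "\<dots> \<le> 1 + ln (real (nat \<lfloor>X\<rfloor>))" by (rule sum_inverse_le[OF N(1)])
  also have "\<dots> \<le> 1 + ln X" using N by (intro add_mono ln_mono) auto
  finally show ?thesis .
qed

lemma card_prime_factors_le:
  assumes "n > 0"
  shows "real (card (prime_factors n)) \<le> 2 * ln (real n)"
proof -
  have "2 ^ card (prime_factors n) = (\<Prod>p\<in>prime_factors n. 2::nat)" by simp
  also have "\<dots> \<le> (\<Prod>p\<in>prime_factors n. p ^ multiplicity p n)"
  proof (intro prod_mono conjI)
    fix p assume p: "p \<in> prime_factors n"
    then have "multiplicity p n \<ge> 1" using assms by (simp add: prime_factors_multiplicity)
    then have "p ^ 1 \<le> p ^ multiplicity p n" using p prime_ge_1_nat by (intro power_increasing) auto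
    moreover have "2 \<le> p" using p prime_ge_2_nat by auto
    ultimately show "2 \<le> p ^ multiplicity p n" by simp
  qed simp
  also have "\<dots> = n" using prime_factorization_nat[OF assms] by simp
  finally have "real (2 ^ card (prime_factors n)) \<le> real n" by (rule of_nat_mono)
  then have "ln (2 ^ card (prime_factors n)) \<le> ln (real n)" by (intro ln_mono) auto
  then have "real (card (prime_factors n)) * ln 2 \<le> ln (real n)" by (simp add: ln_realpow)
  moreover have "real (card (prime_factors n)) * (1 / 2) \<le> real (card (prime_factors n)) * ln 2"
    using ln2_ge_two_thirds by (intro mult_left_mono) auto
  ultimately show ?thesis by linarith
qed

text \<open>With m one more than the number of prime factors, those up to m are bounded by a
  harmonic sum, and the at most m - 1 others contribute at most 1/m each. For n bounded by a power
  of ln Y the result is of order ln ln ln Y.\<close>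

lemma sum_inverse_prime_factors_le:
  assumes "n > 0"
  shows "(\<Sum>p\<in>prime_factors n. 1 / real p) \<le> 2 + ln (1 + 2 * ln (real n))"
proof -
  define m where "m = Suc (card (prime_factors n))"
  let ?S = "prime_factors n"
  have "(\<Sum>p\<in>?S. 1 / real p) = (\<Sum>p\<in>{p\<in>?S. p \<le> m}. 1 / real p) + (\<Sum>p\<in>{p\<in>?S. \<not> p \<le> m}. 1 / real p)"
    by (subst sum.union_disjoint[symmetric]) (auto intro!: sum.cong)
  also have "\<dots> \<le> (1 + ln (real m)) + 1"
  proof (rule add_mono)
    have "(\<Sum>p\<in>{p\<in>?S. p \<le> m}. 1 / real p) \<le> (\<Sum>p=1..m. 1 / real p)"
      by (intro sum_mono2) (auto dest!: in_prime_factors_imp_prime prime_ge_1_nat)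
    also have "\<dots> \<le> 1 + ln (real m)" by (rule sum_inverse_le) (simp add: m_def)
    finally show "(\<Sum>p\<in>{p\<in>?S. p \<le> m}. 1 / real p) \<le> 1 + ln (real m)" .
    have "(\<Sum>p\<in>{p\<in>?S. \<not> p \<le> m}. 1 / real p) \<le> (\<Sum>p\<in>{p\<in>?S. \<not> p \<le> m}. 1 / real m)"
      by (intro sum_mono divide_left_mono) (auto simp: m_def)
    also have "\<dots> \<le> real (card ?S) * (1 / real m)"
      unfolding sum_constant by (intro mult_right_mono) (auto intro!: card_mono)
    also have "\<dots> \<le> 1" by (simp add: m_def)
    finally show "(\<Sum>p\<in>{p\<in>?S. \<not> p \<le> m}. 1 / real p) \<le> 1" .
  qed
  also have "ln (real m) \<le> ln (1 + 2 * ln (real n))"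
    using card_prime_factors_le[OF assms] by (intro ln_mono) (auto simp: m_def)
  finally show ?thesis by simp
qed

section \<open>From the hypothesis to real characters\<close>

lemma moderately_aperiodic_liouvilleD:
  assumes "moderately_aperiodic liouville"
  obtains A where "A > 0" "\<And>\<epsilon>. \<epsilon> > 0 \<Longrightarrow> eventually (\<lambda>X::real. \<exists>t \<chi> q. \<bar>t\<bar> \<le> X powr A \<and> real q \<le> ln X powr A \<and> dirichlet_character q \<chi> \<and>
    (\<Sum>p | prime p \<and> real p \<le> X. 1 / real p * (1 + Re (\<chi> p * of_nat p powr (\<i> * of_real t)))) \<le> \<epsilon> * ln (ln X)) at_top"
proof -
  define S where "S A X t = {prime_distance liouville \<chi> t X | q \<chi>. real q \<le> ln X powr A \<and> dirichlet_character q \<chi>}" for A X t :: real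
  obtain A where A: "A > 0" and lim: "((\<lambda>X::real. 1 / ln (ln X) * (INF t\<in>{t. \<bar>t\<bar> \<le> X powr A}. Min (S A X t))) \<longlongrightarrow> 0) at_top"
    using assms unfolding moderately_aperiodic_def S_def by blast
  show thesis
  proof (rule that[OF A])
    fix \<epsilon> :: real assume \<epsilon>: "\<epsilon> > 0"
    have "eventually (\<lambda>X::real. ln X \<ge> 1 \<and> ln (ln X) > 0) at_top" by (intro eventually_conj; real_asymp)
    then show "eventually (\<lambda>X::real. \<exists>t \<chi> q. \<bar>t\<bar> \<le> X powr A \<and> real q \<le> ln X powr A \<and> dirichlet_character q \<chi> \<and>
      (\<Sum>p | prime p \<and> real p \<le> X. 1 / real p * (1 + Re (\<chi> p * of_nat p powr (\<i> * of_real t)))) \<le> \<epsilon> * ln (ln X)) at_top"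
      using order_tendstoD(2)[OF lim \<epsilon>]
    proof eventually_elim
      case (elim X)
      have one: "ln X powr A \<ge> 1" using elim(1) A by (intro ge_one_powr_ge_zero) auto
      have Min: "Min (S A X t) \<in> S A X t" for t
        unfolding S_def by (intro Min_in finite_prime_distances prime_distances_nonempty one)
      have ge0: "Min (S A X t) \<ge> 0" for t
        using Min[of t] prime_distance_nonneg[OF liouville_in_multiplicative_functions] by (auto simp: S_def)
      have "(INF t\<in>{t. \<bar>t\<bar> \<le> X powr A}. Min (S A X t)) < \<epsilon> * ln (ln X)"
        using elim by (simp add: divide_simps)
      moreover have "{t. \<bar>t\<bar> \<le> X powr A} \<noteq> {}" by (auto intro: exI[of _ 0])
      moreover have "bdd_below ((\<lambda>t. Min (S A X t)) ` {t. \<bar>t\<bar> \<le> X powr A})" using ge0 by (intro bdd_belowI[of _ 0]) auto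
      \<comment> \<open>The infimum may fail to be attained; the strict inequality still yields a
        suitable \<open>t\<close>.\<close>
      ultimately obtain t where t: "\<bar>t\<bar> \<le> X powr A" "Min (S A X t) < \<epsilon> * ln (ln X)"
        by (subst (asm) cINF_less_iff) auto
      then obtain q \<chi> where q: "real q \<le> ln X powr A" "dirichlet_character q \<chi>" "prime_distance liouville \<chi> t X < \<epsilon> * ln (ln X)"
        using Min[of t] unfolding S_def by auto
      have "prime_distance liouville \<chi> t X = (\<Sum>p | prime p \<and> real p \<le> X. 1 / real p * (1 + Re (\<chi> p * of_nat p powr (\<i> * of_real t))))"
        unfolding prime_distance_def by (intro sum.cong refl) (auto simp: liouville_def prime_factorization_prime)
      then show ?case using t q by (intro exI[of _ t] exI[of _ \<chi>] exI[of _ q]) auto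
    qed
  qed
qed

lemma Re_character_le_twist:
  assumes "dirichlet_character q \<chi>" "p > 0"
  shows "Re (\<chi> p) \<le> Re (\<chi> p * of_nat p powr (\<i> * of_real t)) + \<bar>t\<bar> * ln (real p)"
proof -
  let ?z = "cis (t * ln (real p))"
  have "Re (\<chi> p) - Re (\<chi> p * ?z) = Re (\<chi> p * (1 - ?z))" by (simp add: algebra_simps)
  also have "\<dots> \<le> norm (\<chi> p * (1 - ?z))" by (rule complex_Re_le_cmod)
  also have "\<dots> = norm (\<chi> p) * norm (?z - 1)" by (simp only: norm_mult norm_minus_commute)
  also have "\<dots> \<le> 1 * \<bar>t * ln (real p)\<bar>"
    by (intro mult_mono norm_dirichlet_character_le_1[OF assms(1)] norm_cis_minus_one_le) auto
  finally show ?thesis using assms(2) by (simp add: nat_powr_imaginary abs_mult)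
qed

text \<open>The hypothesis is used at X with ln X = (ln Y)^3. \<open>distance_to_one_ge\<close> for
  \<chi>^2 and 2t forces \<chi>^2 to be principal and |t| to be at most (ln Y)^(-117/40). Removing
  the twist for p \<le> Y then costs |t| ln Y \<Sum>1/p, at most (ln Y)^(-117/40) (ln Y) (1 + ln Y)
  \<le> 1 for large Y. The cube is the least integral power for which this crude estimate works, as
  117/40 > 2 > 78/40.\<close>

lemma eventually_real_character:
  fixes A \<epsilon> :: real
  assumes A: "A > 0" and \<epsilon>: "\<epsilon> > 0"
    and H: "\<And>\<epsilon>. \<epsilon> > 0 \<Longrightarrow> eventually (\<lambda>X::real. \<exists>t \<chi> q. \<bar>t\<bar> \<le> X powr A \<and> real q \<le> ln X powr A \<and> dirichlet_character q \<chi> \<and>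
      (\<Sum>p | prime p \<and> real p \<le> X. 1 / real p * (1 + Re (\<chi> p * of_nat p powr (\<i> * of_real t)))) \<le> \<epsilon> * ln (ln X)) at_top"
  shows "eventually (\<lambda>Y::real. \<exists>\<chi> q. real q \<le> ln Y powr (3 * A) \<and> dirichlet_character q \<chi> \<and> principal q (\<lambda>n. \<chi> n * \<chi> n) \<and>
      (\<Sum>p | prime p \<and> real p \<le> Y. 1 / real p * (1 + Re (\<chi> p))) \<le> \<epsilon> * ln (ln Y)) at_top"
proof -
  \<comment> \<open>The bound 4 \<delta> \<le> 1/200 stays below 1/100. Since ln ln X = 3 ln ln Y,
    \<delta> \<le> \<epsilon>/6 uses up half of \<epsilon>; the other half covers the cost 1 of the
    twist.\<close>
  define \<delta> where "\<delta> = min (\<epsilon> / 6) (1 / 800)"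
  have \<delta>: "\<delta> > 0" "\<delta> \<le> \<epsilon> / 6" "\<delta> \<le> 1 / 800" using \<epsilon> by (auto simp: \<delta>_def)
  \<comment> \<open>The height doubles in passing from t to 2t, which X^(A + 1) allows.\<close>
  have A1: "A + 1 > 0" using A by simp
  obtain x0 where x0: "\<And>X q \<chi> \<tau>. ln X \<ge> x0 \<and> X > 0 \<and> real q \<le> ln X powr (A + 1) \<and> dirichlet_character q \<chi> \<and> \<bar>\<tau>\<bar> \<le> X powr (A + 1) \<and>
     (principal q \<chi> \<longrightarrow> \<bar>\<tau>\<bar> \<ge> ln X powr (- 39 / 40)) \<Longrightarrow>
     (\<Sum>p | prime p \<and> real p \<le> X. 1 / real p * (1 - Re (\<chi> p * of_nat p powr (\<i> * of_real \<tau>)))) \<ge> ln (ln X) / 100"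
    using distance_to_one_ge[OF A1] by blast
  have lim: "filterlim (\<lambda>Y::real. exp (ln Y ^ 3)) at_top at_top" by real_asymp
  have "eventually (\<lambda>Y::real. ln Y ^ 3 \<ge> x0) at_top" "eventually (\<lambda>Y::real. ln Y \<ge> 1) at_top"
    "eventually (\<lambda>Y::real. \<epsilon> / 2 * ln (ln Y) \<ge> 1) at_top"
    "eventually (\<lambda>Y::real. (ln Y ^ 3) powr (- 39 / 40) * (ln Y * (1 + ln Y)) \<le> 1) at_top"
    using \<epsilon> by real_asymp+
  then show ?thesis using eventually_compose_filterlim[OF H[OF \<delta>(1)] lim] eventually_ge_at_top[of 1]
  proof eventually_elim
    case (elim Y)
    define X where "X = exp (ln Y ^ 3)"
    have lX: "ln X = ln Y ^ 3" and X0: "X > 0" by (simp_all add: X_def)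
    have llY: "ln (ln Y) > 0"
    proof -
      have "0 < \<epsilon> / 2 * ln (ln Y)" using elim(3) by linarith
      then show ?thesis using \<epsilon> by (simp add: zero_less_mult_iff)
    qed
    have llX: "ln (ln X) = 3 * ln (ln Y)" using elim(2) by (simp add: lX ln_realpow)
    have Y: "Y \<ge> 1" "Y > 0" using elim(6) by auto
    have YX: "Y \<le> X"
    proof -
      have "ln Y \<le> ln Y ^ 3" using elim(2) by (intro self_le_power) auto
      then have "exp (ln Y) \<le> X" unfolding X_def by (simp only: exp_le_cancel_iff)
      then show ?thesis using Y by simp
    qed
    obtain t \<chi> q where t: "\<bar>t\<bar> \<le> X powr A" and q: "real q \<le> ln X powr A" and \<chi>: "dirichlet_character q \<chi>"
      and D: "(\<Sum>p | prime p \<and> real p \<le> X. 1 / real p * (1 + Re (\<chi> p * of_nat p powr (\<i> * of_real t)))) \<le> \<delta> * ln (ln X)"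
      using elim(5) unfolding X_def by blast
    let ?z = "\<lambda>p. \<chi> p * of_nat p powr (\<i> * of_real t)"
    have lX1: "ln X \<ge> 1" unfolding lX using elim(2) by (rule one_le_power)
    have X2: "X \<ge> 2" using exp_ge_add_one_self[of "ln X"] lX1 X0 by simp
    have sq: "dirichlet_character q (\<lambda>n. \<chi> n * \<chi> n)" by (rule dirichlet_character_square[OF \<chi>])
    have small: "(\<Sum>p | prime p \<and> real p \<le> X. 1 / real p * (1 - Re ((\<chi> p * \<chi> p) * of_nat p powr (\<i> * of_real (2 * t))))) < ln (ln X) / 100"
    proof -
      have "(\<Sum>p | prime p \<and> real p \<le> X. 1 / real p * (1 - Re ((\<chi> p * \<chi> p) * of_nat p powr (\<i> * of_real (2 * t))))) \<le>
        (\<Sum>p | prime p \<and> real p \<le> X. 4 * (1 / real p * (1 + Re (?z p))))"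
      proof (rule sum_mono)
        fix p assume "p \<in> {p. prime p \<and> real p \<le> X}"
        then have p: "p > 0" by (auto dest: prime_gt_0_nat)
        have zz: "(\<chi> p * \<chi> p) * of_nat p powr (\<i> * of_real (2 * t)) = ?z p * ?z p"
        proof -
          have "cis (2 * t * ln (real p)) = cis (t * ln (real p)) * cis (t * ln (real p))" by (simp add: cis_mult mult.assoc)
          moreover have "w = u * u \<Longrightarrow> (a * a) * w = (a * u) * (a * u)" for a u w :: complex by (simp add: mult_ac)
          ultimately show ?thesis unfolding nat_powr_imaginary[OF p] by blast
        qed
        have "?z p = 0 \<or> norm (?z p) = 1"
          using dirichlet_character_norm[OF \<chi>, of p] unfolding nat_powr_imaginary[OF p] by (auto simp: norm_mult)
        then have "1 - Re (?z p * ?z p) \<le> 4 * (1 + Re (?z p))" by (rule one_minus_Re_square_le)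
        then have "1 / real p * (1 - Re (?z p * ?z p)) \<le> 1 / real p * (4 * (1 + Re (?z p)))"
          by (rule mult_left_mono) simp
        then show "1 / real p * (1 - Re ((\<chi> p * \<chi> p) * of_nat p powr (\<i> * of_real (2 * t)))) \<le> 4 * (1 / real p * (1 + Re (?z p)))"
          unfolding zz by (simp only: mult.left_commute)
      qed
      also have "\<dots> \<le> 4 * (\<delta> * ln (ln X))" unfolding sum_distrib_left[symmetric] using D by simp
      also have "\<dots> \<le> 4 * (1 / 800 * ln (ln X))" using \<delta>(3) llX llY by (intro mult_left_mono mult_right_mono) auto
      also have "\<dots> < ln (ln X) / 100" using llX llY by simp
      finally show ?thesis .
    qed
    have "\<not> (principal q (\<lambda>n. \<chi> n * \<chi> n) \<longrightarrow> \<bar>2 * t\<bar> \<ge> ln X powr (- 39 / 40))"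
    proof
      assume a: "principal q (\<lambda>n. \<chi> n * \<chi> n) \<longrightarrow> \<bar>2 * t\<bar> \<ge> ln X powr (- 39 / 40)"
      have "ln X powr A \<le> ln X powr (A + 1)" using lX1 by (intro powr_mono) auto
      then have "real q \<le> ln X powr (A + 1)" using q by linarith
      moreover have "\<bar>2 * t\<bar> \<le> X powr (A + 1)"
      proof -
        have "2 * \<bar>t\<bar> \<le> X * X powr A" using X2 t by (intro mult_mono) auto
        then show ?thesis using X0 by (simp add: powr_add mult.commute abs_mult)
      qed
      ultimately show False using x0[of X q "\<lambda>n. \<chi> n * \<chi> n" "2 * t"] a sq small X0 elim(1) lX by force
    qed
    then have pr: "principal q (\<lambda>n. \<chi> n * \<chi> n)" and t': "\<bar>t\<bar> \<le> (ln Y ^ 3) powr (- 39 / 40)" using lX by auto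
    have "(\<Sum>p | prime p \<and> real p \<le> Y. 1 / real p * (1 + Re (\<chi> p))) \<le>
      (\<Sum>p | prime p \<and> real p \<le> Y. 1 / real p * (1 + Re (?z p)) + (\<bar>t\<bar> * ln Y) * (1 / real p))"
    proof (rule sum_mono)
      fix p assume "p \<in> {p. prime p \<and> real p \<le> Y}"
      then have p: "p > 0" "real p \<le> Y" by (auto dest: prime_gt_0_nat)
      then have "\<bar>t\<bar> * ln (real p) \<le> \<bar>t\<bar> * ln Y" by (intro mult_left_mono ln_mono) auto
      then have "1 + Re (\<chi> p) \<le> (1 + Re (?z p)) + \<bar>t\<bar> * ln Y" using Re_character_le_twist[OF \<chi> p(1), of t] by linarith
      then have "1 / real p * (1 + Re (\<chi> p)) \<le> 1 / real p * ((1 + Re (?z p)) + \<bar>t\<bar> * ln Y)" by (rule mult_left_mono) simp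
      then show "1 / real p * (1 + Re (\<chi> p)) \<le> 1 / real p * (1 + Re (?z p)) + (\<bar>t\<bar> * ln Y) * (1 / real p)"
        by (simp only: distrib_left mult.commute)
    qed
    also have "\<dots> = (\<Sum>p | prime p \<and> real p \<le> Y. 1 / real p * (1 + Re (?z p))) + \<bar>t\<bar> * ln Y * (\<Sum>p | prime p \<and> real p \<le> Y. 1 / real p)"
      by (simp only: sum.distrib sum_distrib_left)
    also have "\<dots> \<le> \<delta> * ln (ln X) + 1"
    proof (rule add_mono)
      have "(\<Sum>p | prime p \<and> real p \<le> Y. 1 / real p * (1 + Re (?z p))) \<le> (\<Sum>p | prime p \<and> real p \<le> X. 1 / real p * (1 + Re (?z p)))"
      proof (rule sum_mono2[OF finite_primes_le])
        fix p assume "p \<in> {p. prime p \<and> real p \<le> X} - {p. prime p \<and> real p \<le> Y}"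
        then have "norm (?z p) \<le> 1" using norm_character_twist_le[OF \<chi>] by auto
        then have "1 + Re (?z p) \<ge> 0" using abs_Re_le_cmod[of "?z p"] by linarith
        then show "0 \<le> 1 / real p * (1 + Re (?z p))" by (intro mult_nonneg_nonneg) auto
      qed (use YX in auto)
      then show "(\<Sum>p | prime p \<and> real p \<le> Y. 1 / real p * (1 + Re (?z p))) \<le> \<delta> * ln (ln X)" using D by linarith
      have "\<bar>t\<bar> * (ln Y * (\<Sum>p | prime p \<and> real p \<le> Y. 1 / real p)) \<le> (ln Y ^ 3) powr (- 39 / 40) * (ln Y * (1 + ln Y))"
        using t' elim(2) by (intro mult_mono sum_prime_inverse_le[OF Y(1)] mult_nonneg_nonneg sum_nonneg) auto
      then show "\<bar>t\<bar> * ln Y * (\<Sum>p | prime p \<and> real p \<le> Y. 1 / real p) \<le> 1" using elim(4) unfolding mult.assoc by linarith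
    qed
    also have "\<dots> \<le> \<epsilon> * ln (ln Y)"
    proof -
      have "\<delta> * (3 * ln (ln Y)) \<le> \<epsilon> / 6 * (3 * ln (ln Y))" using \<delta>(2) llY by (intro mult_right_mono) auto
      then show ?thesis unfolding llX using elim(3) by simp
    qed
    finally have "(\<Sum>p | prime p \<and> real p \<le> Y. 1 / real p * (1 + Re (\<chi> p))) \<le> \<epsilon> * ln (ln Y)" .
    moreover have "ln X powr A = ln Y powr (3 * A)"
    proof -
      have "ln Y ^ 3 = ln Y powr 3" using elim(2) by (simp add: powr_numeral)
      then show ?thesis unfolding lX by (simp only: powr_powr)
    qed
    ultimately show ?case using q \<chi> pr by (intro exI[of _ \<chi>] exI[of _ q]) auto
  qed
qed

theorem proposition4p3:
  shows "\<not> moderately_aperiodic liouville"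
proof
  assume "moderately_aperiodic liouville"
  then obtain A0 where A0: "A0 > 0" and H: "\<And>\<epsilon>. \<epsilon> > 0 \<Longrightarrow> eventually (\<lambda>X::real. \<exists>t \<chi> q. \<bar>t\<bar> \<le> X powr A0 \<and> real q \<le> ln X powr A0 \<and> dirichlet_character q \<chi> \<and>
    (\<Sum>p | prime p \<and> real p \<le> X. 1 / real p * (1 + Re (\<chi> p * of_nat p powr (\<i> * of_real t)))) \<le> \<epsilon> * ln (ln X)) at_top"
    by (rule moderately_aperiodic_liouvilleD) blast
  \<comment> \<open>A bounds the moduli of the real characters, by (ln X)^A0 = (ln Y)^(3 A0). B
    makes q^16 \<le> (ln Y)^(16 A) at most ln Z = (ln Y)^B. C bounds the product of the moduli found
    at Y and Z. Finally \<epsilon> (1 + B) = 1/200 lies below the constant 1/100 of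
    \<open>distance_to_one_ge\<close>.\<close>
  define A where "A = 3 * A0"
  define B where "B = 16 * A + 1"
  define C where "C = A * (1 + B)"
  define \<epsilon> where "\<epsilon> = 1 / (200 * (1 + B))"
  have A: "A > 0" and B: "B \<ge> 1" and B0: "B > 0" and C: "C > 0" using A0 by (auto simp: A_def B_def C_def)
  have \<epsilon>: "\<epsilon> > 0" "\<epsilon> * (1 + B) = 1 / 200" using B by (auto simp: \<epsilon>_def)
  define good where "good Y \<chi> q \<longleftrightarrow> real q \<le> ln Y powr A \<and> dirichlet_character q \<chi> \<and> principal q (\<lambda>n. \<chi> n * \<chi> n) \<and>
      (\<Sum>p | prime p \<and> real p \<le> Y. 1 / real p * (1 + Re (\<chi> p))) \<le> \<epsilon> * ln (ln Y)" for Y :: real and \<chi> q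
  have good: "eventually (\<lambda>Y. \<exists>\<chi> q. good Y \<chi> q) at_top"
    unfolding good_def A_def by (rule eventually_real_character[OF A0 \<epsilon>(1) H])
  have pow: "filterlim (\<lambda>Y::real. ln Y powr B) at_top at_top" using B0 by real_asymp
  have lim: "filterlim (\<lambda>Y::real. exp (ln Y powr B)) at_top at_top"
    by (rule filterlim_compose[OF exp_at_top pow])
  obtain x0 where x0: "\<And>X q \<chi> \<tau>. ln X \<ge> x0 \<and> X > 0 \<and> real q \<le> ln X powr C \<and> dirichlet_character q \<chi> \<and> \<bar>\<tau>\<bar> \<le> X powr C \<and>
     (principal q \<chi> \<longrightarrow> \<bar>\<tau>\<bar> \<ge> ln X powr (- 39 / 40)) \<Longrightarrow>
     (\<Sum>p | prime p \<and> real p \<le> X. 1 / real p * (1 - Re (\<chi> p * of_nat p powr (\<i> * of_real \<tau>)))) \<ge> ln (ln X) / 100"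
    using distance_to_one_ge[OF C] by blast
  obtain y0 where y0: "\<And>Y q \<chi>. ln Y \<ge> y0 \<and> Y > 0 \<and> dirichlet_character q \<chi> \<and> principal q (\<lambda>n. \<chi> n * \<chi> n) \<and> real q ^ 16 \<le> ln Y \<Longrightarrow>
     (\<Sum>p | prime p \<and> real p \<le> Y. 1 / real p * (1 + Re (\<chi> p))) \<ge> ln (ln Y) / 4"
    using real_character_distance_ge by blast
  have "eventually (\<lambda>Y::real. ln Y \<ge> x0) at_top" "eventually (\<lambda>Y::real. ln Y > 1) at_top"
    "eventually (\<lambda>Y::real. 2 * (2 + ln (1 + 2 * (C * ln (ln Y)))) < ln (ln Y) / 5) at_top"
    using B0 C by real_asymp+
  moreover have "eventually (\<lambda>Y::real. ln Y powr B \<ge> y0) at_top"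
    using pow by (simp add: filterlim_at_top)
  ultimately have "eventually (\<lambda>Y::real. False) at_top"
    using good eventually_compose_filterlim[OF good lim] eventually_gt_at_top[of 0]
  proof eventually_elim
    case (elim Y)
    define y where "y = ln Y"
    define Z where "Z = exp (y powr B)"
    have y1: "y > 1" and lny: "ln y > 0" using elim(2) by (auto simp: y_def)
    have Y0: "Y > 0" using elim(7) .
    have lZ: "ln Z = y powr B" "ln (ln Z) = B * ln y" and Z0: "Z > 0" using y1 by (simp_all add: Z_def ln_powr)
    obtain \<chi> q where "good Y \<chi> q" using elim(5) by blast
    then have q: "real q \<le> y powr A" and \<chi>: "dirichlet_character q \<chi>" and \<chi>2: "principal q (\<lambda>n. \<chi> n * \<chi> n)"
      and D1: "(\<Sum>p | prime p \<and> real p \<le> Y. 1 / real p * (1 + Re (\<chi> p))) \<le> \<epsilon> * ln y"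
      by (auto simp: good_def y_def)
    obtain \<psi> r where "good Z \<psi> r" using elim(6) unfolding Z_def y_def by blast
    then have r: "real r \<le> (y powr B) powr A" and \<psi>: "dirichlet_character r \<psi>" and \<psi>2: "principal r (\<lambda>n. \<psi> n * \<psi> n)"
      and D2: "(\<Sum>p | prime p \<and> real p \<le> Z. 1 / real p * (1 + Re (\<psi> p))) \<le> \<epsilon> * (B * ln y)"
      unfolding good_def lZ by auto
    have v: "\<chi> n \<in> {0, 1, - 1}" "\<psi> n \<in> {0, 1, - 1}" for n
      by (rule real_character_values[OF \<chi> \<chi>2], rule real_character_values[OF \<psi> \<psi>2])
    have nn: "0 \<le> 1 / real p * (1 + Re (\<psi> p))" for p using v(2)[of p] by auto
    have YZ: "Y \<le> Z"
    proof -
      have "y powr 1 \<le> y powr B" using y1 B by (intro powr_mono) auto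
      then have "exp y \<le> Z" using y1 by (simp add: Z_def)
      then show ?thesis using Y0 by (simp add: y_def)
    qed
    have qr: "real (q * r) \<le> y powr C"
    proof -
      have "real q * real r \<le> y powr A * (y powr B) powr A" using q r by (intro mult_mono) auto
      also have "\<dots> = y powr C" by (simp add: powr_powr C_def algebra_simps flip: powr_add)
      finally show ?thesis by simp
    qed
    have \<chi>\<psi>: "dirichlet_character (q * r) (\<lambda>n. \<chi> n * \<psi> n)" by (rule dirichlet_character_mult[OF \<chi> \<psi>])
    \<comment> \<open>Both \<chi> and \<psi> are close to -1 at the primes up to Y, so their product
      is close to 1; \<open>distance_to_one_ge\<close> with \<tau> = 0 excludes this for a
      nonprincipal product.\<close>
    have "principal (q * r) (\<lambda>n. \<chi> n * \<psi> n)"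
    proof (rule ccontr)
      assume np: "\<not> principal (q * r) (\<lambda>n. \<chi> n * \<psi> n)"
      have "ln (ln Y) / 100 \<le> (\<Sum>p | prime p \<and> real p \<le> Y. 1 / real p * (1 - Re ((\<chi> p * \<psi> p) * of_nat p powr (\<i> * of_real 0))))"
        by (rule x0[of Y "q * r" "\<lambda>n. \<chi> n * \<psi> n" 0]) (use np \<chi>\<psi> qr elim(1) Y0 in \<open>auto simp: y_def\<close>)
      also have "\<dots> \<le> (\<Sum>p | prime p \<and> real p \<le> Y. 1 / real p * (1 + Re (\<chi> p)) + 1 / real p * (1 + Re (\<psi> p)))"
      proof (rule sum_mono)
        fix p assume "p \<in> {p. prime p \<and> real p \<le> Y}"
        then have p: "p > 0" by (auto dest: prime_gt_0_nat)
        \<comment> \<open>For the real values a and b of the two characters this is 0 \<le> (1 +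
          a)(1 + b).\<close>
        have "1 - Re (\<chi> p * \<psi> p) \<le> (1 + Re (\<chi> p)) + (1 + Re (\<psi> p))" using v[of p] by auto
        then have "1 / real p * (1 - Re (\<chi> p * \<psi> p)) \<le> 1 / real p * ((1 + Re (\<chi> p)) + (1 + Re (\<psi> p)))"
          by (rule mult_left_mono) simp
        then show "1 / real p * (1 - Re ((\<chi> p * \<psi> p) * of_nat p powr (\<i> * of_real 0))) \<le> 1 / real p * (1 + Re (\<chi> p)) + 1 / real p * (1 + Re (\<psi> p))"
          unfolding distrib_left[symmetric] using p by simp
      qed
      also have "\<dots> = (\<Sum>p | prime p \<and> real p \<le> Y. 1 / real p * (1 + Re (\<chi> p))) + (\<Sum>p | prime p \<and> real p \<le> Y. 1 / real p * (1 + Re (\<psi> p)))"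
        by (rule sum.distrib)
      also have "(\<Sum>p | prime p \<and> real p \<le> Y. 1 / real p * (1 + Re (\<psi> p))) \<le> (\<Sum>p | prime p \<and> real p \<le> Z. 1 / real p * (1 + Re (\<psi> p)))"
        by (rule sum_mono2[OF finite_primes_le]) (use YZ nn in auto)
      finally have "ln y / 100 \<le> \<epsilon> * ln y + \<epsilon> * (B * ln y)" using D1 D2 unfolding y_def by linarith
      also have "\<dots> = (\<epsilon> * (1 + B)) * ln y" by (simp add: algebra_simps)
      finally show False unfolding \<epsilon>(2) using lny by simp
    qed
    then have eq: "\<chi> p = \<psi> p" if "prime p" "\<not> p dvd q * r" for p
    proof -
      assume "principal (q * r) (\<lambda>n. \<chi> n * \<psi> n)"
      moreover have "coprime p (q * r)" using that by (rule prime_imp_coprime)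
      ultimately have "\<chi> p * \<psi> p = 1" unfolding principal_def by blast
      then show ?thesis using v[of p] by auto
    qed
    have qr0: "q * r > 0" using \<chi> \<psi> by (simp add: dirichlet_character_def)
    \<comment> \<open>Measured against ln Z, the modulus of \<chi> is small enough for
      \<open>real_character_distance_ge\<close>.\<close>
    have "B * ln y / 4 \<le> (\<Sum>p | prime p \<and> real p \<le> Z. 1 / real p * (1 + Re (\<chi> p)))"
    proof -
      have "real q ^ 16 \<le> (y powr A) ^ 16" using q by (intro power_mono) auto
      also have "\<dots> = y powr (16 * A)" using y1 by (simp add: powr_power)
      also have "\<dots> \<le> y powr B" using y1 by (intro powr_mono) (auto simp: B_def)
      finally show ?thesis using y0[of Z q \<chi>] elim(4) \<chi> \<chi>2 Z0 unfolding lZ y_def by auto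
    qed
    \<comment> \<open>Beyond Y the closeness of \<chi> to -1 is borrowed from \<psi>, with which it
      agrees at primes not dividing q r; the remaining primes cost at most 2/p each.\<close>
    also have "\<dots> \<le> (\<Sum>p | prime p \<and> real p \<le> Z. 1 / real p * (1 + Re (\<psi> p)) + (if p dvd q * r then 2 * (1 / real p) else 0))"
    proof (rule sum_mono)
      fix p assume p: "p \<in> {p. prime p \<and> real p \<le> Z}"
      show "1 / real p * (1 + Re (\<chi> p)) \<le> 1 / real p * (1 + Re (\<psi> p)) + (if p dvd q * r then 2 * (1 / real p) else 0)"
      proof (cases "p dvd q * r")
        case True
        have "1 + Re (\<chi> p) \<le> 2" using v(1)[of p] by auto
        then have "1 / real p * (1 + Re (\<chi> p)) \<le> 1 / real p * 2" by (rule mult_left_mono) simp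
        then show ?thesis using True nn[of p] by simp
      qed (use eq[of p] p in simp)
    qed
    also have "\<dots> = (\<Sum>p | prime p \<and> real p \<le> Z. 1 / real p * (1 + Re (\<psi> p))) + 2 * (\<Sum>p\<in>{p\<in>{p. prime p \<and> real p \<le> Z}. p dvd q * r}. 1 / real p)"
      unfolding sum.distrib sum.inter_filter[OF finite_primes_le, symmetric] sum_distrib_left ..
    also have "(\<Sum>p\<in>{p\<in>{p. prime p \<and> real p \<le> Z}. p dvd q * r}. 1 / real p) \<le> (\<Sum>p\<in>prime_factors (q * r). 1 / real p)"
      using qr0 by (intro sum_mono2) (auto simp: prime_factors_dvd)
    also have "\<dots> \<le> 2 + ln (1 + 2 * ln (real (q * r)))" by (rule sum_inverse_prime_factors_le[OF qr0])
    also have "\<dots> \<le> 2 + ln (1 + 2 * (C * ln y))"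
    proof -
      have "ln (real (q * r)) \<le> ln (y powr C)" using qr qr0 by (intro ln_mono) auto
      then have "ln (real (q * r)) \<le> C * ln y" using y1 by (simp add: ln_powr)
      moreover have "real 1 \<le> real (q * r)" by (rule of_nat_mono) (use qr0 in linarith)
      then have "0 \<le> ln (real (q * r))" by (intro ln_ge_zero) (simp only: of_nat_1)
      ultimately show ?thesis by (intro add_left_mono ln_mono) auto
    qed
    \<comment> \<open>This is contradictory because B \<ge> 1 and 1/4 > 1/200 + 1/5.\<close>
    finally have le: "B * ln y / 4 \<le> \<epsilon> * (B * ln y) + 2 * (2 + ln (1 + 2 * (C * ln y)))" using D2 by linarith
    have "\<epsilon> * (B * ln y) \<le> (\<epsilon> * (1 + B)) * ln y" using \<epsilon>(1) lny by (simp add: algebra_simps)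
    then have "\<epsilon> * (B * ln y) \<le> ln y / 200" unfolding \<epsilon>(2) by simp
    moreover have "1 * ln y \<le> B * ln y" using B lny by (intro mult_right_mono) auto
    ultimately show ?case using le elim(3) lny unfolding y_def[symmetric] by linarith
  qed
  then show False by simp
qed

end
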